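(* Fix a real number $\vartheta$ with $0<\vartheta<1$ and a constant $A>0$. Then there exist $x_0$ and $C>0$ such that for all real $x\ge x_0$ and all real $z>0$ with $|\log z|\le A\log\log x$, \[ \left|B(x,z)-z\,S_\vartheta(x)\right|\le C\,z\,S_\vartheta(x)\sqrt{\frac{\log\log x}{\log x}}. \]
   Context: For a natural number $m$, let $k(m)$ denote the largest square-free divisor of $m$. For fixed $\vartheta\in(0,1)$ and real $x\ge1$, let $S_\vartheta(x)$ be the number of natural numbers $m\le x$ with $k(m)\le m^{\vartheta}$, and for $z>0$ let $B(x,z)$ be the number of natural numbers $n\le x$ with $k(n)\le z\,n^{\vartheta}$. *)

theory Defs
  imports "HOL-Analysis.Analysis" "HOL-Computational_Algebra.Primes"
begin

definition kernel :: "nat \<Rightarrow> nat" where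
  "kernel m = (\<Prod>p\<in>prime_factors m. p)"

definition S_count :: "real \<Rightarrow> real \<Rightarrow> nat" where
  "S_count \<theta> x = card {m::nat. 1 \<le> m \<and> real m \<le> x \<and> real (kernel m) \<le> real m powr \<theta>}"

definition B_count :: "real \<Rightarrow> real \<Rightarrow> real \<Rightarrow> nat" where
  "B_count \<theta> x z = card {n::nat. 1 \<le> n \<and> real n \<le> x \<and> real (kernel n) \<le> z * real n powr \<theta>}"

end

theory Submission
  imports Defs "HOL-Real_Asymp.Real_Asymp"
begin

text \<open>
  Writing \<open>m = n k(n) l\<close> with \<open>n = m / k(m)\<close> and \<open>l\<close> squarefree and coprime to \<open>n\<close>, one finds that
  \<open>B(x, z)\<close> is, up to a small error and a constant, \<open>z x\<^sup>\<theta>\<close> times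
  \<open>L(t) = \<Sum>\<^sub>n w(t - ln n) / \<psi>(n)\<close>. Here \<open>\<psi>(n) = \<Prod>\<^bsub>p | n\<^esub> (p + 1)\<close>,
  \<open>t = (1 - \<theta>) ln x - ln z\<close>, and \<open>w\<close> is a tent function decaying exponentially on both sides.
  One has to show that \<open>L\<close> changes by a relative \<open>O(\<surd>(ln t / t))\<close> when \<open>t\<close> moves by \<open>O(ln t)\<close>.

  Let \<open>N(t)\<close> be the sum of \<open>1 / \<psi>(n)\<close> over \<open>n \<le> e\<^sup>t\<close>, possibly with one or two primes excluded.
  Weighting by \<open>ln n\<close> and Mertens-type bounds give that \<open>N\<close> changes by bounded factors on the scale
  \<open>\<surd>(t ln t)\<close>. Hence excluding a prime \<open>p\<close> costs a factor \<open>O(p ln p / \<surd>(t ln t))\<close>, and \<open>N\<close> changes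
  by a relative \<open>O(u / \<surd>(t ln t))\<close> when \<open>t\<close> moves by \<open>u \<ge> 1\<close>.

  Finally, summing over the powers of 2 dividing \<open>n\<close> turns \<open>w\<close> into a Lipschitz function of period
  \<open>ln 2\<close>. Its mean produces a multiple of \<open>N\<close> over odd integers. The \<open>k\<close>-th harmonic has
  coefficient \<open>O(1 / k\<^sup>2)\<close> and produces a sum twisted by \<open>n\<^bsup>i\<tau>\<^esup>\<close>, \<open>\<tau> = 2 \<pi> k / ln 2\<close>, which is
  \<open>O(k / \<surd>(t ln t)) N\<close> by a geometric series in a single prime \<open>p = O(\<surd>k)\<close> for which \<open>p\<^bsup>i\<tau>\<^esup>\<close>
  stays away from 1.
\<close>

section \<open>Sums over primes\<close>

text \<open>The tent has width of order 1, while direct estimates control \<open>N\<close> only on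
  the much longer scale \<surd>(t ln t); the prime 2 bridges this gap. The rate comes from two equal
  losses. Harmonic k contributes 1 / k^2 times k / \<surd>(t ln t), and summing over k up to a power
  of t gives ln t / \<surd>(t ln t) = \<surd>(ln t / t). Moving t by |ln z| = O(ln t) costs the
  same. The constant in front of \<open>N\<close> is never evaluated: it is a mean of finitely many
  samples whose number depends on x alone. So one main term serves both B(x, z) and z S(x) = z B(x,
  1), and only a positive lower bound for it matters. The error in counting squarefree l is useless
  when k(n) is close to the length of the range. Interpolating with the trivial bound leaves a
  factor k(n)^\<lambda> with \<lambda> of order 1 / \<surd>(t ln t). Sums with this factor are still
  \<open>N(t)\<close> up to powers of t, because \<open>N\<close> decays exponentially at just that
  rate to the left of t.\<close>

lemma ln_eq_sum_multiplicity:
  fixes n :: nat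
  assumes "n > 0" "finite P" "prime_factors n \<subseteq> P" "\<And>p. p \<in> P \<Longrightarrow> prime p"
  shows "ln (real n) = (\<Sum>p\<in>P. real (multiplicity p n) * ln (real p))"
proof -
  have "real n = (\<Prod>p\<in>prime_factors n. real p ^ multiplicity p n)"
    using prime_factorization_nat[of n] assms(1) by (metis (no_types, lifting) of_nat_power of_nat_prod prod.cong)
  hence "ln (real n) = ln (\<Prod>p\<in>prime_factors n. real p ^ multiplicity p n)" by simp
  also have "\<dots> = (\<Sum>p\<in>prime_factors n. ln (real p ^ multiplicity p n))"
    by (rule ln_prod) (auto simp: prime_gt_0_nat in_prime_factors_iff)
  also have "\<dots> = (\<Sum>p\<in>prime_factors n. real (multiplicity p n) * ln (real p))"
    by (simp add: ln_realpow)
  also have "\<dots> = (\<Sum>p\<in>P. real (multiplicity p n) * ln (real p))"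
  proof (intro sum.mono_neutral_left assms ballI)
    fix p assume p: "p \<in> P - prime_factors n"
    hence "\<not> p dvd n" using assms by (auto simp: in_prime_factors_iff)
    thus "real (multiplicity p n) * ln (real p) = 0" by (simp add: not_dvd_imp_multiplicity_0)
  qed
  finally show ?thesis .
qed

text \<open>The cut-off J only has to reach n, so one J serves a whole range of n and the sums over
  n and j can be exchanged.\<close>

lemma multiplicity_eq_card_powers:
  fixes p n J :: nat
  assumes "prime p" "n > 0" "n \<le> J"
  shows "multiplicity p n = (\<Sum>j=1..J. of_bool (p ^ j dvd n))"
proof -
  have *: "multiplicity p n \<le> J"
  proof -
    have "p ^ multiplicity p n dvd n" by (rule multiplicity_dvd)
    hence "p ^ multiplicity p n \<le> n" using assms by (simp add: dvd_imp_le)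
    moreover have "multiplicity p n < 2 ^ multiplicity p n" by (rule less_exp)
    moreover have "2 ^ multiplicity p n \<le> p ^ multiplicity p n"
      using assms(1) by (intro power_mono) (auto simp: prime_ge_2_nat)
    ultimately show ?thesis using assms by linarith
  qed
  have "p ^ j dvd n \<longleftrightarrow> j \<le> multiplicity p n" for j
    using assms by (intro power_dvd_iff_le_multiplicity) auto
  hence "(\<Sum>j=1..J. of_bool (p ^ j dvd n)) = (\<Sum>j=1..J. of_bool (j \<le> multiplicity p n) :: nat)" by simp
  also have "\<dots> = card ({1..J} \<inter> {j. j \<le> multiplicity p n})"
    by (simp add: sum.If_cases of_bool_def)
  also have "{1..J} \<inter> {j. j \<le> multiplicity p n} = {1..multiplicity p n}" using * by auto
  finally show ?thesis by simp
qed

lemma card_multiples: "d > 0 \<Longrightarrow> (\<Sum>m=1..n. of_bool (d dvd m)) = n div d" for n d :: nat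
proof (induction n)
  case (Suc n)
  thus ?case by (auto simp: div_Suc dvd_eq_mod_eq_0)
qed simp

text \<open>Legendre's formula with the exponents left as sums of multiplicities; two-sided bounds
  for ln n! then become bounds for prime sums.\<close>

lemma ln_fact_eq:
  fixes n :: nat
  shows "ln (fact n :: real) = (\<Sum>p | prime p \<and> p \<le> n. (\<Sum>m=1..n. real (multiplicity p m)) * ln (real p))"
proof -
  have "ln (fact n :: real) = (\<Sum>m=1..n. ln (real m))"
    unfolding fact_prod of_nat_prod by (subst ln_prod) auto
  also have "\<dots> = (\<Sum>m=1..n. \<Sum>p | prime p \<and> p \<le> n. real (multiplicity p m) * ln (real p))"
    by (intro sum.cong refl ln_eq_sum_multiplicity)
       (auto simp: in_prime_factors_iff intro: order_trans[OF dvd_imp_le])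
  also have "\<dots> = (\<Sum>p | prime p \<and> p \<le> n. \<Sum>m=1..n. real (multiplicity p m) * ln (real p))"
    by (rule sum.swap)
  finally show ?thesis by (simp add: sum_distrib_right)
qed

lemma sum_half_powers_le: "(\<Sum>j<n. (1 / 2 :: real) ^ j) \<le> 2"
  by (subst geometric_sum) auto

text \<open>The exponent of p in n! is the sum of the floors of n / p^j. Its first term is the lower
  bound; the upper bound is the geometric series with ratio 1 / p \<le> 1/2.\<close>

lemma sum_multiplicity_bounds:
  fixes p n :: nat
  assumes "prime p"
  shows "real (n div p) \<le> (\<Sum>m=1..n. real (multiplicity p m))"
    and "(\<Sum>m=1..n. real (multiplicity p m)) \<le> 2 * real n / real p"
proof -
  have p2: "real p \<ge> 2" using assms prime_ge_2_nat by fastforce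
  have eq: "(\<Sum>m=1..n. multiplicity p m) = (\<Sum>j=1..n. n div p ^ j)"
  proof -
    have "(\<Sum>m=1..n. multiplicity p m) = (\<Sum>m=1..n. \<Sum>j=1..n. of_bool (p ^ j dvd m))"
      by (intro sum.cong refl multiplicity_eq_card_powers) (use assms in auto)
    also have "\<dots> = (\<Sum>j=1..n. \<Sum>m=1..n. of_bool (p ^ j dvd m))" by (rule sum.swap)
    also have "\<dots> = (\<Sum>j=1..n. n div p ^ j)"
      by (intro sum.cong refl card_multiples) (use assms prime_gt_0_nat in auto)
    finally show ?thesis .
  qed
  have eq': "(\<Sum>m=1..n. real (multiplicity p m)) = (\<Sum>j=1..n. real (n div p ^ j))"
    using arg_cong[OF eq, of real] by simp
  show "real (n div p) \<le> (\<Sum>m=1..n. real (multiplicity p m))"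
  proof (cases "n = 0")
    case False
    have "(\<Sum>j\<in>{1}. real (n div p ^ j)) \<le> (\<Sum>j=1..n. real (n div p ^ j))"
      by (rule sum_mono2) (use False in auto)
    thus ?thesis unfolding eq' by simp
  qed simp
  have "(\<Sum>j=1..n. real (n div p ^ j)) \<le> (\<Sum>j=1..n. real n * (1 / real p) ^ j)"
  proof (rule sum_mono)
    fix j
    have "real (n div p ^ j) \<le> real n / real (p ^ j)" by (rule of_nat_div_le_of_nat)
    thus "real (n div p ^ j) \<le> real n * (1 / real p) ^ j" by (simp add: power_divide)
  qed
  also have "\<dots> = real n * (\<Sum>j=1..n. (1 / real p) ^ j)" by (simp add: sum_distrib_left)
  also have "\<dots> \<le> real n * (2 / real p)"
  proof (rule mult_left_mono)
  show "(\<Sum>j=1..n. (1 / real p) ^ j) \<le> 2 / real p"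
  proof -
    have "(\<Sum>j=1..n. (1 / real p) ^ j) = (1 / real p) * (\<Sum>j<n. (1 / real p) ^ j)"
      unfolding sum_distrib_left
      by (rule sum.reindex_bij_witness[of _ Suc "\<lambda>j. j - 1"]) (auto simp: power_Suc[symmetric] simp del: power_Suc)
    also have "(\<Sum>j<n. (1 / real p) ^ j) \<le> (\<Sum>j<n. (1 / 2) ^ j)"
      by (intro sum_mono power_mono) (use p2 in \<open>auto simp: field_simps\<close>)
    also have "(\<Sum>j<n. (1 / 2 :: real) ^ j) \<le> 2" by (rule sum_half_powers_le)
    finally show ?thesis using p2 by (simp add: divide_right_mono)
  qed
  qed auto
  finally show "(\<Sum>m=1..n. real (multiplicity p m)) \<le> 2 * real n / real p"
    unfolding eq' by (simp add: mult.commute)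
qed

text \<open>One half of Mertens' first theorem up to a factor 2: n! \<le> n^n, and for p \<le> n the
  floor of n / p is at least n / (2 p). Only orders of magnitude matter later.\<close>

lemma sum_ln_prime_over_prime_le_nat:
  assumes "n \<ge> 1"
  shows "(\<Sum>p | prime p \<and> p \<le> n. ln (real p) / real p) \<le> 2 * ln (real n)"
proof -
  have "real n * (\<Sum>p | prime p \<and> p \<le> n. ln (real p) / real p) / 2 =
        (\<Sum>p | prime p \<and> p \<le> n. (real n / (2 * real p)) * ln (real p))"
    by (simp add: sum_distrib_left sum_divide_distrib field_simps)
  also have "\<dots> \<le> (\<Sum>p | prime p \<and> p \<le> n. (\<Sum>m=1..n. real (multiplicity p m)) * ln (real p))"
  proof (intro sum_mono mult_right_mono)
    fix p assume p: "p \<in> {p. prime p \<and> p \<le> n}"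
    hence "p > 0" "n div p \<ge> 1" by (auto simp: prime_gt_0_nat div_greater_zero_iff Suc_le_eq)
    have "n < p * (n div p + 1)" using \<open>p > 0\<close> by (metis add.commute dividend_less_div_times mult.commute mult_Suc_right plus_1_eq_Suc)
    also have "\<dots> \<le> p * (2 * (n div p))" using \<open>n div p \<ge> 1\<close> by (intro mult_left_mono) auto
    finally have "real n \<le> real (p * (2 * (n div p)))" by linarith
    hence "real n / (2 * real p) \<le> real (n div p)" using \<open>p > 0\<close> by (simp add: field_simps)
    also have "\<dots> \<le> (\<Sum>m=1..n. real (multiplicity p m))" using p sum_multiplicity_bounds(1) by blast
    finally show "real n / (2 * real p) \<le> (\<Sum>m=1..n. real (multiplicity p m))" .
    show "0 \<le> ln (real p)" using \<open>p > 0\<close> by simp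
  qed
  also have "\<dots> = ln (fact n)" by (rule ln_fact_eq[symmetric])
  also have "\<dots> \<le> ln (real n ^ n)"
    using fact_le_power[of n, where 'a = real] assms by (intro ln_mono) auto
  also have "\<dots> = real n * ln (real n)" using assms by (simp add: ln_realpow)
  finally show ?thesis using assms by simp
qed

lemma ln_fact_ge: "n \<ge> 1 \<Longrightarrow> ln (fact n :: real) \<ge> real n * ln (real n) - real n"
proof (induction n rule: nat_induct_at_least)
  case (Suc n)
  have n: "real n > 0" using Suc by simp
  have "real n * ln (1 + 1 / real n) \<le> real n * (1 / real n)"
    using n by (intro mult_left_mono ln_add_one_self_le_self) auto
  hence "real n * (ln (real n + 1) - ln (real n)) \<le> 1"
    using n ln_div[of "real n + 1" "real n"] by (simp add: add_divide_distrib)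
  moreover have "ln (fact (Suc n) :: real) = ln (real n + 1) + ln (fact n)"
    unfolding fact_Suc by (subst ln_mult) (auto simp: algebra_simps)
  ultimately show ?case using Suc.IH by (simp add: algebra_simps)
qed simp

lemma sum_ln_prime_over_prime_ge_nat:
  assumes "n \<ge> 1"
  shows "(\<Sum>p | prime p \<and> p \<le> n. ln (real p) / real p) \<ge> (ln (real n) - 1) / 2"
proof -
  have "real n * ln (real n) - real n \<le> ln (fact n)" using assms by (rule ln_fact_ge)
  also have "\<dots> = (\<Sum>p | prime p \<and> p \<le> n. (\<Sum>m=1..n. real (multiplicity p m)) * ln (real p))"
    by (rule ln_fact_eq)
  also have "\<dots> \<le> (\<Sum>p | prime p \<and> p \<le> n. (2 * real n / real p) * ln (real p))"
    by (intro sum_mono mult_right_mono sum_multiplicity_bounds(2))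
       (auto simp: prime_gt_0_nat Suc_le_eq)
  also have "\<dots> = 2 * real n * (\<Sum>p | prime p \<and> p \<le> n. ln (real p) / real p)"
    by (simp add: sum_distrib_left field_simps)
  finally have "real n * ln (real n) \<le> real n * (1 + 2 * (\<Sum>p | prime p \<and> p \<le> n. ln (real p) / real p))"
    by (simp add: algebra_simps)
  thus ?thesis using assms by simp
qed

section \<open>Prime sums over real ranges, by repeated squaring\<close>

definition primes_upto :: "real \<Rightarrow> nat set" where
  "primes_upto x = {p. prime p \<and> real p \<le> x}"

lemma primes_upto_floor: "x \<ge> 0 \<Longrightarrow> primes_upto x = {p. prime p \<and> p \<le> nat \<lfloor>x\<rfloor>}"
  unfolding primes_upto_def by (auto simp: le_nat_floor) linarith

lemma finite_primes_upto [simp, intro]: "finite (primes_upto x)"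
proof (cases "x \<ge> 0")
  case False
  hence "primes_upto x = {}" by (auto simp: primes_upto_def)
  thus ?thesis by simp
qed (auto simp: primes_upto_floor)

lemma finite_primes_le [simp]: "finite {p::nat. prime p \<and> real p \<le> x}"
  using finite_primes_upto[of x] by (simp add: primes_upto_def)

lemma sum_ln_prime_over_prime_le:
  assumes "x \<ge> 1"
  shows "(\<Sum>p\<in>primes_upto x. ln (real p) / real p) \<le> 2 * ln x"
proof -
  have 1: "nat \<lfloor>x\<rfloor> \<ge> 1" "real (nat \<lfloor>x\<rfloor>) \<le> x" using assms by linarith+
  have "(\<Sum>p\<in>primes_upto x. ln (real p) / real p) \<le> 2 * ln (real (nat \<lfloor>x\<rfloor>))"
    using sum_ln_prime_over_prime_le_nat[OF 1(1)] assms by (simp add: primes_upto_floor)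
  also have "\<dots> \<le> 2 * ln x" using 1 by (intro mult_left_mono ln_mono) auto
  finally show ?thesis .
qed

lemma sum_ln_prime_over_prime_ge:
  assumes "x \<ge> 1"
  shows "(\<Sum>p\<in>primes_upto x. ln (real p) / real p) \<ge> (ln x - 2) / 2"
proof -
  have 1: "nat \<lfloor>x\<rfloor> \<ge> 1" using assms by linarith
  moreover have "x \<le> real (nat \<lfloor>x\<rfloor>) + 1" using assms by linarith
  ultimately have 2: "x \<le> 2 * real (nat \<lfloor>x\<rfloor>)" by linarith
  have "ln x \<le> ln (2 * real (nat \<lfloor>x\<rfloor>))" using 1 2 assms by (intro ln_mono) auto
  also have "\<dots> = ln 2 + ln (real (nat \<lfloor>x\<rfloor>))" using 1 by (subst ln_mult) auto
  also have "ln 2 \<le> (1::real)" using ln_le_minus_one[of "2::real"] by simp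
  finally have "(ln x - 2) / 2 \<le> (ln (real (nat \<lfloor>x\<rfloor>)) - 1) / 2" by simp
  thus ?thesis using sum_ln_prime_over_prime_ge_nat[OF 1] assms by (simp add: primes_upto_floor)
qed

lemma sum_ln_prime_over_prime_square_block:
  assumes "z > 1"
  shows "(\<Sum>p\<in>primes_upto (z^2) - primes_upto z. ln (real p) / real p) \<le> 4 * ln z"
proof -
  have "(\<Sum>p\<in>primes_upto (z^2) - primes_upto z. ln (real p) / real p) \<le>
        (\<Sum>p\<in>primes_upto (z^2). ln (real p) / real p)"
    by (intro sum_mono2 finite_primes_upto) (auto simp: primes_upto_def prime_gt_0_nat Suc_le_eq)
  also have "\<dots> \<le> 2 * ln (z^2)" using assms by (intro sum_ln_prime_over_prime_le) auto
  finally show ?thesis using assms by (simp add: ln_realpow)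
qed

lemma sum_recip_prime_ln_block:
  assumes "z > 1"
  shows "(\<Sum>p\<in>primes_upto (z^2) - primes_upto z. 1 / (real p * ln (real p))) \<le> 4 / ln z"
proof -
  have lz: "ln z > 0" using assms by simp
  have "(\<Sum>p\<in>primes_upto (z^2) - primes_upto z. 1 / (real p * ln (real p))) \<le>
        (\<Sum>p\<in>primes_upto (z^2) - primes_upto z. (ln (real p) / real p) * (1 / ln z ^ 2))"
  proof (rule sum_mono)
    fix p assume "p \<in> primes_upto (z^2) - primes_upto z"
    hence p: "real p > z" by (auto simp: primes_upto_def)
    hence l: "ln z < ln (real p)" using assms by simp
    have "ln z ^ 2 \<le> ln (real p) ^ 2" using l lz by (intro power_mono) auto
    thus "1 / (real p * ln (real p)) \<le> (ln (real p) / real p) * (1 / ln z ^ 2)"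
      using p l lz assms by (simp add: field_simps power2_eq_square)
  qed
  also have "\<dots> \<le> 4 * ln z * (1 / ln z ^ 2)"
    unfolding sum_distrib_right[symmetric]
    by (intro mult_right_mono sum_ln_prime_over_prime_square_block assms) auto
  finally show ?thesis using lz by (simp add: power2_eq_square)
qed

lemma sum_recip_prime_block:
  assumes "z > 1"
  shows "(\<Sum>p\<in>primes_upto (z^2) - primes_upto z. 1 / real p) \<le> 4"
proof -
  have lz: "ln z > 0" using assms by simp
  have "(\<Sum>p\<in>primes_upto (z^2) - primes_upto z. 1 / real p) \<le>
        (\<Sum>p\<in>primes_upto (z^2) - primes_upto z. (ln (real p) / real p) * (1 / ln z))"
  proof (rule sum_mono)
    fix p assume "p \<in> primes_upto (z^2) - primes_upto z"
    hence p: "real p > z" by (auto simp: primes_upto_def)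
    hence l: "ln z < ln (real p)" using assms by simp
    thus "1 / real p \<le> (ln (real p) / real p) * (1 / ln z)"
      using p l lz assms by (simp add: field_simps)
  qed
  also have "\<dots> \<le> 4 * ln z * (1 / ln z)"
    unfolding sum_distrib_right[symmetric]
    using lz by (intro mult_right_mono sum_ln_prime_over_prime_square_block assms) auto
  finally show ?thesis using lz by simp
qed

text \<open>Squaring doubles ln z. On the blocks from z^(2^i) to its square, a bound 4 / ln z for
  one block becomes geometric in i, while a bound 4 stays constant and merely counts the
  blocks.\<close>

lemma sum_primes_iterated_square:
  assumes z: "z > 1" and g: "\<And>p. prime p \<Longrightarrow> g p \<ge> (0::real)"
    and b: "\<And>i. (\<Sum>p\<in>primes_upto ((z^(2^i))^2) - primes_upto (z^(2^i)). g p) \<le> b i"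
  shows "(\<Sum>p\<in>primes_upto (z^(2^i)) - primes_upto z. g p) \<le> (\<Sum>j<i. b j)"
proof (induction i)
  case (Suc i)
  have sq: "z ^ 2 ^ Suc i = (z ^ 2 ^ i)^2" by (simp add: power_mult[symmetric] mult.commute)
  have "z ^ 2 ^ i \<ge> 1" using z by simp
  hence "z^2^i * 1 \<le> z^2^i * z^2^i" by (intro mult_left_mono) auto
  hence "primes_upto (z ^ 2 ^ Suc i) - primes_upto z \<subseteq>
     (primes_upto (z^2^i) - primes_upto z) \<union> (primes_upto ((z^(2^i))^2) - primes_upto (z^(2^i)))"
    unfolding sq by auto
  hence "(\<Sum>p\<in>primes_upto (z ^ 2 ^ Suc i) - primes_upto z. g p) \<le>
     (\<Sum>p\<in>(primes_upto (z^2^i) - primes_upto z) \<union> (primes_upto ((z^(2^i))^2) - primes_upto (z^(2^i))). g p)"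
    by (rule sum_mono2[rotated]) (auto simp: primes_upto_def intro!: g)
  also have "\<dots> = (\<Sum>p\<in>primes_upto (z^2^i) - primes_upto z. g p) +
       (\<Sum>p\<in>primes_upto ((z^(2^i))^2) - primes_upto (z^(2^i)). g p)"
    by (rule sum.union_disjoint) auto
  also have "\<dots> \<le> (\<Sum>j<Suc i. b j)" using Suc b[of i] by simp
  finally show ?case .
qed simp

lemma sum_recip_prime_ln_tail:
  assumes z: "z > 1"
  shows "(\<Sum>p\<in>primes_upto Z - primes_upto z. 1 / (real p * ln (real p))) \<le> 8 / ln z"
proof -
  have lz: "ln z > 0" using assms by simp
  obtain n where n: "Z < z ^ n" using real_arch_pow[OF z] by blast
  have "z ^ n \<le> z ^ (2 ^ n)" using z less_exp[of n] by (intro power_increasing) auto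
  hence "primes_upto Z - primes_upto z \<subseteq> primes_upto (z^2^n) - primes_upto z"
    using n by (auto simp: primes_upto_def)
  hence "(\<Sum>p\<in>primes_upto Z - primes_upto z. 1 / (real p * ln (real p))) \<le>
         (\<Sum>p\<in>primes_upto (z^2^n) - primes_upto z. 1 / (real p * ln (real p)))"
    by (rule sum_mono2[rotated]) (auto simp: primes_upto_def prime_gt_0_nat Suc_le_eq)
  also have "\<dots> \<le> (\<Sum>j<n. (4 / ln z) * (1/2)^j)"
  proof (rule sum_primes_iterated_square[OF z])
    fix i
    have "z^2^i > 1" using z by (simp add: one_less_power)
    from sum_recip_prime_ln_block[OF this]
    show "(\<Sum>p\<in>primes_upto ((z^(2^i))^2) - primes_upto (z^(2^i)). 1 / (real p * ln (real p)))
            \<le> (4 / ln z) * (1/2)^i"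
      using z by (simp add: ln_realpow power_divide field_simps)
  qed (auto simp: prime_gt_0_nat Suc_le_eq)
  also have "\<dots> = (4 / ln z) * (\<Sum>j<n. (1/2)^j)" by (simp add: sum_distrib_left)
  also have "\<dots> \<le> (4 / ln z) * 2"
    using lz by (intro mult_left_mono sum_half_powers_le) auto
  finally show ?thesis by simp
qed

lemma ln2_ge_half: "ln 2 \<ge> (1/2::real)"
proof -
  have "exp (1/2) \<le> (2::real)" using exp_bound[of "1/2"] by (simp add: power2_eq_square)
  thus ?thesis by (subst ln_ge_iff) auto
qed

text \<open>A weak second theorem of Mertens: exp t is reached from 2 by O(ln t) squarings, each
  costing at most 4.\<close>

lemma sum_recip_prime_le:
  "\<exists>C>0. \<forall>t\<ge>2. (\<Sum>p\<in>primes_upto (exp t). 1 / real p) \<le> C * ln t"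
proof -
  define C where "C = (1/2 + 12 + 4 / ln 2) / ln 2 + 4 / ln (2::real)"
  have l2: "ln 2 > (0::real)" by simp
  have "(\<Sum>p\<in>primes_upto (exp t). 1 / real p) \<le> C * ln t" if t: "t \<ge> 2" for t :: real
  proof -
    \<comment> \<open>Since ln 2 \<ge> 1/2, the inequality 2 t \<le> 2^i is enough for exp t \<le>
      2^(2^i).\<close>
    define i where "i = nat \<lceil>log 2 (2 * t)\<rceil>"
    have lt: "ln t \<ge> ln 2" using t by simp
    have "2 * t = 2 powr (log 2 (2 * t))" using t by simp
    also have "\<dots> \<le> 2 powr (real i)" unfolding i_def by (intro powr_mono) (auto simp: le_of_int_ceiling of_nat_ceiling)
    also have "\<dots> = 2 ^ i" by (simp add: powr_realpow)
    finally have ti: "2 * t \<le> 2 ^ i" .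
    have i: "real i \<le> ln t / ln 2 + 2"
    proof -
      have "log 2 (2 * t) = 1 + log 2 t" using t by (simp add: log_mult)
      moreover have "real i \<le> log 2 (2 * t) + 1"
      proof -
        have "log 2 (2*t) \<ge> 0" using t by simp
        thus ?thesis unfolding i_def by linarith
      qed
      ultimately show ?thesis by (simp add: log_def)
    qed
    have "exp t \<le> exp (2^i * ln 2)"
    proof -
      have "t = 2 * t * (1/2)" by simp
      also have "\<dots> \<le> 2^i * ln 2" using ti ln2_ge_half t by (intro mult_mono) auto
      finally show ?thesis by simp
    qed
    also have "\<dots> = exp (ln (2::real)) ^ (2^i)"
      unfolding exp_of_nat_mult[symmetric] by simp
    finally have e: "exp t \<le> 2 ^ 2 ^ i" by simp
    have "primes_upto (exp t) \<subseteq> primes_upto (2^2^i)" unfolding primes_upto_def using order_trans[OF _ e] by blast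
    also have "\<dots> \<subseteq> insert 2 (primes_upto (2^2^i) - primes_upto 2)"
    proof
      fix p assume p: "p \<in> primes_upto (2^2^i)"
      hence "p = 2 \<or> \<not> p \<le> 2" using prime_ge_2_nat[of p] by (auto simp: primes_upto_def)
      thus "p \<in> insert 2 (primes_upto (2^2^i) - primes_upto 2)" using p by (auto simp: primes_upto_def)
    qed
    finally have "(\<Sum>p\<in>primes_upto (exp t). 1 / real p) \<le> (\<Sum>p\<in>insert 2 (primes_upto (2^2^i) - primes_upto 2). 1 / real p)"
      by (rule sum_mono2[rotated]) auto
    also have "\<dots> \<le> 1/2 + (\<Sum>p\<in>primes_upto (2^2^i) - primes_upto 2. 1 / real p)"
      by (subst sum.insert) (auto simp: primes_upto_def)
    also have "(\<Sum>p\<in>primes_upto (2^2^i) - primes_upto 2. 1 / real p) \<le> (\<Sum>j<i. 4)"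
      by (rule sum_primes_iterated_square) (auto intro!: sum_recip_prime_block simp: one_less_power)
    finally have "(\<Sum>p\<in>primes_upto (exp t). 1 / real p) \<le> 1/2 + 4 * real i" by simp
    also have "\<dots> \<le> 1/2 + 12 + (4 / ln 2) + (4 / ln 2) * ln t"
    proof -
      have "4 * real i \<le> 4 / ln 2 * ln t + 8" using i by simp
      moreover have "4 / ln 2 > (0::real)" by simp
      ultimately show ?thesis by linarith
    qed
    also have "\<dots> \<le> ((1/2 + 12 + 4 / ln 2) / ln 2) * ln t + (4 / ln 2) * ln t"
    proof -
      have "1/2 + 12 + 4 / ln 2 = ((1/2 + 12 + 4 / ln 2) / ln (2::real)) * ln 2" by simp
      also have "\<dots> \<le> ((1/2 + 12 + 4 / ln 2) / ln 2) * ln t" using lt by (intro mult_left_mono) auto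
      finally show ?thesis by simp
    qed
    finally show ?thesis unfolding C_def by (simp add: algebra_simps)
  qed
  moreover have "C > 0" unfolding C_def by (intro add_pos_pos divide_pos_pos) auto
  ultimately show ?thesis by blast
qed

lemma gt_1_if_ln_ge_6: "ln t \<ge> 6 \<Longrightarrow> t > 0 \<Longrightarrow> t > (1::real)"
  by (metis ln_gt_zero_iff order_less_le_trans zero_less_numeral)

text \<open>The upper and lower Mertens bounds differ by a factor 4, so the range has to end beyond
  y^4. Up to y^8 the sum of ln p / p is at least 2 ln y - 1; two excluded primes cost at most 2, and
  ln y \<ge> 6 leaves ln y. Passing to 1 / (p ln p) divides by at most (8 ln y)^2.\<close>

lemma sum_recip_prime_ln_ge:
  assumes y: "ln y \<ge> 6" "y > 0" and Q: "finite Q" "card Q \<le> 2"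
  shows "(\<Sum>p\<in>primes_upto (y^8) - primes_upto y - Q. 1 / (real p * ln (real p))) \<ge> 1 / (64 * ln y)"
proof -
  have y1: "y > 1" using y by (rule gt_1_if_ln_ge_6)
  let ?R = "primes_upto (y^8) - primes_upto y - Q"
  have bd: "ln (real p) / real p \<le> 1" if "p > 0" for p
    using that ln_le_minus_one[of "real p"] by (simp add: field_simps)
  have sub: "primes_upto y \<subseteq> primes_upto (y^8)"
    using self_le_power[of y 8] y1 by (auto simp: primes_upto_def)
  have "(ln (y^8) - 2) / 2 - 2 * ln y \<le> (\<Sum>p\<in>primes_upto (y^8). ln (real p) / real p) - (\<Sum>p\<in>primes_upto y. ln (real p) / real p)"
    using y1 by (intro diff_mono sum_ln_prime_over_prime_le sum_ln_prime_over_prime_ge) (auto simp: one_le_power)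
  also have "\<dots> = (\<Sum>p\<in>primes_upto (y^8) - primes_upto y. ln (real p) / real p)"
    using sub by (subst sum_diff) auto
  also have "\<dots> \<le> (\<Sum>p\<in>?R \<union> (Q \<inter> primes_upto (y^8)). ln (real p) / real p)"
    using Q by (intro sum_mono2) (auto simp: primes_upto_def prime_gt_0_nat Suc_le_eq)
  also have "\<dots> = (\<Sum>p\<in>?R. ln (real p) / real p) + (\<Sum>p\<in>Q \<inter> primes_upto (y^8). ln (real p) / real p)"
    using Q by (intro sum.union_disjoint) auto
  also have "(\<Sum>p\<in>Q \<inter> primes_upto (y^8). ln (real p) / real p) \<le> (\<Sum>p\<in>Q \<inter> primes_upto (y^8). 1)"
    by (intro sum_mono bd) (auto simp: primes_upto_def prime_gt_0_nat)
  also have "\<dots> \<le> 2"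
  proof -
    have "card (Q \<inter> primes_upto (y^8)) \<le> card Q" using Q by (intro card_mono) auto
    thus ?thesis using Q by simp
  qed
  finally have "(ln (y^8) - 2) / 2 - 2 * ln y \<le> (\<Sum>p\<in>?R. ln (real p) / real p) + 2" by simp
  hence "2 * ln y - 3 \<le> (\<Sum>p\<in>?R. ln (real p) / real p)"
    using ln_realpow[of y 8] by (simp add: field_simps)
  hence 1: "ln y \<le> (\<Sum>p\<in>?R. ln (real p) / real p)" using y by linarith
  have "ln y / (64 * ln y ^ 2) \<le> (\<Sum>p\<in>?R. ln (real p) / real p) / (64 * ln y ^ 2)"
    by (intro divide_right_mono 1) auto
  also have "\<dots> \<le> (\<Sum>p\<in>?R. 1 / (real p * ln (real p)))"
    unfolding sum_divide_distrib
  proof (rule sum_mono)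
    fix p assume "p \<in> ?R"
    hence p: "real p > y" "real p \<le> y^8" by (auto simp: primes_upto_def)
    have l: "ln (real p) > 0" using p y1 by simp
    have "ln (real p) \<le> ln (y^8)" using p y1 by (intro ln_mono) auto
    hence "ln (real p) \<le> 8 * ln y" using y by (simp add: ln_realpow)
    hence "ln (real p) ^ 2 \<le> (8 * ln y)^2" using l by (intro power_mono) auto
    hence "ln (real p) ^ 2 \<le> 64 * ln y ^ 2" by (simp add: power_mult_distrib)
    thus "ln (real p) / real p / (64 * ln y ^ 2) \<le> 1 / (real p * ln (real p))"
      using p y1 l y by (simp add: divide_simps power2_eq_square)
  qed
  finally show ?thesis using y y1 by (simp add: power2_eq_square)
qed

section \<open>Weighted counts of integers with excluded primes\<close>

lemma ln_prime_pos: "prime p \<Longrightarrow> ln (real p) > 0"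
  using prime_gt_1_nat[of p] by simp

lemma nat_floor_ge_half: "x \<ge> 1 \<Longrightarrow> real (nat \<lfloor>x\<rfloor>) \<ge> x / 2" for x :: real
proof -
  assume x: "x \<ge> 1"
  hence "real (nat \<lfloor>x\<rfloor>) \<ge> 1" by (simp add: le_nat_iff)
  moreover have "real (nat \<lfloor>x\<rfloor>) > x - 1" by linarith
  ultimately show ?thesis by linarith
qed

text \<open>This is 1 / \<psi>(n). It arises from two factors: squarefree l coprime to n have
  density proportional to the product of q / (q + 1) over q | n, and l runs up to a multiple of 1 /
  k(n).\<close>

definition kernel_weight :: "nat \<Rightarrow> real" where
  "kernel_weight n = (\<Prod>p\<in>prime_factors n. 1 / (real p + 1))"

text \<open>The cut-off is logarithmic, so that extracting a factor p^j shifts it by j ln p.\<close>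

definition coprime_upto :: "nat set \<Rightarrow> real \<Rightarrow> nat set" where
  "coprime_upto Q t = {n. 0 < n \<and> ln (real n) \<le> t \<and> (\<forall>q\<in>Q. \<not> q dvd n)}"

definition weight_sum :: "nat set \<Rightarrow> real \<Rightarrow> real" where
  "weight_sum Q t = (\<Sum>n\<in>coprime_upto Q t. kernel_weight n)"

lemma finite_coprime_upto [simp, intro]: "finite (coprime_upto Q t)"
proof (rule finite_subset)
  show "coprime_upto Q t \<subseteq> {..nat \<lfloor>exp t\<rfloor>}"
  proof
    fix n assume "n \<in> coprime_upto Q t"
    hence "0 < n" "ln (real n) \<le> t" by (auto simp: coprime_upto_def)
    hence "real n \<le> exp t" by (metis exp_le_cancel_iff exp_ln of_nat_0_less_iff)
    thus "n \<in> {..nat \<lfloor>exp t\<rfloor>}" by (simp add: le_nat_floor)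
  qed
qed auto

lemma coprime_upto_mono: "s \<le> t \<Longrightarrow> coprime_upto Q s \<subseteq> coprime_upto Q t"
  by (auto simp: coprime_upto_def)

lemma coprime_upto_antimono: "Q \<subseteq> Q' \<Longrightarrow> coprime_upto Q' t \<subseteq> coprime_upto Q t"
  by (auto simp: coprime_upto_def)

lemma coprime_upto_neg: "t < 0 \<Longrightarrow> coprime_upto Q t = {}"
proof (rule ccontr)
  assume "t < 0" "coprime_upto Q t \<noteq> {}"
  then obtain n where "0 < n" "ln (real n) \<le> t" by (auto simp: coprime_upto_def)
  moreover have "ln (real n) \<ge> 0" using \<open>0 < n\<close> by simp
  ultimately show False using \<open>t < 0\<close> by linarith
qed

lemma kernel_weight_pos: "kernel_weight n > 0"
  unfolding kernel_weight_def by (intro prod_pos) auto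

lemma kernel_weight_nonneg [simp]: "kernel_weight n \<ge> 0"
  using kernel_weight_pos[of n] by simp

lemma prime_factors_power_mult:
  assumes "prime p" "\<not> p dvd m" "m > 0" "j \<ge> 1"
  shows "prime_factors (p ^ j * m) = insert p (prime_factors m)"
  using assms primes_dvd_imp_eq[of _ p]
  by (auto simp: in_prime_factors_iff prime_dvd_mult_iff prime_dvd_power_iff prime_gt_0_nat)

text \<open>The weight does not see the exponent once j \<ge> 1. Hence powers of p contribute to
  \<open>weight_sum\<close> along an unweighted progression of step ln p, and this flatness drives
  the estimates that follow.\<close>

lemma kernel_weight_power_mult:
  assumes "prime p" "\<not> p dvd m" "m > 0"
  shows "kernel_weight (p ^ j * m) = (if j = 0 then 1 else 1 / (real p + 1)) * kernel_weight m"
proof (cases "j = 0")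
  case False
  have "prime_factors (p ^ j * m) = insert p (prime_factors m)"
    using assms False by (intro prime_factors_power_mult) auto
  moreover have "p \<notin> prime_factors m" using assms by auto
  ultimately show ?thesis using False by (simp add: kernel_weight_def)
qed simp

lemma kernel_weight_dvd_antimono:
  assumes "m dvd n" "n > 0"
  shows "kernel_weight n \<le> kernel_weight m"
proof -
  have sub: "prime_factors m \<subseteq> prime_factors n" using assms by (simp add: dvd_prime_factors)
  have "kernel_weight n = kernel_weight m * (\<Prod>p\<in>prime_factors n - prime_factors m. 1 / (real p + 1))"
    unfolding kernel_weight_def using prod.subset_diff[OF sub] by (simp add: mult.commute)
  also have "\<dots> \<le> kernel_weight m * 1"
    by (intro mult_left_mono prod_le_1) auto
  finally show ?thesis by simp
qed

lemma weight_sum_nonneg [simp]: "weight_sum Q t \<ge> 0"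
  unfolding weight_sum_def by (intro sum_nonneg) auto

lemma weight_sum_mono: "s \<le> t \<Longrightarrow> weight_sum Q s \<le> weight_sum Q t"
  unfolding weight_sum_def by (intro sum_mono2 coprime_upto_mono) auto

lemma weight_sum_antimono: "Q \<subseteq> Q' \<Longrightarrow> weight_sum Q' t \<le> weight_sum Q t"
  unfolding weight_sum_def by (intro sum_mono2 coprime_upto_antimono) auto

lemma weight_sum_neg: "t < 0 \<Longrightarrow> weight_sum Q t = 0"
  by (simp add: weight_sum_def coprime_upto_neg)

text \<open>Every n is p^j m with p not dividing m. Exponents beyond t / ln p give empty inner sets,
  so any large enough J will do, in particular one J for several cut-offs.\<close>

lemma sum_coprime_upto_split:
  fixes F :: "nat \<Rightarrow> 'a::comm_monoid_add"
  assumes p: "prime p" "p \<notin> Q" and Q: "\<And>q. q \<in> Q \<Longrightarrow> prime q"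
    and J: "t < real (Suc J) * ln (real p)"
  shows "(\<Sum>n\<in>coprime_upto Q t. F n) =
         (\<Sum>j\<le>J. \<Sum>m\<in>coprime_upto (insert p Q) (t - real j * ln (real p)). F (p ^ j * m))"
proof -
  have lp: "ln (real p) > 0" using p ln_prime_pos by auto
  have p0: "p > 0" using p prime_gt_0_nat by blast
  have ln_eq: "ln (real (p ^ j * m)) = real j * ln (real p) + ln (real m)" if "m > 0" for j m
    using that p0 by (simp add: ln_mult ln_realpow)
  have "(\<Sum>n\<in>coprime_upto Q t. F n) =
        (\<Sum>(j,m)\<in>Sigma {..J} (\<lambda>j. coprime_upto (insert p Q) (t - real j * ln (real p))). F (p ^ j * m))"
  proof (rule sum.reindex_bij_witness[of _ "\<lambda>(j,m). p ^ j * m" "\<lambda>n. (multiplicity p n, n div p ^ multiplicity p n)"])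
    fix n assume n: "n \<in> coprime_upto Q t"
    hence n0: "n > 0" and nt: "ln (real n) \<le> t" and nQ: "\<forall>q\<in>Q. \<not> q dvd n" by (auto simp: coprime_upto_def)
    let ?j = "multiplicity p n" let ?m = "n div p ^ ?j"
    have dec: "n = p ^ ?j * ?m" by (simp add: multiplicity_dvd)
    have m0: "?m > 0" using n0 dec by (metis gr0I mult_0_right less_numeral_extra(3))
    have np: "\<not> p dvd ?m" using multiplicity_decompose[of n p] n0 p not_prime_1 by (metis nat_dvd_1_iff_1 neq0_conv)
    have "ln (real n) = real ?j * ln (real p) + ln (real ?m)" using ln_eq[OF m0, of ?j] dec by simp
    hence l: "real ?j * ln (real p) + ln (real ?m) \<le> t" using nt by simp
    moreover have "ln (real ?m) \<ge> 0" using m0 by simp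
    ultimately have "real ?j * ln (real p) < real (Suc J) * ln (real p)" using J by linarith
    hence "?j \<le> J" using lp by simp
    moreover have "?m \<in> coprime_upto (insert p Q) (t - real ?j * ln (real p))"
      using l m0 np nQ dec unfolding coprime_upto_def by (auto dest: dvd_mult_left) (metis dvd_mult)
    ultimately show "(?j, ?m) \<in> Sigma {..J} (\<lambda>j. coprime_upto (insert p Q) (t - real j * ln (real p)))" by auto
    show "(case (?j, ?m) of (j, m) \<Rightarrow> p ^ j * m) = n" using dec by simp
    show "(case (?j, ?m) of (j, m) \<Rightarrow> F (p ^ j * m)) = F n" using dec by simp
  next
    fix b assume "b \<in> Sigma {..J} (\<lambda>j. coprime_upto (insert p Q) (t - real j * ln (real p)))"
    then obtain j m where b: "b = (j, m)" "j \<le> J" "m \<in> coprime_upto (insert p Q) (t - real j * ln (real p))" by auto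
    hence m: "m > 0" "ln (real m) \<le> t - real j * ln (real p)" "\<not> p dvd m" "\<forall>q\<in>Q. \<not> q dvd m"
      by (auto simp: coprime_upto_def)
    have mu: "multiplicity p (p ^ j * m) = j"
      using m p p0 by (simp add: prime_elem_multiplicity_mult_distrib not_dvd_imp_multiplicity_0)
    show "(multiplicity p (case b of (j, m) \<Rightarrow> p ^ j * m), (case b of (j, m) \<Rightarrow> p ^ j * m) div
           p ^ multiplicity p (case b of (j, m) \<Rightarrow> p ^ j * m)) = b"
      using b mu p0 by simp
    have "\<not> q dvd p ^ j * m" if "q \<in> Q" for q
    proof
      assume "q dvd p ^ j * m"
      hence "q dvd p ^ j \<or> q dvd m" using Q[OF that] by (simp add: prime_dvd_mult_iff)
      hence "q dvd p" using m that Q[OF that] prime_dvd_power by blast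
      hence "q = p" using Q[OF that] p primes_dvd_imp_eq by blast
      thus False using p that by simp
    qed
    thus "(case b of (j, m) \<Rightarrow> p ^ j * m) \<in> coprime_upto Q t"
      using b m p0 ln_eq[OF m(1), of j] by (auto simp: coprime_upto_def)
  qed
  also have "\<dots> = (\<Sum>j\<le>J. \<Sum>m\<in>coprime_upto (insert p Q) (t - real j * ln (real p)). F (p ^ j * m))"
    by (rule sum.Sigma[symmetric]) auto
  finally show ?thesis .
qed

lemma sum_coprime_upto_split':
  fixes F :: "nat \<Rightarrow> 'a::comm_monoid_add"
  assumes p: "prime p" "p \<notin> Q" and Q: "\<And>q. q \<in> Q \<Longrightarrow> prime q"
    and J: "t < real (Suc J) * ln (real p)"
  shows "(\<Sum>n\<in>coprime_upto Q t. F n) = (\<Sum>m\<in>coprime_upto (insert p Q) t. F m) +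
         (\<Sum>j=1..J. \<Sum>m\<in>coprime_upto (insert p Q) (t - real j * ln (real p)). F (p ^ j * m))"
proof -
  have "{..J} = insert 0 {1..J}" by auto
  thus ?thesis using sum_coprime_upto_split[OF assms] by simp
qed

lemma sum_kernel_weight_power_mult:
  assumes "prime p" "j \<ge> 1" "p \<in> Q'"
  shows "(\<Sum>m\<in>coprime_upto Q' s. kernel_weight (p ^ j * m) * G m) =
         (1 / (real p + 1)) * (\<Sum>m\<in>coprime_upto Q' s. kernel_weight m * G m)"
  unfolding sum_distrib_left
  by (intro sum.cong refl, subst kernel_weight_power_mult) (use assms in \<open>auto simp: coprime_upto_def\<close>)

lemma weight_sum_split:
  assumes p: "prime p" "p \<notin> Q" and Q: "\<And>q. q \<in> Q \<Longrightarrow> prime q"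
    and J: "t < real (Suc J) * ln (real p)"
  shows "weight_sum Q t = weight_sum (insert p Q) t +
         (1 / (real p + 1)) * (\<Sum>j=1..J. weight_sum (insert p Q) (t - real j * ln (real p)))"
  unfolding weight_sum_def
  by (subst sum_coprime_upto_split'[OF assms])
     (auto simp: sum_distrib_left sum_divide_distrib sum_kernel_weight_power_mult[where G = "\<lambda>_. 1", simplified] p intro!: sum.cong)

section \<open>Weighted sums of p-adic valuations\<close>

definition valuation_sum :: "nat \<Rightarrow> nat set \<Rightarrow> real \<Rightarrow> real" where
  "valuation_sum p Q t = (\<Sum>n\<in>coprime_upto Q t. kernel_weight n * real (multiplicity p n))"

lemma valuation_sum_nonneg [simp]: "valuation_sum p Q t \<ge> 0"
  unfolding valuation_sum_def by (intro sum_nonneg) auto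

lemma valuation_sum_eq:
  assumes p: "prime p" "p \<notin> Q" and Q: "\<And>q. q \<in> Q \<Longrightarrow> prime q"
    and J: "t < real (Suc J) * ln (real p)"
  shows "valuation_sum p Q t =
         (1 / (real p + 1)) * (\<Sum>j=1..J. real j * weight_sum (insert p Q) (t - real j * ln (real p)))"
proof -
  have mu: "multiplicity p (p ^ j * m) = j" if "\<not> p dvd m" "m > 0" for j m
    using that p by (simp add: prime_elem_multiplicity_mult_distrib not_dvd_imp_multiplicity_0 prime_gt_0_nat)
  have "(\<Sum>m\<in>coprime_upto (insert p Q) t. kernel_weight m * real (multiplicity p m)) = 0"
    by (intro sum.neutral) (auto simp: coprime_upto_def not_dvd_imp_multiplicity_0)
  moreover have "(\<Sum>m\<in>coprime_upto (insert p Q) s. kernel_weight (p ^ j * m) * real (multiplicity p (p ^ j * m))) =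
      (1 / (real p + 1)) * (real j * weight_sum (insert p Q) s)" if "j \<ge> 1" for j s
  proof -
    have "(\<Sum>m\<in>coprime_upto (insert p Q) s. kernel_weight (p ^ j * m) * real (multiplicity p (p ^ j * m))) =
          (\<Sum>m\<in>coprime_upto (insert p Q) s. kernel_weight (p ^ j * m) * real j)"
      by (intro sum.cong refl) (auto simp: coprime_upto_def mu)
    also have "\<dots> = (1 / (real p + 1)) * (\<Sum>m\<in>coprime_upto (insert p Q) s. kernel_weight m * real j)"
      by (rule sum_kernel_weight_power_mult) (use p that in auto)
    finally show ?thesis by (simp add: weight_sum_def sum_distrib_left mult_ac)
  qed
  ultimately show ?thesis
    unfolding valuation_sum_def
    by (subst sum_coprime_upto_split'[OF assms]) (auto simp: sum_distrib_left intro!: sum.cong)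
qed

text \<open>Here n = p^j m with m still allowed to contain p, and the weight only increases from n
  to m. The factor 1 / (p + 1) of \<open>valuation_sum_eq\<close> is lost, but the sums on the right
  are those of Q itself, to which exponential decay applies directly; this serves the small
  primes.\<close>

lemma valuation_sum_le:
  assumes p: "prime p"
  shows "\<exists>J. valuation_sum p Q t \<le> (\<Sum>j=1..J. weight_sum Q (t - real j * ln (real p)))"
proof -
  define J where "J = nat \<lfloor>exp t\<rfloor>"
  have p0: "p > 0" using p prime_gt_0_nat by blast
  have "valuation_sum p Q t = (\<Sum>n\<in>coprime_upto Q t. \<Sum>j=1..J. kernel_weight n * of_bool (p ^ j dvd n))"
    unfolding valuation_sum_def
  proof (rule sum.cong)
    fix n assume "n \<in> coprime_upto Q t"
    hence n: "0 < n" "ln (real n) \<le> t" by (auto simp: coprime_upto_def)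
    hence "real n \<le> exp t" by (metis exp_le_cancel_iff exp_ln of_nat_0_less_iff)
    hence "n \<le> J" unfolding J_def by (simp add: le_nat_floor)
    thus "kernel_weight n * real (multiplicity p n) = (\<Sum>j=1..J. kernel_weight n * of_bool (p ^ j dvd n))"
      using multiplicity_eq_card_powers[OF p n(1)] by (simp add: sum_distrib_left)
  qed simp
  also have "\<dots> = (\<Sum>j=1..J. \<Sum>n\<in>coprime_upto Q t. kernel_weight n * of_bool (p ^ j dvd n))"
    by (rule sum.swap)
  also have "\<dots> \<le> (\<Sum>j=1..J. weight_sum Q (t - real j * ln (real p)))"
  proof (rule sum_mono)
    fix j assume "j \<in> {1..J}"
    have "(\<Sum>n\<in>coprime_upto Q t. kernel_weight n * of_bool (p ^ j dvd n)) =
          (\<Sum>n\<in>{n\<in>coprime_upto Q t. p ^ j dvd n}. kernel_weight n)"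
      by (simp add: of_bool_def sum.inter_filter if_distrib cong: if_cong)
    also have "\<dots> \<le> (\<Sum>m\<in>coprime_upto Q (t - real j * ln (real p)). kernel_weight m)"
    proof (rule sum_le_included[where i = "\<lambda>m. p ^ j * m"])
      show "\<forall>n\<in>{n \<in> coprime_upto Q t. p ^ j dvd n}. \<exists>m\<in>coprime_upto Q (t - real j * ln (real p)).
              p ^ j * m = n \<and> kernel_weight n \<le> kernel_weight m"
      proof
        fix n assume n: "n \<in> {n \<in> coprime_upto Q t. p ^ j dvd n}"
        then obtain m where m: "n = p ^ j * m" by auto
        have n': "n > 0" "ln (real n) \<le> t" "\<forall>q\<in>Q. \<not> q dvd n" using n by (auto simp: coprime_upto_def)
        have m0: "m > 0" using m n' by (auto intro: Nat.gr0I)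
        have "ln (real n) = real j * ln (real p) + ln (real m)"
          using m m0 p0 by (simp add: ln_mult ln_realpow)
        hence "m \<in> coprime_upto Q (t - real j * ln (real p))"
          using n' m m0 by (auto simp: coprime_upto_def)
        moreover have "kernel_weight n \<le> kernel_weight m"
          using m n' by (intro kernel_weight_dvd_antimono) auto
        ultimately show "\<exists>m\<in>coprime_upto Q (t - real j * ln (real p)).
              p ^ j * m = n \<and> kernel_weight n \<le> kernel_weight m" using m by auto
      qed
    qed auto
    finally show "(\<Sum>n\<in>coprime_upto Q t. kernel_weight n * of_bool (p ^ j dvd n)) \<le>
        weight_sum Q (t - real j * ln (real p))" by (simp add: weight_sum_def)
  qed
  finally show ?thesis by blast
qed

section \<open>Decay on the scale \<surd>(t ln t)\<close>

lemma sum_ln_multiplicity_le: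
  fixes n :: nat
  assumes "n > 0" "finite R" "\<And>p. p \<in> R \<Longrightarrow> prime p"
  shows "(\<Sum>p\<in>R. real (multiplicity p n) * ln (real p)) \<le> ln (real n)"
proof -
  have "(\<Sum>p\<in>R. real (multiplicity p n) * ln (real p)) \<le>
        (\<Sum>p\<in>R \<union> prime_factors n. real (multiplicity p n) * ln (real p))"
    using assms by (intro sum_mono2) (auto simp: in_prime_factors_iff prime_gt_0_nat Suc_le_eq)
  also have "\<dots> = ln (real n)"
    using assms by (intro ln_eq_sum_multiplicity[symmetric]) (auto simp: in_prime_factors_iff)
  finally show ?thesis .
qed

text \<open>At most two primes are ever excluded together: 2 for the periodization and one more,
  either 3 or the prime of a twisted sum. The fixed bound keeps all constants uniform in Q.\<close>

definition admissible :: "nat set \<Rightarrow> bool" where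
  "admissible Q \<longleftrightarrow> finite Q \<and> card Q \<le> 2 \<and> (\<forall>q\<in>Q. prime q)"

definition root_scale :: "real \<Rightarrow> real" where
  "root_scale t = sqrt (t * ln t)"

text \<open>Weighting by \<open>ln n = \<Sum>\<^sub>p v\<^sub>p(n) ln p\<close> and keeping only the primes between \<open>t\<close> and \<open>t\<^sup>8\<close>
  forces growth on the scale \<open>\<surd>(t ln t)\<close>.\<close>

lemma weight_sum_half_decay:
  assumes t: "ln t \<ge> 6" "t > 0" and Q: "admissible Q" and s: "s \<le> t"
  shows "weight_sum Q (s - 64 * root_scale t) \<le> weight_sum Q s / 2"
proof (cases "s - 64 * root_scale t < 0")
  case True
  thus ?thesis by (simp add: weight_sum_neg)
next
  case False
  \<comment> \<open>With 64 one has H^2 = 4096 t ln t = 2 t * 32 * 64 ln t. The divisor 32 of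
    \<open>main\<close> and the divisor 64 ln t of \<open>sum_recip_prime_ln_ge\<close> then leave
    exactly the factor 2 of the halving.\<close>
  define H where "H = 64 * root_scale t"
  have t1: "t > 1" using t by (rule gt_1_if_ln_ge_6)
  have lt: "ln t > 0" "ln t \<le> t" using t ln_le_minus_one[of t] by auto
  have "root_scale t \<ge> sqrt (ln t * ln t)"
    unfolding root_scale_def using lt t1 by (intro real_sqrt_le_mono mult_right_mono) auto
  hence Hlt: "H \<ge> 64 * ln t" unfolding H_def using lt by simp
  hence H0: "H > 0" using lt by simp
  have H2: "H^2 = 4096 * t * ln t" unfolding H_def root_scale_def using t lt by (simp add: power_mult_distrib)
  have sH: "s \<ge> H" using False by (simp add: H_def)
  have Qp: "\<And>q. q \<in> Q \<Longrightarrow> prime q" using Q by (auto simp: admissible_def)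
  let ?R = "primes_upto (t^8) - primes_upto t - Q"
  have finR: "finite ?R" by auto
  have main: "ln (real p) * valuation_sum p Q s \<ge> (weight_sum Q (s - H) * H^2 / 32) * (1 / (real p * ln (real p)))"
    if pR: "p \<in> ?R" for p
  proof -
    have p: "prime p" "p \<notin> Q" "real p > t" "real p \<le> t^8" using pR by (auto simp: primes_upto_def)
    have lp: "ln (real p) > 0" using p t1 by simp
    have "ln (real p) \<le> ln (t^8)" using p t1 by (intro ln_mono) auto
    hence lpH: "ln (real p) \<le> H" using Hlt lt t by (simp add: ln_realpow)
    have lp1: "ln (real p) \<ge> 1"
    proof -
      have "ln t \<le> ln (real p)" using p t1 by simp
      thus ?thesis using t by linarith
    qed
    define J where "J = nat \<lfloor>s / ln (real p)\<rfloor>"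
    define J0 where "J0 = nat \<lfloor>H / ln (real p)\<rfloor>"
    have J: "u < real (Suc J) * ln (real p)" if "u \<le> s" for u
    proof -
      have "s / ln (real p) < real (Suc J)" using sH H0 lp unfolding J_def by (simp add: floor_less_iff) linarith
      hence "s < real (Suc J) * ln (real p)" using lp by (simp add: pos_divide_less_eq)
      thus ?thesis using that by linarith
    qed
    have Jub: "real J \<le> s / ln (real p)" unfolding J_def using sH H0 lp by (simp add: of_nat_floor)
    have J0J: "J0 \<le> J" unfolding J_def J0_def using sH lp by (intro nat_mono floor_mono divide_right_mono) auto
    have J0ub: "real J0 * ln (real p) \<le> H"
    proof -
      have "real J0 \<le> H / ln (real p)" unfolding J0_def using H0 lp by (simp add: of_nat_floor)
      thus ?thesis using lp by (simp add: pos_le_divide_eq)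
    qed
    have J0lb: "real J0 \<ge> H / (2 * ln (real p))"
    proof -
      have "H / ln (real p) \<ge> 1" using lpH lp by simp
      hence "real J0 \<ge> (H / ln (real p)) / 2" unfolding J0_def by (rule nat_floor_ge_half)
      thus ?thesis by (simp add: field_simps)
    qed
    \<comment> \<open>Excluding a prime p > t costs at most a factor 2: there are at most s / ln p
      \<le> t < p further exponents, each with weight 1 / (p + 1).\<close>
    have half: "weight_sum Q (s - H) / 2 \<le> weight_sum (insert p Q) (s - H)"
    proof -
      have "weight_sum Q (s - H) = weight_sum (insert p Q) (s - H) +
         (1 / (real p + 1)) * (\<Sum>j=1..J. weight_sum (insert p Q) (s - H - real j * ln (real p)))"
        by (rule weight_sum_split) (use p Qp J H0 in auto)
      also have "(\<Sum>j=1..J. weight_sum (insert p Q) (s - H - real j * ln (real p))) \<le>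
                 (\<Sum>j=1..J. weight_sum (insert p Q) (s - H))"
        using lp by (intro sum_mono weight_sum_mono) auto
      hence "weight_sum (insert p Q) (s - H) +
         (1 / (real p + 1)) * (\<Sum>j=1..J. weight_sum (insert p Q) (s - H - real j * ln (real p))) \<le>
         weight_sum (insert p Q) (s - H) + (1 / (real p + 1)) * (real J * weight_sum (insert p Q) (s - H))"
        by (intro add_left_mono mult_left_mono) auto
      also have "\<dots> = weight_sum (insert p Q) (s - H) * (1 + real J / (real p + 1))"
        by (simp add: field_simps)
      also have "\<dots> \<le> weight_sum (insert p Q) (s - H) * 2"
      proof -
        have "s / ln (real p) \<le> s" using lp1 sH H0 by (simp add: field_simps)
        hence "real J \<le> real p + 1" using Jub p s by linarith
        thus ?thesis by (intro mult_left_mono) (auto simp: field_simps)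
      qed
      finally show ?thesis by simp
    qed
    \<comment> \<open>Only exponents with j ln p \<le> H are kept, where the sum is still at least
      its value at s - H. There are about H / ln p of them, so the factors j add up to order (H / ln
      p)^2.\<close>
    have "(\<Sum>j=1..J0. real j) * (weight_sum Q (s - H) / 2) \<le>
          (\<Sum>j=1..J0. real j * weight_sum (insert p Q) (s - real j * ln (real p)))"
      unfolding sum_distrib_right
    proof (intro sum_mono mult_left_mono)
      fix j assume "j \<in> {1..J0}"
      hence "real j * ln (real p) \<le> real J0 * ln (real p)" using lp by (intro mult_right_mono) auto
      hence "weight_sum (insert p Q) (s - H) \<le> weight_sum (insert p Q) (s - real j * ln (real p))"
        using J0ub by (intro weight_sum_mono) auto
      thus "weight_sum Q (s - H) / 2 \<le> weight_sum (insert p Q) (s - real j * ln (real p))" using half by linarith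
    qed auto
    also have "\<dots> \<le> (\<Sum>j=1..J. real j * weight_sum (insert p Q) (s - real j * ln (real p)))"
      using J0J by (intro sum_mono2) auto
    also have "\<dots> = (real p + 1) * valuation_sum p Q s"
      by (subst valuation_sum_eq[OF p(1,2) Qp J]) auto
    finally have 1: "(\<Sum>j=1..J0. real j) * (weight_sum Q (s - H) / 2) \<le> (real p + 1) * valuation_sum p Q s" .
    have gauss: "(\<Sum>j=1..J0. real j) = real J0 * (real J0 + 1) / 2"
      by (induction J0) (auto simp: field_simps)
    have "H^2 / (8 * ln (real p)^2) = (H / (2 * ln (real p)))^2 / 2" by (simp add: power_divide power_mult_distrib)
    also have "\<dots> \<le> real J0 ^ 2 / 2"
      using J0lb H0 lp by (intro divide_right_mono power_mono) auto
    also have "\<dots> \<le> (\<Sum>j=1..J0. real j)" unfolding gauss by (simp add: power2_eq_square field_simps)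
    finally have "H^2 / (8 * ln (real p)^2) * (weight_sum Q (s - H) / 2) \<le> (\<Sum>j=1..J0. real j) * (weight_sum Q (s - H) / 2)"
      by (intro mult_right_mono) auto
    also have "\<dots> \<le> (real p + 1) * valuation_sum p Q s" by (rule 1)
    also have "\<dots> \<le> 2 * real p * valuation_sum p Q s"
      using p t1 by (intro mult_right_mono) auto
    finally have "H^2 / (8 * ln (real p)^2) * (weight_sum Q (s - H) / 2) * (ln (real p) / (2 * real p)) \<le>
       2 * real p * valuation_sum p Q s * (ln (real p) / (2 * real p))"
      using lp by (intro mult_right_mono) auto
    thus ?thesis using lp p t1 by (simp add: power2_eq_square field_simps)
  qed
  have "(weight_sum Q (s - H) * H^2 / 32) * (1 / (64 * ln t)) \<le>
        (weight_sum Q (s - H) * H^2 / 32) * (\<Sum>p\<in>?R. 1 / (real p * ln (real p)))"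
    using Q t by (intro mult_left_mono sum_recip_prime_ln_ge) (auto simp: admissible_def)
  also have "\<dots> \<le> (\<Sum>p\<in>?R. ln (real p) * valuation_sum p Q s)"
    unfolding sum_distrib_left by (intro sum_mono main)
  also have "\<dots> = (\<Sum>n\<in>coprime_upto Q s. kernel_weight n * (\<Sum>p\<in>?R. real (multiplicity p n) * ln (real p)))"
    unfolding valuation_sum_def sum_distrib_left by (subst sum.swap) (simp add: mult_ac)
  also have "\<dots> \<le> (\<Sum>n\<in>coprime_upto Q s. kernel_weight n * t)"
  proof (intro sum_mono mult_left_mono)
    fix n assume "n \<in> coprime_upto Q s"
    hence n: "n > 0" "ln (real n) \<le> s" by (auto simp: coprime_upto_def)
    have "(\<Sum>p\<in>?R. real (multiplicity p n) * ln (real p)) \<le> ln (real n)"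
      by (rule sum_ln_multiplicity_le) (use n in \<open>auto simp: primes_upto_def\<close>)
    thus "(\<Sum>p\<in>?R. real (multiplicity p n) * ln (real p)) \<le> t" using n s by linarith
  qed auto
  also have "\<dots> = weight_sum Q s * t" by (simp add: weight_sum_def sum_distrib_right)
  finally have "weight_sum Q (s - H) * (2 * t) \<le> weight_sum Q s * t"
    unfolding H2 using lt t1 by (simp add: field_simps)
  thus ?thesis using t unfolding H_def by simp
qed

text \<open>The exponential rate that halves once per step of length
  \<open>64 * root_scale t\<close>.\<close>

definition decay_rate :: "real \<Rightarrow> real" where
  "decay_rate t = ln 2 / (64 * root_scale t)"

lemma root_scale_pos: "t > 1 \<Longrightarrow> root_scale t > 0"
  by (simp add: root_scale_def)

lemma decay_rate_pos: "t > 1 \<Longrightarrow> decay_rate t > 0"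
  by (simp add: decay_rate_def root_scale_pos)

text \<open>The halving is iterated with the step length frozen at the right end t; the factor 2
  pays for the incomplete last step.\<close>

lemma weight_sum_exp_decay:
  assumes t: "ln t \<ge> 6" "t > 0" and Q: "admissible Q" and s: "s \<le> t"
  shows "weight_sum Q s \<le> 2 * exp (- (decay_rate t * (t - s))) * weight_sum Q t"
proof -
  define H where "H = 64 * root_scale t"
  have t1: "t > 1" using t by (rule gt_1_if_ln_ge_6)
  have H0: "H > 0" unfolding H_def using root_scale_pos[OF t1] by simp
  have step: "weight_sum Q (t - real i * H) \<le> weight_sum Q t / 2 ^ i" for i
  proof (induction i)
    case (Suc i)
    have "weight_sum Q (t - real (Suc i) * H) = weight_sum Q ((t - real i * H) - 64 * root_scale t)"
      by (simp add: H_def algebra_simps)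
    also have "\<dots> \<le> weight_sum Q (t - real i * H) / 2"
      using H0 by (intro weight_sum_half_decay t Q) auto
    finally show ?case using Suc by simp
  qed simp
  define i where "i = nat \<lfloor>(t - s) / H\<rfloor>"
  have i: "real i \<le> (t - s) / H" "(t - s) / H < real i + 1"
    unfolding i_def using s H0 by (auto simp: of_nat_floor)
  have "real i * H \<le> t - s" using i H0 by (simp add: pos_le_divide_eq)
  hence "weight_sum Q s \<le> weight_sum Q (t - real i * H)" by (intro weight_sum_mono) auto
  also have "\<dots> \<le> weight_sum Q t / 2 ^ i" by (rule step)
  also have "\<dots> = exp (- (real i * ln 2)) * weight_sum Q t"
    by (simp add: exp_minus exp_of_nat_mult field_simps)
  also have "\<dots> \<le> exp (ln 2 - decay_rate t * (t - s)) * weight_sum Q t"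
  proof (intro mult_right_mono)
    have "decay_rate t * (t - s) = ln 2 * ((t - s) / H)" by (simp add: decay_rate_def H_def)
    also have "\<dots> \<le> ln 2 * (real i + 1)" using i by (intro mult_left_mono) auto
    finally show "exp (- (real i * ln 2)) \<le> exp (ln 2 - decay_rate t * (t - s))" by (simp add: algebra_simps)
  qed auto
  also have "exp (ln 2 - decay_rate t * (t - s)) = 2 * exp (- (decay_rate t * (t - s)))"
    using exp_add[of "ln 2" "- (decay_rate t * (t - s))"] by simp
  finally show ?thesis .
qed

text \<open>The exact value 1 / (exp a - 1) of the infinite series is kept, rather than only 1 / a,
  for the cancellation in \<open>tilted_weight_sum_le\<close>.\<close>

lemma sum_exp_multiples_less:
  assumes a: "a > 0"
  shows "(\<Sum>j=1..J. exp (- (a * real j))) \<le> 1 / (exp a - 1)"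
proof -
  have e: "exp (-a) < 1" using a by simp
  have "(\<Sum>j=1..J. exp (- (a * real j))) = (\<Sum>j=1..J. exp (-a) ^ j)"
    by (intro sum.cong refl) (simp add: exp_of_nat_mult[symmetric] mult_ac)
  also have "\<dots> = exp (-a) * (\<Sum>j<J. exp (-a) ^ j)"
    unfolding sum_distrib_left
    by (rule sum.reindex_bij_witness[of _ Suc "\<lambda>j. j - 1"]) (auto simp: power_Suc[symmetric] simp del: power_Suc)
  also have "(\<Sum>j<J. exp (-a) ^ j) = (1 - exp (-a) ^ J) / (1 - exp (-a))"
    using e by (simp add: geometric_sum field_simps)
  also have "exp (-a) * \<dots> \<le> exp (-a) * (1 / (1 - exp (-a)))"
    using e by (intro mult_left_mono divide_right_mono) auto
  also have "\<dots> = 1 / (exp a - 1)" using e a by (simp add: exp_minus field_simps)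
  finally show ?thesis .
qed

lemma sum_exp_multiples_le:
  assumes a: "a > 0"
  shows "(\<Sum>j=1..J. exp (- (a * real j))) \<le> 1 / a"
proof -
  have "a \<le> exp a - 1" using exp_ge_add_one_self[of a] by linarith
  hence "1 / (exp a - 1) \<le> 1 / a" using a by (intro divide_left_mono) auto
  thus ?thesis using sum_exp_multiples_less[OF a, of J] by linarith
qed

section \<open>Sums along multiples of ln p and upper bounds for windows\<close>

lemma sum_weight_sum_multiples_le:
  assumes t: "ln t \<ge> 6" "t > 0" and Q: "admissible Q" and l: "l > 0"
  shows "(\<Sum>j=1..J. weight_sum Q (t - real j * l)) \<le> 2 * weight_sum Q t / (decay_rate t * l)"
proof -
  have t1: "t > 1" using t by (rule gt_1_if_ln_ge_6)
  have "(\<Sum>j=1..J. weight_sum Q (t - real j * l)) \<le>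
        (\<Sum>j=1..J. 2 * exp (- (decay_rate t * (t - (t - real j * l)))) * weight_sum Q t)"
    using l by (intro sum_mono weight_sum_exp_decay t Q) auto
  also have "\<dots> = 2 * weight_sum Q t * (\<Sum>j=1..J. exp (- ((decay_rate t * l) * real j)))"
    by (simp add: sum_distrib_left mult_ac)
  also have "\<dots> \<le> 2 * weight_sum Q t * (1 / (decay_rate t * l))"
    using l decay_rate_pos[OF t1] by (intro mult_left_mono sum_exp_multiples_le) auto
  finally show ?thesis by simp
qed

text \<open>The substitution i = j + r gives the second sum the factors i - r. Common terms then
  keep only the factor r, terms with i \<le> r have i at most r anyway, and terms with i > J enter
  negatively.\<close>

lemma sum_index_shift_diff_le:
  fixes g :: "nat \<Rightarrow> real"
  assumes "\<And>i. g i \<ge> 0"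
  shows "(\<Sum>j=1..J. real j * g j) - (\<Sum>j=1..J. real j * g (j + r)) \<le> real r * (\<Sum>j=1..J. g j)"
proof -
  have "(\<Sum>i=1..J. (real i - real r) * g i) \<le> (\<Sum>i\<in>{1..J} \<inter> {1 + r..J + r}. (real i - real r) * g i)"
  proof -
    have "(\<Sum>i=1..J. (real i - real r) * g i) = (\<Sum>i\<in>{1..J} \<inter> {1 + r..J + r}. (real i - real r) * g i)
        + (\<Sum>i\<in>{1..J} - {1 + r..J + r}. (real i - real r) * g i)"
      by (rule sum.Int_Diff) auto
    also have "(\<Sum>i\<in>{1..J} - {1 + r..J + r}. (real i - real r) * g i) \<le> 0"
      by (rule sum_nonpos) (auto intro!: mult_nonpos_nonneg assms)
    finally show ?thesis by simp
  qed
  also have "\<dots> \<le> (\<Sum>i\<in>{1 + r..J + r}. (real i - real r) * g i)"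
    by (rule sum_mono2) (auto intro!: mult_nonneg_nonneg assms)
  also have "\<dots> = (\<Sum>j=1..J. real j * g (j + r))"
    by (subst sum.shift_bounds_cl_nat_ivl) simp
  finally have "(\<Sum>i=1..J. (real i - real r) * g i) \<le> (\<Sum>j=1..J. real j * g (j + r))" .
  moreover have "(\<Sum>i=1..J. (real i - real r) * g i) = (\<Sum>j=1..J. real j * g j) - real r * (\<Sum>j=1..J. g j)"
    by (simp add: left_diff_distrib sum_subtractf sum_distrib_left)
  ultimately show ?thesis by simp
qed

text \<open>The bound 1 in the minimum serves the primes with \<open>p ln p \<le> h\<close>; for the others consecutive
  multiples of \<open>ln p\<close> telescope, leaving about \<open>h / ln p\<close> terms.\<close>

lemma valuation_sum_diff_le:
  assumes t: "ln t \<ge> 6" "t > 0" and Q: "admissible Q" and p: "prime p" "p \<notin> Q" and h: "h \<ge> 0"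
  shows "ln (real p) * (valuation_sum p Q t - valuation_sum p Q (t - h)) \<le>
         (2 * weight_sum Q t / decay_rate t) * min 1 ((h / ln (real p) + 1) / (real p + 1))"
proof -
  have t1: "t > 1" using t by (rule gt_1_if_ln_ge_6)
  have lp: "ln (real p) > 0" using p ln_prime_pos by auto
  note dr = decay_rate_pos[OF t1]
  have Qp: "\<And>q. q \<in> Q \<Longrightarrow> prime q" using Q by (auto simp: admissible_def)
  obtain J1 where "valuation_sum p Q t \<le> (\<Sum>j=1..J1. weight_sum Q (t - real j * ln (real p)))"
    using valuation_sum_le[OF p(1)] by blast
  also have "\<dots> \<le> 2 * weight_sum Q t / (decay_rate t * ln (real p))"
    by (rule sum_weight_sum_multiples_le[OF t Q lp])
  finally have "valuation_sum p Q t - valuation_sum p Q (t - h) \<le> 2 * weight_sum Q t / (decay_rate t * ln (real p))"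
    using valuation_sum_nonneg[of p Q "t - h"] by linarith
  hence a: "ln (real p) * (valuation_sum p Q t - valuation_sum p Q (t - h)) \<le> (2 * weight_sum Q t / decay_rate t) * 1"
    using lp dr by (simp add: field_simps)
  define J where "J = nat \<lfloor>t / ln (real p)\<rfloor>"
  have J: "u < real (Suc J) * ln (real p)" if "u \<le> t" for u
  proof -
    have "t / ln (real p) < real (Suc J)" using t lp unfolding J_def by (simp add: floor_less_iff) linarith
    hence "t < real (Suc J) * ln (real p)" using lp by (simp add: pos_divide_less_eq)
    thus ?thesis using that by linarith
  qed
  \<comment> \<open>Rounding h up to a multiple of ln p is the source of the summand 1 next to h /
    ln p.\<close>
  define r where "r = nat \<lceil>h / ln (real p)\<rceil>"
  have r: "real r \<ge> h / ln (real p)" "real r \<le> h / ln (real p) + 1"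
  proof -
    have "h / ln (real p) \<ge> 0" using h lp by simp
    thus "real r \<ge> h / ln (real p)" "real r \<le> h / ln (real p) + 1" unfolding r_def by linarith+
  qed
  have rh: "h \<le> real r * ln (real p)" using r lp by (simp add: pos_divide_le_eq)
  let ?g = "\<lambda>i. weight_sum (insert p Q) (t - real i * ln (real p))"
  have "(real p + 1) * (valuation_sum p Q t - valuation_sum p Q (t - h)) =
     (\<Sum>j=1..J. real j * ?g j) - (\<Sum>j=1..J. real j * weight_sum (insert p Q) (t - h - real j * ln (real p)))"
    unfolding right_diff_distrib using h
    by (subst (1 2) valuation_sum_eq[OF p Qp J]) (auto simp del: mult_divide_mult_cancel_left_if)
  also have "\<dots> \<le> (\<Sum>j=1..J. real j * ?g j) - (\<Sum>j=1..J. real j * ?g (j + r))"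
    using rh by (intro diff_left_mono sum_mono mult_left_mono weight_sum_mono) (auto simp: algebra_simps)
  also have "\<dots> \<le> real r * (\<Sum>j=1..J. ?g j)" by (rule sum_index_shift_diff_le) auto
  also have "\<dots> \<le> real r * (\<Sum>j=1..J. weight_sum Q (t - real j * ln (real p)))"
    by (intro mult_left_mono sum_mono weight_sum_antimono) auto
  also have "\<dots> \<le> real r * (2 * weight_sum Q t / (decay_rate t * ln (real p)))"
    by (intro mult_left_mono sum_weight_sum_multiples_le[OF t Q lp]) auto
  also have "\<dots> \<le> (h / ln (real p) + 1) * (2 * weight_sum Q t / (decay_rate t * ln (real p)))"
    using r lp dr by (intro mult_right_mono) auto
  finally have "ln (real p) / (real p + 1) * ((real p + 1) * (valuation_sum p Q t - valuation_sum p Q (t - h))) \<le>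
      ln (real p) / (real p + 1) * ((h / ln (real p) + 1) * (2 * weight_sum Q t / (decay_rate t * ln (real p))))"
    using lp by (intro mult_left_mono) auto
  moreover have "ln (real p) / (real p + 1) * ((real p + 1) * (valuation_sum p Q t - valuation_sum p Q (t - h))) =
      ln (real p) * (valuation_sum p Q t - valuation_sum p Q (t - h))" by simp
  moreover have "ln (real p) / (real p + 1) * ((h / ln (real p) + 1) * (2 * weight_sum Q t / (decay_rate t * ln (real p)))) =
      (2 * weight_sum Q t / decay_rate t) * ((h / ln (real p) + 1) / (real p + 1))"
    using lp dr by (simp add: divide_simps)
  ultimately have b: "ln (real p) * (valuation_sum p Q t - valuation_sum p Q (t - h)) \<le>
      (2 * weight_sum Q t / decay_rate t) * ((h / ln (real p) + 1) / (real p + 1))" by simp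
  show ?thesis using a b by (cases "1 \<le> (h / ln (real p) + 1) / (real p + 1)") (auto simp: min_def)
qed

text \<open>Integers in the window satisfy ln n \<ge> t / 2, so weighting by ln n turns the window
  into a sum over primes of valuation differences. Primes up to \<surd>h get the trivial bound 1,
  the larger ones contribute about h / ln h. Without this saving of ln h, windows of length
  comparable to \<surd>(t ln t) would be out of reach.\<close>

lemma weight_sum_diff_le:
  assumes t: "ln t \<ge> 6" "t > 0" and Q: "admissible Q" and h: "h > 1" "h \<le> t / 2"
    and C: "(\<Sum>p\<in>primes_upto (exp t). 1 / real p) \<le> C * ln t"
  shows "weight_sum Q t - weight_sum Q (t - h) \<le>
         (512 * root_scale t / t) * (sqrt h + 16 * h / ln h + C * ln t) * weight_sum Q t"
proof -
  have t1: "t > 1" using t by (rule gt_1_if_ln_ge_6)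
  note dr = decay_rate_pos[OF t1]
  let ?D = "coprime_upto Q t - coprime_upto Q (t - h)"
  let ?P = "primes_upto (exp t) - Q"
  let ?W = "2 * weight_sum Q t / decay_rate t"
  have sub: "coprime_upto Q (t - h) \<subseteq> coprime_upto Q t" using h by (intro coprime_upto_mono) auto
  have Qp: "\<And>q. q \<in> Q \<Longrightarrow> prime q" using Q by (auto simp: admissible_def)
  have "weight_sum Q t - weight_sum Q (t - h) = (\<Sum>n\<in>?D. kernel_weight n)"
    unfolding weight_sum_def using sub by (subst sum_diff) auto
  hence "(t / 2) * (weight_sum Q t - weight_sum Q (t - h)) \<le> (\<Sum>n\<in>?D. kernel_weight n * (t / 2))"
    by (simp add: sum_distrib_right sum_distrib_left mult.commute)
  also have "\<dots> \<le> (\<Sum>n\<in>?D. kernel_weight n * (\<Sum>p\<in>?P. real (multiplicity p n) * ln (real p)))"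
  proof (intro sum_mono mult_left_mono)
    fix n assume n: "n \<in> ?D"
    hence n': "n > 0" "ln (real n) \<le> t" "ln (real n) > t - h" "\<forall>q\<in>Q. \<not> q dvd n"
      by (auto simp: coprime_upto_def)
    have "real n \<le> exp t" using n' by (metis exp_le_cancel_iff exp_ln of_nat_0_less_iff)
    hence "prime_factors n \<subseteq> ?P"
      using n' by (auto simp: primes_upto_def in_prime_factors_iff dest!: dvd_imp_le)
    hence "ln (real n) = (\<Sum>p\<in>?P. real (multiplicity p n) * ln (real p))"
      using n' by (intro ln_eq_sum_multiplicity) (auto simp: primes_upto_def)
    thus "t / 2 \<le> (\<Sum>p\<in>?P. real (multiplicity p n) * ln (real p))" using n' h by linarith
  qed auto
  also have "\<dots> = (\<Sum>p\<in>?P. ln (real p) * (\<Sum>n\<in>?D. kernel_weight n * real (multiplicity p n)))"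
    unfolding sum_distrib_left by (subst sum.swap) (simp add: mult_ac)
  also have "\<dots> = (\<Sum>p\<in>?P. ln (real p) * (valuation_sum p Q t - valuation_sum p Q (t - h)))"
    unfolding valuation_sum_def using sub by (intro sum.cong refl, subst sum_diff) auto
  also have "\<dots> \<le> (\<Sum>p\<in>?P. ?W * min 1 ((h / ln (real p) + 1) / (real p + 1)))"
    using h by (intro sum_mono valuation_sum_diff_le t Q) (auto simp: primes_upto_def)
  also have "\<dots> = ?W * (\<Sum>p\<in>?P. min 1 ((h / ln (real p) + 1) / (real p + 1)))"
    by (simp add: sum_distrib_left)
  also have "\<dots> \<le> ?W * (sqrt h + 16 * h / ln h + C * ln t)"
  proof (rule mult_left_mono)
    let ?A = "primes_upto (sqrt h)"
    have s1: "sqrt h > 1" using h by simp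
    have "(\<Sum>p\<in>?P. min 1 ((h / ln (real p) + 1) / (real p + 1))) \<le>
          (\<Sum>p\<in>?A \<union> (primes_upto (exp t) - ?A). min 1 ((h / ln (real p) + 1) / (real p + 1)))"
      using h by (intro sum_mono2) (auto simp: primes_upto_def prime_gt_0_nat Suc_le_eq intro!: divide_nonneg_nonneg add_nonneg_nonneg)
    also have "\<dots> = (\<Sum>p\<in>?A. min 1 ((h / ln (real p) + 1) / (real p + 1))) +
        (\<Sum>p\<in>primes_upto (exp t) - ?A. min 1 ((h / ln (real p) + 1) / (real p + 1)))"
      by (rule sum.union_disjoint) auto
    also have "\<dots> \<le> sqrt h + (16 * h / ln h + C * ln t)"
    proof (rule add_mono)
      have "(\<Sum>p\<in>?A. min 1 ((h / ln (real p) + 1) / (real p + 1))) \<le> (\<Sum>p\<in>?A. 1)"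
        by (intro sum_mono) auto
      also have "\<dots> = real (card ?A)" by simp
      also have "card ?A \<le> card {1..nat \<lfloor>sqrt h\<rfloor>}"
        using s1 by (intro card_mono) (auto simp: primes_upto_floor prime_gt_0_nat Suc_le_eq)
      also have "real (card {1..nat \<lfloor>sqrt h\<rfloor>}) \<le> sqrt h" using s1 by simp
      finally show "(\<Sum>p\<in>?A. min 1 ((h / ln (real p) + 1) / (real p + 1))) \<le> sqrt h" by simp
    next
      have "(\<Sum>p\<in>primes_upto (exp t) - ?A. min 1 ((h / ln (real p) + 1) / (real p + 1))) \<le>
            (\<Sum>p\<in>primes_upto (exp t) - ?A. h * (1 / (real p * ln (real p))) + 1 / real p)"
      proof (rule sum_mono)
        fix p assume "p \<in> primes_upto (exp t) - ?A"
        hence p: "prime p" by (auto simp: primes_upto_def)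
        have lp: "ln (real p) > 0" using p ln_prime_pos by auto
        have p0: "real p > 0" using p prime_gt_0_nat by simp
        have "min 1 ((h / ln (real p) + 1) / (real p + 1)) \<le> (h / ln (real p) + 1) / (real p + 1)" by simp
        also have "\<dots> \<le> (h / ln (real p) + 1) / real p"
          using h lp p0 by (intro divide_left_mono add_nonneg_nonneg) auto
        also have "\<dots> = h * (1 / (real p * ln (real p))) + 1 / real p"
          by (simp add: add_divide_distrib mult.commute)
        finally show "min 1 ((h / ln (real p) + 1) / (real p + 1)) \<le> h * (1 / (real p * ln (real p))) + 1 / real p" .
      qed
      also have "\<dots> = h * (\<Sum>p\<in>primes_upto (exp t) - ?A. 1 / (real p * ln (real p))) +
                     (\<Sum>p\<in>primes_upto (exp t) - ?A. 1 / real p)"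
        by (simp add: sum.distrib sum_distrib_left)
      also have "\<dots> \<le> h * (8 / ln (sqrt h)) + C * ln t"
      proof (intro add_mono mult_left_mono sum_recip_prime_ln_tail s1)
        have "(\<Sum>p\<in>primes_upto (exp t) - ?A. 1 / real p) \<le> (\<Sum>p\<in>primes_upto (exp t). 1 / real p)"
          by (intro sum_mono2) auto
        thus "(\<Sum>p\<in>primes_upto (exp t) - ?A. 1 / real p) \<le> C * ln t" using C by linarith
      qed (use h in auto)
      also have "\<dots> = 16 * h / ln h + C * ln t" using h by (simp add: ln_sqrt)
      finally show "(\<Sum>p\<in>primes_upto (exp t) - ?A. min 1 ((h / ln (real p) + 1) / (real p + 1))) \<le> 16 * h / ln h + C * ln t" .
    qed
    finally show "(\<Sum>p\<in>?P. min 1 ((h / ln (real p) + 1) / (real p + 1))) \<le> sqrt h + 16 * h / ln h + C * ln t" by simp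
  qed (use dr in auto)
  finally have 1: "(t / 2) * (weight_sum Q t - weight_sum Q (t - h)) \<le> ?W * (sqrt h + 16 * h / ln h + C * ln t)" .
  have nn: "sqrt h + 16 * h / ln h + C * ln t \<ge> 0"
  proof -
    have "0 \<le> (\<Sum>p\<in>primes_upto (exp t). 1 / real p)" by (intro sum_nonneg) auto
    hence "C * ln t \<ge> 0" using C by linarith
    thus ?thesis using h by (intro add_nonneg_nonneg) auto
  qed
  \<comment> \<open>256 = 2 * 64 * 2, the last factor from ln 2 \<ge> 1/2. Dividing by t / 2
    afterwards yields the constant 512.\<close>
  have "?W \<le> 256 * root_scale t * weight_sum Q t"
  proof -
    have "1 / decay_rate t = 64 * root_scale t / ln 2" by (simp add: decay_rate_def)
    also have "\<dots> \<le> 64 * root_scale t / (1/2)" using ln2_ge_half root_scale_pos[OF t1] by (intro divide_left_mono) auto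
    finally have "(2 * weight_sum Q t) * (1 / decay_rate t) \<le> (2 * weight_sum Q t) * (128 * root_scale t)"
      by (intro mult_left_mono) auto
    thus ?thesis by (simp add: mult_ac)
  qed
  hence "?W * (sqrt h + 16 * h / ln h + C * ln t) \<le> 256 * root_scale t * weight_sum Q t * (sqrt h + 16 * h / ln h + C * ln t)"
    using nn by (intro mult_right_mono)
  hence "(t / 2) * (weight_sum Q t - weight_sum Q (t - h)) \<le>
      256 * root_scale t * weight_sum Q t * (sqrt h + 16 * h / ln h + C * ln t)" using 1 by linarith
  hence "(weight_sum Q t - weight_sum Q (t - h)) \<le>
      (256 * root_scale t * weight_sum Q t * (sqrt h + 16 * h / ln h + C * ln t)) / (t / 2)"
    using t by (subst pos_le_divide_eq) (auto simp: mult.commute)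
  moreover have "(256 * root_scale t * weight_sum Q t * X) / (t / 2) = (512 * root_scale t / t) * X * weight_sum Q t" for X
    by simp
  ultimately show ?thesis by (simp only:)
qed

text \<open>The converse of the halving: over a small multiple of the same length at most half is
  lost, so \<surd>(t ln t) is the true scale of variation.\<close>

lemma weight_sum_regular:
  "\<exists>e>0. \<forall>\<^sub>F t in at_top. e * root_scale t \<le> t \<and> (\<forall>Q. admissible Q \<longrightarrow> weight_sum Q t \<le> 2 * weight_sum Q (t - e * root_scale t))"
proof -
  obtain C where C: "C > 0" "\<And>t. t \<ge> 2 \<Longrightarrow> (\<Sum>p\<in>primes_upto (exp t). 1 / real p) \<le> C * ln t"
    using sum_recip_prime_le by blast
  \<comment> \<open>For h = e \<surd>(t ln t) one has ln h \<ge> ln t / 2, so the dominant term is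
    at most 512 * 16 * 2 * e = 2^14 e, which becomes 1/4; the remaining terms tend to 0.\<close>
  define e :: real where "e = 1 / 2^16"
  have e: "e > 0" by (simp add: e_def)
  have ev1: "\<forall>\<^sub>F t::real in at_top. (512 * sqrt (t * ln t) / t) * (sqrt (e * sqrt (t * ln t)) + C * ln t) < 1/4"
  proof (rule order_tendstoD(2))
    show "((\<lambda>t. (512 * sqrt (t * ln t) / t) * (sqrt (e * sqrt (t * ln t)) + C * ln t)) \<longlongrightarrow> 0) at_top"
      using e C by real_asymp
  qed auto
  have ev2: "\<forall>\<^sub>F t::real in at_top. ln t \<ge> 6" by real_asymp
  have ev3: "\<forall>\<^sub>F t::real in at_top. e * sqrt (t * ln t) > sqrt t" unfolding e_def by real_asymp
  have ev4: "\<forall>\<^sub>F t::real in at_top. e * sqrt (t * ln t) \<le> t / 2" unfolding e_def by real_asymp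
  have "\<forall>\<^sub>F t::real in at_top. e * root_scale t \<le> t \<and> (\<forall>Q. admissible Q \<longrightarrow> weight_sum Q t \<le> 2 * weight_sum Q (t - e * root_scale t))"
    using ev1 ev2 ev3 ev4 eventually_gt_at_top[of 2]
  proof eventually_elim
    case (elim t)
    define h where "h = e * root_scale t"
    have t: "t > 2" "ln t \<ge> 6" using elim by auto
    have h: "h > sqrt t" "h \<le> t / 2" using elim by (auto simp: h_def root_scale_def)
    have h1: "h > 1" using h t by (meson less_trans real_sqrt_gt_1_iff one_less_numeral_iff semiring_norm(76))
    have "ln (sqrt t) \<le> ln h" using h t by (intro ln_mono) auto
    hence lh: "ln h \<ge> ln t / 2" using t by (simp add: ln_sqrt)
    have "weight_sum Q t \<le> 2 * weight_sum Q (t - h)" if Q: "admissible Q" for Q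
    proof -
      have "weight_sum Q t - weight_sum Q (t - h) \<le>
         (512 * root_scale t / t) * (sqrt h + 16 * h / ln h + C * ln t) * weight_sum Q t"
        using t h h1 Q C(2)[of t] by (intro weight_sum_diff_le) auto
      also have "\<dots> \<le> 1/2 * weight_sum Q t"
      proof (rule mult_right_mono)
        have "(512 * root_scale t / t) * (16 * h / ln h) \<le> (512 * root_scale t / t) * (16 * h / (ln t / 2))"
          using lh t h1 root_scale_pos[of t] by (intro mult_left_mono divide_left_mono) auto
        also have "\<dots> = 16384 * e * (root_scale t * root_scale t) / (t * ln t)"
          by (simp add: h_def field_simps)
        also have "root_scale t * root_scale t = t * ln t" using t by (simp add: root_scale_def)
        also have "16384 * e * (t * ln t) / (t * ln t) = 1/4" using t by (simp add: e_def)
        finally have "(512 * root_scale t / t) * (16 * h / ln h) \<le> 1/4" .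
        moreover have "(512 * root_scale t / t) * (sqrt h + C * ln t) < 1/4"
          using elim by (simp add: h_def root_scale_def)
        ultimately show "(512 * root_scale t / t) * (sqrt h + 16 * h / ln h + C * ln t) \<le> 1/2"
          by (simp add: distrib_left)
      qed auto
      finally show ?thesis by simp
    qed
    moreover have "h \<le> t" using h t by linarith
    ultimately show ?case unfolding h_def by auto
  qed
  thus ?thesis using e by blast
qed

text \<open>By regularity the exponent of \<open>p\<close> is spread over about \<open>\<surd>(t ln t) / ln p\<close> values, so that it is
  rarely 0.\<close>

lemma weight_sum_exclude_prime:
  "\<exists>C>0. \<forall>\<^sub>F t in at_top. \<forall>Q p. prime p \<longrightarrow> p \<notin> Q \<longrightarrow> admissible (insert p Q) \<longrightarrow>
     weight_sum (insert p Q) t \<le> C * (real p * ln (real p)) / root_scale t * weight_sum Q t"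
proof -
  obtain e where e: "e > 0" and ev: "\<forall>\<^sub>F t in at_top. e * root_scale t \<le> t \<and> (\<forall>Q. admissible Q \<longrightarrow> weight_sum Q t \<le> 2 * weight_sum Q (t - e * root_scale t))"
    using weight_sum_regular by blast
  have "\<forall>\<^sub>F t in at_top. \<forall>Q p. prime p \<longrightarrow> p \<notin> Q \<longrightarrow> admissible (insert p Q) \<longrightarrow>
     weight_sum (insert p Q) t \<le> (8 / e) * (real p * ln (real p)) / root_scale t * weight_sum Q t"
    using ev eventually_gt_at_top[of 1]
  proof eventually_elim
    case (elim t)
    show ?case
    proof (intro allI impI)
      fix Q p assume p: "prime p" "p \<notin> Q" and a: "admissible (insert p Q)"
      define h where "h = e * root_scale t"
      have h: "h > 0" "h \<le> t" using elim e root_scale_pos[of t] by (auto simp: h_def)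
      have lp: "ln (real p) > 0" using p ln_prime_pos by auto
      have p1: "real p \<ge> 1" using p prime_gt_0_nat[of p] by simp
      have Qp: "\<And>q. q \<in> Q \<Longrightarrow> prime q" using a by (auto simp: admissible_def)
      let ?N = "weight_sum Q t" let ?N' = "weight_sum (insert p Q)"
      \<comment> \<open>Regularity is applied to the sum with p already excluded, which is why
        \<open>insert p Q\<close> has to be admissible.\<close>
      have half: "?N' t \<le> 2 * ?N' (t - h)" using elim a by (auto simp: h_def)
      have le: "?N' t \<le> 8 * (real p * ln (real p)) / h * ?N"
      proof (cases "ln (real p) \<le> h")
        case False
        have "?N' t \<le> 1 * ?N" by (simp, intro weight_sum_antimono) auto
        also have "1 \<le> 8 * (real p * ln (real p)) / h"
        proof -
          have "1 * h \<le> (8 * real p) * ln (real p)" using False p1 h by (intro mult_mono) auto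
          thus ?thesis using h by (simp add: pos_le_divide_eq mult.assoc)
        qed
        hence "1 * ?N \<le> 8 * (real p * ln (real p)) / h * ?N" by (intro mult_right_mono) auto
        finally show ?thesis .
      next
        case True
        define J where "J = nat \<lfloor>t / ln (real p)\<rfloor>"
        define J0 where "J0 = nat \<lfloor>h / ln (real p)\<rfloor>"
        have J: "t < real (Suc J) * ln (real p)"
        proof -
          have "t / ln (real p) < real (Suc J)" using h lp unfolding J_def by (simp add: floor_less_iff) linarith
          thus ?thesis using lp by (simp add: pos_divide_less_eq)
        qed
        have J0J: "J0 \<le> J" unfolding J_def J0_def using h lp by (intro nat_mono floor_mono divide_right_mono) auto
        have J0ub: "real J0 * ln (real p) \<le> h"
        proof -
          have "real J0 \<le> h / ln (real p)" unfolding J0_def using h lp by (simp add: of_nat_floor)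
          thus ?thesis using lp by (simp add: pos_le_divide_eq)
        qed
        have J0lb: "real J0 \<ge> h / (2 * ln (real p))"
        proof -
          have "h / ln (real p) \<ge> 1" using True lp by simp
          hence "real J0 \<ge> (h / ln (real p)) / 2" unfolding J0_def by (rule nat_floor_ge_half)
          thus ?thesis by (simp add: field_simps)
        qed
        have "h / (2 * ln (real p)) * (?N' t / 2) \<le> real J0 * ?N' (t - h)"
          using J0lb half h lp by (intro mult_mono) auto
        also have "\<dots> = (\<Sum>j=1..J0. ?N' (t - h))" by simp
        also have "\<dots> \<le> (\<Sum>j=1..J0. ?N' (t - real j * ln (real p)))"
        proof (intro sum_mono weight_sum_mono)
          fix j assume "j \<in> {1..J0}"
          hence "real j * ln (real p) \<le> real J0 * ln (real p)" using lp by (intro mult_right_mono) auto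
          thus "t - h \<le> t - real j * ln (real p)" using J0ub by linarith
        qed
        also have "\<dots> \<le> (\<Sum>j=1..J. ?N' (t - real j * ln (real p)))"
          using J0J by (intro sum_mono2) auto
        also have "\<dots> = (real p + 1) * (?N - ?N' t)"
          by (subst weight_sum_split[OF p Qp J]) auto
        also have "\<dots> \<le> (2 * real p) * ?N" using p1 by (intro mult_mono) (auto intro: weight_sum_antimono)
        finally show ?thesis using h lp by (simp add: field_simps)
      qed
      thus "?N' t \<le> (8 / e) * (real p * ln (real p)) / root_scale t * ?N"
        using e by (simp add: h_def field_simps)
    qed
  qed
  thus ?thesis using e by (intro exI[of _ "8 / e"]) auto
qed

text \<open>The powers of 3 telescope: exponent 0 has weight 1 and every other exponent weight 1/4,
  so the difference is the right-hand side minus 3/4 of its value at t - ln 3. The step must be the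
  logarithm of a prime, and 2 is reserved for the periodization.\<close>

lemma weight_sum_ln3_diff_le:
  assumes "admissible Q" "3 \<notin> Q" "t \<ge> 0"
  shows "weight_sum Q t - weight_sum Q (t - ln 3) \<le> weight_sum (insert 3 Q) t"
proof -
  have Qp: "\<And>q. q \<in> Q \<Longrightarrow> prime q" using assms by (auto simp: admissible_def)
  have 3: "prime (3::nat)" by simp
  define J where "J = Suc (nat \<lfloor>t / ln 3\<rfloor>)"
  have l3: "ln 3 > (0::real)" by simp
  have "t / ln 3 < real J" unfolding J_def using assms(3) l3 by (simp add: floor_less_iff) linarith
  hence J: "t < real J * ln 3" using l3 by (simp add: pos_divide_less_eq)
  let ?N' = "weight_sum (insert 3 Q)"
  have 1: "weight_sum Q t = ?N' t + (1/4) * (\<Sum>j=1..J. ?N' (t - real j * ln 3))"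
    using weight_sum_split[OF 3 assms(2) Qp, of t J] J l3 by (simp add: algebra_simps)
  have 2: "weight_sum Q (t - ln 3) = ?N' (t - ln 3) + (1/4) * (\<Sum>j=1..J. ?N' (t - ln 3 - real j * ln 3))"
    using weight_sum_split[OF 3 assms(2) Qp, of "t - ln 3" J] J l3 by (simp add: algebra_simps)
  have "(\<Sum>j=1..J. ?N' (t - real j * ln 3)) \<le> (\<Sum>j=0..J. ?N' (t - ln 3 - real j * ln 3))"
  proof -
    have "(\<Sum>j=0..J. ?N' (t - ln 3 - real j * ln 3)) = (\<Sum>j=1..Suc J. ?N' (t - real j * ln 3))"
      using sum.shift_bounds_cl_Suc_ivl[of "\<lambda>j. ?N' (t - real j * ln 3)" 0 J] by (simp add: algebra_simps)
    thus ?thesis by simp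
  qed
  also have "\<dots> = ?N' (t - ln 3) + (\<Sum>j=1..J. ?N' (t - ln 3 - real j * ln 3))"
    by (simp add: sum.atLeast_Suc_atMost)
  finally have "(1/4) * (\<Sum>j=1..J. ?N' (t - real j * ln 3)) \<le> (1/4) * ?N' (t - ln 3) + (1/4) * (\<Sum>j=1..J. ?N' (t - ln 3 - real j * ln 3))"
    by (simp add: distrib_left)
  moreover have "?N' (t - ln 3) \<ge> 0" by simp
  ultimately show ?thesis using 1 2 by linarith
qed

section \<open>Regularity and tilting\<close>

lemma root_scale_mono: "1 \<le> s \<Longrightarrow> s \<le> t \<Longrightarrow> root_scale s \<le> root_scale t"
  unfolding root_scale_def by (intro real_sqrt_le_mono mult_mono) auto

lemma weight_sum_ln3_step:
  "\<exists>C>0. \<forall>\<^sub>F t in at_top. \<forall>Q\<in>{{}, {2}}.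
     weight_sum Q t - weight_sum Q (t - ln 3) \<le> C / root_scale t * weight_sum Q t"
proof -
  obtain C where C: "C > 0" and ev: "\<forall>\<^sub>F t in at_top. \<forall>Q p. prime p \<longrightarrow> p \<notin> Q \<longrightarrow> admissible (insert p Q) \<longrightarrow>
     weight_sum (insert p Q) t \<le> C * (real p * ln (real p)) / root_scale t * weight_sum Q t"
    using weight_sum_exclude_prime by blast
  have "\<forall>\<^sub>F t in at_top. \<forall>Q\<in>{{}, {2}}.
     weight_sum Q t - weight_sum Q (t - ln 3) \<le> (C * (3 * ln 3)) / root_scale t * weight_sum Q t"
    using ev eventually_ge_at_top[of 0]
  proof eventually_elim
    case (elim t)
    show ?case
    proof
      fix Q :: "nat set" assume Q: "Q \<in> {{}, {2}}"
      have a: "admissible (insert 3 Q)" "admissible Q" "3 \<notin> Q"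
        using Q by (auto simp: admissible_def card_insert_if)
      have "weight_sum Q t - weight_sum Q (t - ln 3) \<le> weight_sum (insert 3 Q) t"
        using a elim by (intro weight_sum_ln3_diff_le) auto
      also have "\<dots> \<le> C * (real 3 * ln (real 3)) / root_scale t * weight_sum Q t"
        using elim(1)[rule_format, of 3 Q] a by simp
      finally show "weight_sum Q t - weight_sum Q (t - ln 3) \<le> (C * (3 * ln 3)) / root_scale t * weight_sum Q t" by simp
    qed
  qed
  thus ?thesis using C by (intro exI[of _ "C * (3 * ln 3)"]) auto
qed

text \<open>Each step of length ln 3 multiplies the sum by a factor tending to 1, so growth is
  slower than any exponential. The condition a \<le> 1/2 makes rounding to whole steps cost at most
  \<surd>3 \<le> 2. This makes the range n > exp t summable against the tent.\<close>

lemma weight_sum_growth: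
  assumes a: "a > 0" "a \<le> 1/2"
  shows "\<forall>\<^sub>F t in at_top. \<forall>Q\<in>{{}, {2}}. \<forall>s\<ge>0. weight_sum Q (t + s) \<le> 2 * exp (a * s) * weight_sum Q t"
proof -
  obtain C where C: "C > 0" and ev: "\<forall>\<^sub>F t in at_top. \<forall>Q\<in>{{}, {2}}.
     weight_sum Q t - weight_sum Q (t - ln 3) \<le> C / root_scale t * weight_sum Q t"
    using weight_sum_ln3_step by blast
  have "\<forall>\<^sub>F t in at_top. C / sqrt (t * ln t) < 1 - exp (- (a * ln 3))"
  proof (rule order_tendstoD(2))
    show "((\<lambda>t. C / sqrt (t * ln t)) \<longlongrightarrow> 0) at_top" using C by real_asymp
    show "0 < 1 - exp (- (a * ln 3))" using a by simp
  qed
  hence "\<forall>\<^sub>F t in at_top. (\<forall>Q\<in>{{}, {2}}. weight_sum Q t - weight_sum Q (t - ln 3) \<le> C / root_scale t * weight_sum Q t) \<and>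
            C / root_scale t < 1 - exp (- (a * ln 3))"
    using ev by (auto simp: root_scale_def eventually_conj_iff)
  then obtain T where T: "\<And>t Q. t \<ge> T \<Longrightarrow> Q \<in> {{}, {2}} \<Longrightarrow> weight_sum Q t - weight_sum Q (t - ln 3) \<le> C / root_scale t * weight_sum Q t"
      "\<And>t. t \<ge> T \<Longrightarrow> C / root_scale t < 1 - exp (- (a * ln 3))"
    unfolding eventually_at_top_linorder by blast
  have l3: "ln 3 > (0::real)" by simp
  have e3: "exp (a * ln 3) \<le> 2"
  proof -
    have "exp (a * ln 3) \<le> exp (1/2 * ln 3)" using a by simp
    also have "\<dots> = sqrt 3" by (simp add: powr_half_sqrt[symmetric] powr_def)
    also have "\<dots> \<le> 2" by (rule real_le_lsqrt) auto
    finally show ?thesis .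
  qed
  show ?thesis
    using eventually_ge_at_top[of T]
  proof eventually_elim
    case (elim t)
    show ?case
    proof (intro ballI allI impI)
      fix Q :: "nat set" and s :: real assume Q: "Q \<in> {{}, {2}}" and s: "s \<ge> 0"
      have step: "weight_sum Q (t + real i * ln 3) \<le> exp (real i * (a * ln 3)) * weight_sum Q t" for i
      proof (induction i)
        case (Suc i)
        let ?u = "t + real (Suc i) * ln 3"
        have u: "?u \<ge> T" using elim l3 by (simp add: add_increasing2)
        have "weight_sum Q ?u - weight_sum Q (?u - ln 3) \<le> C / root_scale ?u * weight_sum Q ?u"
          by (rule T(1)[OF u Q])
        also have "\<dots> \<le> (1 - exp (- (a * ln 3))) * weight_sum Q ?u"
          using T(2)[OF u] by (intro mult_right_mono) auto
        finally have "exp (- (a * ln 3)) * weight_sum Q ?u \<le> weight_sum Q (?u - ln 3)" by (simp add: algebra_simps)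
        also have "?u - ln 3 = t + real i * ln 3" by (simp add: algebra_simps)
        finally have "exp (a * ln 3) * (exp (- (a * ln 3)) * weight_sum Q ?u) \<le> exp (a * ln 3) * weight_sum Q (t + real i * ln 3)"
          by (intro mult_left_mono) auto
        also have "exp (a * ln 3) * (exp (- (a * ln 3)) * weight_sum Q ?u) = weight_sum Q ?u"
          by (simp add: mult.assoc[symmetric] exp_minus)
        also have "exp (a * ln 3) * weight_sum Q (t + real i * ln 3) \<le> exp (a * ln 3) * (exp (real i * (a * ln 3)) * weight_sum Q t)"
          using Suc by (intro mult_left_mono) auto
        also have "\<dots> = exp (real (Suc i) * (a * ln 3)) * weight_sum Q t"
          unfolding mult.assoc[symmetric] exp_add[symmetric] by (simp add: algebra_simps)
        finally show ?case .
      qed simp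
      define i where "i = nat \<lceil>s / ln 3\<rceil>"
      have "s / ln 3 \<ge> 0" using s by simp
      hence i: "s / ln 3 \<le> real i" "real i \<le> s / ln 3 + 1" unfolding i_def by linarith+
      have i1: "s \<le> real i * ln 3" using i l3 by (simp add: pos_divide_le_eq)
      have i2: "real i * ln 3 \<le> s + ln 3"
      proof -
        have "real i * ln 3 \<le> (s / ln 3 + 1) * ln 3" using i l3 by (intro mult_right_mono) auto
        thus ?thesis by (simp add: algebra_simps)
      qed
      have "weight_sum Q (t + s) \<le> weight_sum Q (t + real i * ln 3)" using i1 by (intro weight_sum_mono) auto
      also have "\<dots> \<le> exp (real i * (a * ln 3)) * weight_sum Q t" by (rule step)
      also have "\<dots> \<le> exp (a * ln 3 + a * s) * weight_sum Q t"
      proof (intro mult_right_mono)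
        have "a * (real i * ln 3) \<le> a * (s + ln 3)" using a i2 by (intro mult_left_mono) auto
        thus "exp (real i * (a * ln 3)) \<le> exp (a * ln 3 + a * s)" by (simp add: algebra_simps)
      qed auto
      also have "\<dots> \<le> 2 * exp (a * s) * weight_sum Q t"
        using e3 by (intro mult_right_mono) (auto simp: exp_add)
      finally show "weight_sum Q (t + s) \<le> 2 * exp (a * s) * weight_sum Q t" .
    qed
  qed
qed

text \<open>Steps of length ln 3 are added up. The condition u \<le> t / 2 keeps all arguments above
  t / 3, where \<open>root_scale\<close> is still at least a third of
  \<open>root_scale t\<close>.\<close>

lemma weight_sum_window:
  "\<exists>C>0. \<forall>\<^sub>F t in at_top. \<forall>Q\<in>{{}, {2}}. \<forall>u. 0 \<le> u \<longrightarrow> u \<le> t / 2 \<longrightarrow>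
     weight_sum Q t - weight_sum Q (t - u) \<le> C * (1 + u) / root_scale t * weight_sum Q t"
proof -
  obtain C where C: "C > 0" and ev: "\<forall>\<^sub>F t in at_top. \<forall>Q\<in>{{}, {2}}.
     weight_sum Q t - weight_sum Q (t - ln 3) \<le> C / root_scale t * weight_sum Q t"
    using weight_sum_ln3_step by blast
  then obtain T where T: "\<And>t Q. t \<ge> T \<Longrightarrow> Q \<in> {{}, {2}} \<Longrightarrow> weight_sum Q t - weight_sum Q (t - ln 3) \<le> C / root_scale t * weight_sum Q t"
    unfolding eventually_at_top_linorder by blast
  have l3: "ln 3 \<ge> (1::real)"
  proof -
    have "exp 1 \<le> (3::real)" using exp_le by simp
    thus ?thesis by (subst ln_ge_iff) auto
  qed
  have l3': "ln 3 \<le> (2::real)" using ln_le_minus_one[of "3::real"] by simp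
  have ev2: "\<forall>\<^sub>F t::real in at_top. ln (t / 3) \<ge> ln t / 3" by real_asymp
  have "\<forall>\<^sub>F t in at_top. \<forall>Q\<in>{{}, {2}}. \<forall>u. 0 \<le> u \<longrightarrow> u \<le> t / 2 \<longrightarrow>
     weight_sum Q t - weight_sum Q (t - u) \<le> (3 * C) * (1 + u) / root_scale t * weight_sum Q t"
    using ev2 eventually_ge_at_top[of "3 * T"] eventually_ge_at_top[of 12]
  proof eventually_elim
    case (elim t)
    show ?case
    proof (intro ballI allI impI)
      fix Q :: "nat set" and u :: real assume Q: "Q \<in> {{}, {2}}" and u: "0 \<le> u" "u \<le> t / 2"
      have r3: "root_scale (t/3) \<ge> root_scale t / 3"
      proof -
        have "root_scale t / 3 = sqrt (t / 3 * (ln t / 3))"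
          unfolding root_scale_def using elim by (simp add: real_sqrt_divide)
        also have "\<dots> \<le> root_scale (t / 3)"
          unfolding root_scale_def using elim by (intro real_sqrt_le_mono mult_left_mono) auto
        finally show ?thesis .
      qed
      have rp: "root_scale t > 0" using elim by (intro root_scale_pos) auto
      define i where "i = nat \<lceil>u / ln 3\<rceil>"
      have "u / ln 3 \<ge> 0" using u by simp
      hence i: "u / ln 3 \<le> real i" "real i \<le> u / ln 3 + 1" unfolding i_def by linarith+
      have i1: "u \<le> real i * ln 3" using i l3 by (simp add: pos_divide_le_eq)
      have i2: "real i * ln 3 \<le> u + ln 3"
      proof -
        have "real i * ln 3 \<le> (u / ln 3 + 1) * ln 3" using i l3 by (intro mult_right_mono) auto
        thus ?thesis by (simp add: algebra_simps)
      qed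
      have i3: "real i \<le> 1 + u"
      proof -
        have "u / ln 3 \<le> u / 1" using u l3 by (intro divide_left_mono) auto
        thus ?thesis using i by simp
      qed
      have step: "weight_sum Q t - weight_sum Q (t - real k * ln 3) \<le> real k * (3 * C / root_scale t * weight_sum Q t)" if "k \<le> i" for k
        using that
      proof (induction k)
        case (Suc k)
        let ?v = "t - real k * ln 3"
        have "real k * ln 3 \<le> real i * ln 3 - ln 3"
        proof -
          have "real (Suc k) * ln 3 \<le> real i * ln 3" using Suc.prems l3 by (intro mult_right_mono) auto
          thus ?thesis by (simp add: algebra_simps)
        qed
        hence v: "?v \<ge> t / 3" "?v \<ge> T" "?v \<le> t" using i2 u elim l3' l3 by auto
        have "weight_sum Q ?v - weight_sum Q (?v - ln 3) \<le> C / root_scale ?v * weight_sum Q ?v"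
          by (rule T[OF v(2) Q])
        also have "\<dots> \<le> (C / (root_scale t / 3)) * weight_sum Q t"
        proof (intro mult_mono divide_left_mono weight_sum_mono v)
          have "root_scale (t/3) \<le> root_scale ?v" using v elim by (intro root_scale_mono) auto
          thus "root_scale t / 3 \<le> root_scale ?v" using r3 by linarith
          thus "0 < root_scale ?v * (root_scale t / 3)" using rp by (intro mult_pos_pos) auto
        qed (use C rp in auto)
        also have "?v - ln 3 = t - real (Suc k) * ln 3" by (simp add: algebra_simps)
        finally have "weight_sum Q ?v - weight_sum Q (t - real (Suc k) * ln 3) \<le> 3 * C / root_scale t * weight_sum Q t" by (simp add: mult_ac)
        moreover have "real (Suc k) * D = real k * D + D" for D by (simp add: algebra_simps)
        ultimately show ?case using Suc.IH Suc.prems by (simp only:) linarith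
      qed simp
      have "weight_sum Q t - weight_sum Q (t - u) \<le> weight_sum Q t - weight_sum Q (t - real i * ln 3)"
        using i1 by (intro diff_left_mono weight_sum_mono) auto
      also have "\<dots> \<le> real i * (3 * C / root_scale t * weight_sum Q t)" by (rule step) simp
      also have "\<dots> \<le> (1 + u) * (3 * C / root_scale t * weight_sum Q t)"
        using i3 C rp by (intro mult_right_mono) auto
      also have "\<dots> = (3 * C) * (1 + u) / root_scale t * weight_sum Q t" by (simp add: mult_ac)
      finally show "weight_sum Q t - weight_sum Q (t - u) \<le> (3 * C) * (1 + u) / root_scale t * weight_sum Q t" .
    qed
  qed
  thus ?thesis using C by (intro exI[of _ "3 * C"]) auto
qed

text \<open>If P contains all prime factors of n, this is k(n)^l. The parameter P allows the factors
  p^l to be inserted one prime at a time.\<close>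

definition tilt :: "nat set \<Rightarrow> real \<Rightarrow> nat \<Rightarrow> real" where
  "tilt P l n = (\<Prod>p\<in>P \<inter> prime_factors n. real p powr l)"

lemma tilt_nonneg [simp]: "tilt P l n \<ge> 0"
  unfolding tilt_def by (intro prod_nonneg) auto

text \<open>Inserting p^l on the multiples of p adds (p^l - 1) / (p + 1) times a sum over the
  cut-offs s - j ln p. The exponential factor of the induction hypothesis turns that sum into a
  geometric series of size at most 1 / (p^l - 1), so p^l - 1 cancels and each prime costs only 1 + 1
  / (p + 1). For this the induction has to carry the decay in s.\<close>

lemma tilted_weight_sum_le:
  assumes t: "ln t \<ge> 6" "t > 0" and l: "0 < l" "l \<le> decay_rate t" and P: "finite P" "\<And>p. p \<in> P \<Longrightarrow> prime p" and s: "s \<le> t"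
  shows "(\<Sum>n\<in>coprime_upto {} s. kernel_weight n * tilt P l n) \<le>
         2 * weight_sum {} t * exp (- (l * (t - s))) * (\<Prod>p\<in>P. 1 + 1 / (real p + 1))"
  using P s
proof (induction P arbitrary: s rule: finite_induct)
  case empty
  have "admissible {}" by (simp add: admissible_def)
  from weight_sum_exp_decay[OF t this empty(2)]
  have "weight_sum {} s \<le> 2 * exp (- (decay_rate t * (t - s))) * weight_sum {} t" .
  also have "\<dots> \<le> 2 * exp (- (l * (t - s))) * weight_sum {} t"
    using l empty by (intro mult_right_mono mult_left_mono) (auto intro: mult_right_mono)
  finally show ?case by (simp add: tilt_def weight_sum_def mult_ac)
next
  case (insert p P)
  note lpos = l(1)
  have p: "prime p" "p \<notin> {}" using insert by auto
  have lp: "ln (real p) > 0" using p ln_prime_pos by auto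
  define A where "A s = (\<Sum>n\<in>coprime_upto {} s. kernel_weight n * tilt P l n)" for s
  define A' where "A' s = (\<Sum>n\<in>coprime_upto {p} s. kernel_weight n * tilt P l n)" for s
  define B where "B = 2 * weight_sum {} t * (\<Prod>p\<in>P. 1 + 1 / (real p + 1))"
  have B0: "B \<ge> 0" unfolding B_def by (intro mult_nonneg_nonneg prod_nonneg) auto
  have IH: "A s \<le> B * exp (- (l * (t - s)))" if "s \<le> t" for s
    using insert.IH[of s] insert.prems that unfolding A_def B_def by (simp add: mult_ac)
  have A'A: "A' s \<le> A s" for s unfolding A_def A'_def by (intro sum_mono2 coprime_upto_antimono) auto
  obtain J where J: "s < real (Suc J) * ln (real p)"
  proof -
    obtain n where "s / ln (real p) < real n" using reals_Archimedean2 by blast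
    hence "s / ln (real p) < real (Suc n)" by simp
    hence "s < real (Suc n) * ln (real p)" using lp by (simp add: pos_divide_less_eq)
    thus ?thesis using that by blast
  qed
  have 1: "A s = A' s + (1 / (real p + 1)) * (\<Sum>j=1..J. A' (s - real j * ln (real p)))"
  proof -
    have "(\<Sum>m\<in>coprime_upto {p} r. kernel_weight (p ^ j * m) * tilt P l (p ^ j * m)) = (1 / (real p + 1)) * A' r"
      if "j \<ge> 1" for j r
    proof -
      have "(\<Sum>m\<in>coprime_upto {p} r. kernel_weight (p ^ j * m) * tilt P l (p ^ j * m)) =
            (\<Sum>m\<in>coprime_upto {p} r. kernel_weight (p ^ j * m) * tilt P l m)"
      proof (intro sum.cong refl)
        fix m assume "m \<in> coprime_upto {p} r"
        hence "prime_factors (p ^ j * m) = Set.insert p (prime_factors m)"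
          using p that by (intro prime_factors_power_mult) (auto simp: coprime_upto_def)
        thus "kernel_weight (p ^ j * m) * tilt P l (p ^ j * m) = kernel_weight (p ^ j * m) * tilt P l m"
          using insert.hyps by (simp add: tilt_def)
      qed
      thus ?thesis using sum_kernel_weight_power_mult[OF p(1) that, of "{p}" "tilt P l" r] by (simp add: A'_def)
    qed
    thus ?thesis
      unfolding A_def by (subst sum_coprime_upto_split'[OF p _ J]) (auto simp: A'_def sum_distrib_left)
  qed
  have 2: "(\<Sum>n\<in>coprime_upto {} s. kernel_weight n * tilt (Set.insert p P) l n) =
           A' s + (real p powr l / (real p + 1)) * (\<Sum>j=1..J. A' (s - real j * ln (real p)))"
  proof -
    have "(\<Sum>m\<in>coprime_upto {p} r. kernel_weight (p ^ j * m) * tilt (Set.insert p P) l (p ^ j * m)) =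
          (real p powr l / (real p + 1)) * A' r" if "j \<ge> 1" for j r
    proof -
      have "(\<Sum>m\<in>coprime_upto {p} r. kernel_weight (p ^ j * m) * tilt (Set.insert p P) l (p ^ j * m)) =
            (\<Sum>m\<in>coprime_upto {p} r. kernel_weight (p ^ j * m) * (real p powr l * tilt P l m))"
      proof (intro sum.cong refl)
        fix m assume m: "m \<in> coprime_upto {p} r"
        hence "prime_factors (p ^ j * m) = Set.insert p (prime_factors m)"
          using p that by (intro prime_factors_power_mult) (auto simp: coprime_upto_def)
        moreover have "Set.insert p P \<inter> Set.insert p (prime_factors m) = Set.insert p (P \<inter> prime_factors m)" by auto
        ultimately show "kernel_weight (p ^ j * m) * tilt (Set.insert p P) l (p ^ j * m) = kernel_weight (p ^ j * m) * (real p powr l * tilt P l m)"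
          using insert.hyps by (simp add: tilt_def)
      qed
      also have "\<dots> = 1 / (real p + 1) * (\<Sum>m\<in>coprime_upto {p} r. kernel_weight m * (real p powr l * tilt P l m))"
        by (rule sum_kernel_weight_power_mult[OF p(1) that]) simp
      also have "\<dots> = (real p powr l / (real p + 1)) * A' r"
        by (simp add: A'_def sum_distrib_left mult_ac)
      finally show ?thesis .
    qed
    moreover have "(\<Sum>m\<in>coprime_upto {p} s. kernel_weight m * tilt (Set.insert p P) l m) = A' s"
      unfolding A'_def
    proof (intro sum.cong refl)
      fix m assume "m \<in> coprime_upto {p} s"
      hence "p \<notin> prime_factors m" by (auto simp: coprime_upto_def)
      thus "kernel_weight m * tilt (Set.insert p P) l m = kernel_weight m * tilt P l m" by (simp add: tilt_def)
    qed
    ultimately show ?thesis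
      by (subst sum_coprime_upto_split'[OF p _ J]) (auto simp: sum_distrib_left)
  qed
  define a where "a = l * ln (real p)"
  have a: "a > 0" using lpos lp by (simp add: a_def)
  have pe: "real p powr l = exp a" using p prime_gt_0_nat[of p] by (simp add: powr_def a_def)
  have ea: "exp a > 1" using a by simp
  have "(\<Sum>n\<in>coprime_upto {} s. kernel_weight n * tilt (Set.insert p P) l n) =
        A s + ((exp a - 1) / (real p + 1)) * (\<Sum>j=1..J. A' (s - real j * ln (real p)))"
    unfolding 1 2 pe by (simp add: diff_divide_distrib left_diff_distrib)
  also have "\<dots> \<le> B * exp (- (l * (t - s))) + ((exp a - 1) / (real p + 1)) * (B * exp (- (l * (t - s))) * (1 / (exp a - 1)))"
  proof (intro add_mono IH mult_left_mono)
    show "s \<le> t" using insert by auto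
    have "(\<Sum>j=1..J. A' (s - real j * ln (real p))) \<le> (\<Sum>j=1..J. B * exp (- (l * (t - s))) * exp (- (a * real j)))"
    proof (rule sum_mono)
      fix j
      have "A' (s - real j * ln (real p)) \<le> A (s - real j * ln (real p))" by (rule A'A)
      also have "\<dots> \<le> B * exp (- (l * (t - (s - real j * ln (real p)))))"
        using \<open>s \<le> t\<close> lp by (intro IH) (auto intro: order_trans[of _ s])
      also have "\<dots> = B * exp (- (l * (t - s))) * exp (- (a * real j))"
        unfolding mult.assoc exp_add[symmetric] by (simp add: a_def algebra_simps)
      finally show "A' (s - real j * ln (real p)) \<le> B * exp (- (l * (t - s))) * exp (- (a * real j))" .
    qed
    also have "\<dots> = B * exp (- (l * (t - s))) * (\<Sum>j=1..J. exp (- (a * real j)))" by (simp add: sum_distrib_left)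
    also have "\<dots> \<le> B * exp (- (l * (t - s))) * (1 / (exp a - 1))"
      using B0 by (intro mult_left_mono sum_exp_multiples_less a) auto
    finally show "(\<Sum>j=1..J. A' (s - real j * ln (real p))) \<le> B * exp (- (l * (t - s))) * (1 / (exp a - 1))" .
  qed (use ea in auto)
  also have "((exp a - 1) / (real p + 1)) * (B * exp (- (l * (t - s))) * (1 / (exp a - 1))) = B * exp (- (l * (t - s))) * (1 / (real p + 1))"
    using ea by simp
  also have "B * exp (- (l * (t - s))) + \<dots> = B * exp (- (l * (t - s))) * (1 + 1 / (real p + 1))" by (simp add: distrib_left)
  also have "\<dots> = 2 * weight_sum {} t * exp (- (l * (t - s))) * (\<Prod>p\<in>Set.insert p P. 1 + 1 / (real p + 1))"
    unfolding B_def using insert.hyps by (simp add: mult_ac)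
  finally show ?case .
qed

lemma prod_primes_le:
  "\<exists>C>0. \<forall>t\<ge>2. (\<Prod>p\<in>primes_upto (exp t). 1 + 1 / real p) \<le> t powr C"
proof -
  obtain C where C: "C > 0" "\<And>t. t \<ge> 2 \<Longrightarrow> (\<Sum>p\<in>primes_upto (exp t). 1 / real p) \<le> C * ln t"
    using sum_recip_prime_le by blast
  have "(\<Prod>p\<in>primes_upto (exp t). 1 + 1 / real p) \<le> t powr C" if t: "t \<ge> 2" for t
  proof -
    have "(\<Prod>p\<in>primes_upto (exp t). 1 + 1 / real p) \<le> (\<Prod>p\<in>primes_upto (exp t). exp (1 / real p))"
      by (intro prod_mono conjI exp_ge_add_one_self) auto
    also have "\<dots> = exp (\<Sum>p\<in>primes_upto (exp t). 1 / real p)" by (simp add: exp_sum)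
    also have "\<dots> \<le> exp (C * ln t)" using C(2)[OF t] by simp
    also have "\<dots> = t powr C" using t by (simp add: powr_def)
    finally show ?thesis .
  qed
  thus ?thesis using C by blast
qed

section \<open>Fejer approximation of the periodized tent\<close>

lemma sin_ge_half:
  assumes "0 \<le> x" "x \<le> pi / 2"
  shows "sin x \<ge> x / 2"
proof (cases "x \<le> pi / 3")
  case True
  show ?thesis
  proof (cases "x = 0")
    case False
    hence x: "0 < x" using assms by simp
    obtain z where z: "z > 0" "z < x" "sin x - sin 0 = (x - 0) * cos z"
      using MVT2[OF x, of sin cos] by (auto intro: DERIV_sin)
    have "cos z \<ge> cos (pi / 3)" using z True by (intro cos_monotone_0_pi_le) auto
    hence "cos z \<ge> 1/2" by (simp add: cos_60)
    hence "x * cos z \<ge> x * (1/2)" using x by (intro mult_left_mono) auto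
    thus ?thesis using z by simp
  qed simp
next
  case False
  have "sin x \<ge> sin (pi / 3)" using False assms by (intro sin_monotone_2pi_le) auto
  moreover have "sqrt 3 / 2 \<ge> (4/5 :: real)" using real_le_rsqrt[of "8/5" 3] by (simp add: power2_eq_square)
  moreover have "x / 2 \<le> 4/5" using assms pi_less_4 pi_approx by simp
  ultimately show ?thesis by (simp add: sin_60)
qed

lemma one_minus_cos_ge:
  assumes "\<bar>x\<bar> \<le> pi"
  shows "1 - cos x \<ge> x^2 / 8"
proof -
  have "sin (\<bar>x\<bar> / 2) \<ge> \<bar>x\<bar> / 2 / 2" using assms by (intro sin_ge_half) auto
  hence "(\<bar>x\<bar> / 4)^2 \<le> sin (\<bar>x\<bar> / 2) ^ 2" by (intro power_mono) auto
  moreover have "cos x = 1 - 2 * sin (\<bar>x\<bar> / 2) ^ 2"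
    using cos_double_sin[of "\<bar>x\<bar> / 2"] by simp
  ultimately show ?thesis by (simp add: power_divide)
qed

lemma norm_cis_diff_sq: "(norm (cis a - cis b))^2 = 2 - 2 * cos (a - b)"
proof -
  have "(norm (cis a - cis b))^2 = (cos a - cos b)^2 + (sin a - sin b)^2"
    by (simp add: cmod_power2)
  also have "\<dots> = (cos a ^ 2 + sin a ^ 2) + (cos b ^ 2 + sin b ^ 2) - 2 * (cos a * cos b + sin a * sin b)"
    by (simp add: power2_eq_square algebra_simps)
  finally show ?thesis by (simp add: cos_diff)
qed

lemma norm_cis_diff_ge:
  assumes "\<bar>a - b\<bar> \<le> pi"
  shows "norm (cis a - cis b) \<ge> \<bar>a - b\<bar> / 2"
proof -
  have "(\<bar>a - b\<bar> / 2)^2 \<le> (norm (cis a - cis b))^2"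
    unfolding norm_cis_diff_sq using one_minus_cos_ge[OF assms] by (simp add: power_divide)
  thus ?thesis by (rule power2_le_imp_le) auto
qed

text \<open>The tent summed over all points r + j ln 2 with j an integer, for r in one period: the
  falling branch is a geometric series of ratio 2^(-b), the rising one is exp r * (1/2 + 1/4 +
  ...).\<close>

definition periodic_profile :: "real \<Rightarrow> real \<Rightarrow> real" where
  "periodic_profile b r = exp (- (b * r)) / (1 - 2 powr (-b)) + exp r"

definition periodized_tent :: "real \<Rightarrow> real \<Rightarrow> real" where
  "periodized_tent b s = periodic_profile b (s - ln 2 * of_int \<lfloor>s / ln 2\<rfloor>)"

lemma two_powr_minus_less_1: "b > 0 \<Longrightarrow> 2 powr (-b) < (1::real)"
  using powr_less_mono[of "-b" 0 2] by simp

text \<open>The periodic extension has no jump at the seam, which a Lipschitz bound on the circle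
  needs.\<close>

lemma periodic_profile_ends: "b > 0 \<Longrightarrow> periodic_profile b (ln 2) = periodic_profile b 0"
proof -
  assume "b > 0"
  hence "1 - 2 powr (-b) > (0::real)" using two_powr_minus_less_1[of b] by simp
  moreover have "exp (- (b * ln 2)) = (2::real) powr (-b)" by (simp add: powr_def)
  moreover from calculation(1) have "1 / (1 - 2 powr (-b)) - 2 powr (-b) / (1 - 2 powr (-b)) = (1::real)"
    using \<open>b > 0\<close> by (simp add: diff_divide_distrib[symmetric])
  ultimately show ?thesis by (simp add: periodic_profile_def)
qed

lemma periodic_profile_lipschitz:
  assumes b: "b > 0"
  shows "\<exists>L>0. \<forall>x\<in>{0..ln 2}. \<forall>y\<in>{0..ln 2}. \<bar>periodic_profile b x - periodic_profile b y\<bar> \<le> L * \<bar>x - y\<bar>"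
proof -
  define L where "L = b / (1 - 2 powr (-b)) + 2"
  have q: "1 - 2 powr (-b) > (0::real)" using two_powr_minus_less_1[OF b] by simp
  have L: "L > 0" unfolding L_def using b q by (intro add_pos_pos divide_pos_pos) auto
  have 1: "\<bar>periodic_profile b x - periodic_profile b y\<bar> \<le> L * (y - x)" if xy: "0 \<le> x" "x \<le> y" "y \<le> ln 2" for x y
  proof -
    have e: "0 \<le> 1 - exp (-c)" "1 - exp (-c) \<le> c" if "c \<ge> 0" for c :: real
      using that exp_ge_add_one_self[of "-c"] by auto
    have "exp (- (b * x)) - exp (- (b * y)) = exp (- (b * x)) * (1 - exp (- (b * (y - x))))"
      by (simp add: algebra_simps exp_add[symmetric])
    also have "\<bar>\<dots>\<bar> \<le> 1 * (b * (y - x))"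
      unfolding abs_mult using b xy e[of "b * (y - x)"] by (intro mult_mono) auto
    finally have A: "\<bar>exp (- (b * x)) - exp (- (b * y))\<bar> \<le> b * (y - x)" by simp
    have "exp y - exp x = exp y * (1 - exp (- (y - x)))"
      by (simp add: algebra_simps exp_add[symmetric])
    also have "\<bar>\<dots>\<bar> \<le> 2 * (y - x)"
    proof -
      have "exp y \<le> exp (ln 2)" using xy by (simp del: exp_ln)
      thus ?thesis unfolding abs_mult using xy e[of "y - x"] by (intro mult_mono) auto
    qed
    finally have B: "\<bar>exp y - exp x\<bar> \<le> 2 * (y - x)" .
    have "\<bar>periodic_profile b x - periodic_profile b y\<bar> =
        \<bar>(exp (- (b * x)) - exp (- (b * y))) / (1 - 2 powr (-b)) - (exp y - exp x)\<bar>"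
      by (simp add: periodic_profile_def diff_divide_distrib)
    also have "\<dots> \<le> \<bar>(exp (- (b * x)) - exp (- (b * y))) / (1 - 2 powr (-b))\<bar> + \<bar>exp y - exp x\<bar>" by linarith
    also have "\<dots> \<le> b * (y - x) / (1 - 2 powr (-b)) + 2 * (y - x)"
      using A B q by (intro add_mono) (auto simp: abs_divide divide_right_mono)
    finally show ?thesis by (simp add: L_def algebra_simps)
  qed
  have "\<bar>periodic_profile b x - periodic_profile b y\<bar> \<le> L * \<bar>x - y\<bar>" if "x \<in> {0..ln 2}" "y \<in> {0..ln 2}" for x y
  proof (cases "x \<le> y")
    case True
    thus ?thesis using 1[of x y] that by simp
  next
    case False
    thus ?thesis using 1[of y x] that by (simp add: abs_minus_commute)
  qed
  thus ?thesis using L by blast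
qed

text \<open>Distances are chords of the circle because these are what \<open>fejer_chord_le\<close>
  controls. Points more than half a period apart are joined across the seam, where the two ends
  agree.\<close>

lemma periodic_profile_chord_lipschitz:
  assumes b: "b > 0"
  shows "\<exists>L>0. \<forall>x\<in>{0..1}. \<forall>y\<in>{0..1}.
    \<bar>periodic_profile b (ln 2 * x) - periodic_profile b (ln 2 * y)\<bar> \<le> L * norm (cis (2 * pi * x) - cis (2 * pi * y))"
proof -
  obtain L where L: "L > 0" "\<And>x y. x \<in> {0..ln 2} \<Longrightarrow> y \<in> {0..ln 2} \<Longrightarrow> \<bar>periodic_profile b x - periodic_profile b y\<bar> \<le> L * \<bar>x - y\<bar>"
    using periodic_profile_lipschitz[OF b] by blast
  have l2: "0 < ln (2::real)" "ln (2::real) \<le> 1" using ln_le_minus_one[of "2::real"] by auto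
  have in01: "ln 2 * x \<in> {0..ln 2}" if "x \<in> {0..1}" for x :: real using that l2 by simp
  let ?p = "\<lambda>x. periodic_profile b (ln 2 * x)"
  have lip: "\<bar>?p x - ?p y\<bar> \<le> L * \<bar>x - y\<bar>" if "x \<in> {0..1}" "y \<in> {0..1}" for x y
  proof -
    have "\<bar>?p x - ?p y\<bar> \<le> L * \<bar>ln 2 * x - ln 2 * y\<bar>" using in01 that by (intro L(2)) auto
    also have "\<bar>ln 2 * x - ln 2 * y\<bar> = ln 2 * \<bar>x - y\<bar>" using l2 by (simp add: right_diff_distrib[symmetric] abs_mult)
    also have "L * (ln 2 * \<bar>x - y\<bar>) \<le> L * (1 * \<bar>x - y\<bar>)" using L l2 by (intro mult_left_mono mult_right_mono) auto
    finally show ?thesis by simp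
  qed
  have ends: "?p 1 = ?p 0" using periodic_profile_ends[OF b] by simp
  have main: "\<bar>?p x - ?p y\<bar> \<le> L * norm (cis (2 * pi * x) - cis (2 * pi * y))" if xy: "0 \<le> x" "x \<le> y" "y \<le> 1" for x y
  proof (cases "y - x \<le> 1/2")
    case True
    have a: "\<bar>2 * pi * x - 2 * pi * y\<bar> = 2 * pi * (y - x)" using xy by (simp add: right_diff_distrib[symmetric] abs_mult)
    have "2 * pi * (y - x) \<le> 2 * pi * (1/2)" using True by (intro mult_left_mono) auto
    hence "norm (cis (2 * pi * x) - cis (2 * pi * y)) \<ge> \<bar>2 * pi * x - 2 * pi * y\<bar> / 2"
      by (intro norm_cis_diff_ge) (simp add: a)
    moreover have "1 * (y - x) \<le> pi * (y - x)" using xy pi_gt3 by (intro mult_right_mono) auto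
    ultimately have "y - x \<le> norm (cis (2 * pi * x) - cis (2 * pi * y))" unfolding a by simp
    hence "L * (y - x) \<le> L * norm (cis (2 * pi * x) - cis (2 * pi * y))" using L by (intro mult_left_mono) auto
    thus ?thesis using lip[of x y] xy by simp
  next
    case False
    let ?e = "1 - y + x"
    have "cis (2 * pi * x) = cis (2 * pi * (x + 1))"
      by (simp add: complex_eq_iff distrib_left)
    moreover have a: "\<bar>2 * pi * (x + 1) - 2 * pi * y\<bar> = 2 * pi * ?e"
    proof -
      have "2 * pi * (x + 1) - 2 * pi * y = 2 * pi * ?e" by (simp add: algebra_simps)
      thus ?thesis using xy by (simp add: abs_mult)
    qed
    have "2 * pi * ?e \<le> 2 * pi * (1/2)" using False by (intro mult_left_mono) auto
    hence "norm (cis (2 * pi * (x + 1)) - cis (2 * pi * y)) \<ge> \<bar>2 * pi * (x + 1) - 2 * pi * y\<bar> / 2"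
      by (intro norm_cis_diff_ge) (simp add: a)
    moreover have "1 * ?e \<le> pi * ?e" using xy pi_gt3 by (intro mult_right_mono) auto
    ultimately have "?e \<le> norm (cis (2 * pi * x) - cis (2 * pi * y))" unfolding a by simp
    hence "L * ?e \<le> L * norm (cis (2 * pi * x) - cis (2 * pi * y))" using L by (intro mult_left_mono) auto
    moreover have "\<bar>?p x - ?p y\<bar> \<le> \<bar>?p x - ?p 0\<bar> + \<bar>?p 1 - ?p y\<bar>" using ends by linarith
    moreover have "\<bar>?p x - ?p 0\<bar> \<le> L * x" "\<bar>?p 1 - ?p y\<bar> \<le> L * (1 - y)"
      using lip[of x 0] lip[of 1 y] xy by auto
    moreover have "L * x + L * (1 - y) = L * ?e" by (simp add: algebra_simps)
    ultimately show ?thesis by linarith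
  qed
  have "\<bar>?p x - ?p y\<bar> \<le> L * norm (cis (2 * pi * x) - cis (2 * pi * y))" if "x \<in> {0..1}" "y \<in> {0..1}" for x y
  proof (cases "x \<le> y")
    case True
    thus ?thesis using main[of x y] that by simp
  next
    case False
    thus ?thesis using main[of y x] that by (simp add: abs_minus_commute norm_minus_commute)
  qed
  thus ?thesis using L by blast
qed

section \<open>The discrete Fejer mean\<close>

definition fejer :: "nat \<Rightarrow> real \<Rightarrow> real" where
  "fejer N \<theta> = (norm (\<Sum>l<N. cis (real l * \<theta>)))^2"

lemma fejer_eq: "complex_of_real (fejer N \<theta>) = (\<Sum>l<N. \<Sum>l'<N. cis ((real l - real l') * \<theta>))"
proof -
  have "complex_of_real (fejer N \<theta>) = (\<Sum>l<N. cis (real l * \<theta>)) * cnj (\<Sum>l<N. cis (real l * \<theta>))"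
    unfolding fejer_def by (rule complex_norm_square)
  also have "cnj (\<Sum>l<N. cis (real l * \<theta>)) = (\<Sum>l<N. cis (- (real l * \<theta>)))"
    by (simp add: cis_cnj)
  finally show ?thesis unfolding sum_product by (simp add: cis_mult algebra_simps)
qed

lemma sum_cis_multiples: "(\<Sum>l<N. cis (real l * \<theta>)) = (\<Sum>l<N. cis \<theta> ^ l)"
  by (intro sum.cong refl) (simp add: Complex.DeMoivre)

lemma fejer_chord_le: "fejer N \<theta> * (norm (cis \<theta> - 1))^2 \<le> 4"
proof -
  have "(cis \<theta> - 1) * (\<Sum>l<N. cis (real l * \<theta>)) = cis \<theta> ^ N - 1"
    using power_diff_1_eq[of "cis \<theta>" N] by (simp add: sum_cis_multiples)
  hence "norm (cis \<theta> - 1) * norm (\<Sum>l<N. cis (real l * \<theta>)) = norm (cis \<theta> ^ N - 1)"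
    by (metis norm_mult)
  also have "\<dots> \<le> norm (cis \<theta> ^ N) + norm (1::complex)" by (rule norm_triangle_ineq4)
  also have "\<dots> = 2" by (simp add: norm_power)
  finally have "(norm (cis \<theta> - 1) * norm (\<Sum>l<N. cis (real l * \<theta>)))^2 \<le> 2^2" by (intro power_mono) auto
  thus ?thesis by (simp add: fejer_def power_mult_distrib mult.commute)
qed

lemma cis_neq_1: "0 < \<bar>x\<bar> \<Longrightarrow> \<bar>x\<bar> \<le> pi \<Longrightarrow> cis x \<noteq> 1"
proof
  assume "0 < \<bar>x\<bar>" "\<bar>x\<bar> \<le> pi" "cis x = 1"
  hence "cos x = 1" by (metis cis.simps(1) one_complex.simps(1))
  thus False using one_minus_cos_ge[of x] \<open>0 < \<bar>x\<bar>\<close> \<open>\<bar>x\<bar> \<le> pi\<close> by auto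
qed

lemma cis_int_2pi: "cis (2 * pi * of_int k) = 1"
  by simp

text \<open>With 2 N nodes a frequency |k| < N turns by an angle of at most \<pi> per node, so a
  nonzero one never makes a full turn; the same limit on the angle is used for the coefficient
  bound.\<close>

lemma sum_roots_unity:
  fixes k :: int
  assumes "N \<ge> 1" "\<bar>k\<bar> < int N"
  shows "(\<Sum>j<2*N. cis (of_int k * (pi * real j / real N))) = (if k = 0 then 2 * of_nat N else 0)"
proof (cases "k = 0")
  case False
  let ?x = "of_int k * pi / real N"
  have "\<bar>real_of_int k\<bar> < real N" using assms by linarith
  hence x: "0 < \<bar>?x\<bar>" "\<bar>?x\<bar> \<le> pi" using False assms by (auto simp: abs_mult field_simps)
  have "(\<Sum>j<2*N. cis (of_int k * (pi * real j / real N))) = (\<Sum>j<2*N. cis ?x ^ j)"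
    unfolding sum_cis_multiples[symmetric] by (simp add: mult_ac)
  also have "\<dots> = (cis ?x ^ (2*N) - 1) / (cis ?x - 1)"
    by (rule geometric_sum) (rule cis_neq_1[OF x])
  also have "cis ?x ^ (2*N) = cis (2 * pi * of_int k)" using assms by (simp add: Complex.DeMoivre field_simps)
  finally show ?thesis using False by (simp add: cis_int_2pi)
qed simp

lemma sum_swap3: "(\<Sum>a\<in>A. \<Sum>b\<in>B. \<Sum>c\<in>C. f a b c) = (\<Sum>b\<in>B. \<Sum>c\<in>C. \<Sum>a\<in>A. f a b c)"
proof -
  have "(\<Sum>a\<in>A. \<Sum>b\<in>B. \<Sum>c\<in>C. f a b c) = (\<Sum>b\<in>B. \<Sum>a\<in>A. \<Sum>c\<in>C. f a b c)" by (rule sum.swap)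
  also have "\<dots> = (\<Sum>b\<in>B. \<Sum>c\<in>C. \<Sum>a\<in>A. f a b c)" by (intro sum.cong refl sum.swap)
  finally show ?thesis .
qed

text \<open>Only the N diagonal pairs of the double sum survive the average over nodes. Since
  \<open>fejer\<close> is N times the usual Fejer kernel, the total is 2 N * N, the normalization in
  \<open>fejer_approx\<close>.\<close>

lemma fejer_mean:
  assumes N: "N \<ge> 1"
  shows "(\<Sum>j<2*N. fejer N (\<alpha> - pi * real j / real N)) = 2 * real N * real N"
proof -
  have "complex_of_real (\<Sum>j<2*N. fejer N (\<alpha> - pi * real j / real N)) =
        (\<Sum>j<2*N. \<Sum>l<N. \<Sum>l'<N. cis ((real l - real l') * (\<alpha> - pi * real j / real N)))"
    by (simp add: fejer_eq)
  also have "\<dots> = (\<Sum>l<N. \<Sum>l'<N. \<Sum>j<2*N. cis ((real l - real l') * (\<alpha> - pi * real j / real N)))"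
    by (rule sum_swap3)
  also have "\<dots> = (\<Sum>l<N. \<Sum>l'<N. if l' = l then 2 * of_nat N else 0)"
  proof (intro sum.cong refl)
    fix l l' assume l: "l \<in> {..<N}" "l' \<in> {..<N}"
    have "(\<Sum>j<2*N. cis ((real l - real l') * (\<alpha> - pi * real j / real N))) =
          cis ((real l - real l') * \<alpha>) * (\<Sum>j<2*N. cis (of_int (int l' - int l) * (pi * real j / real N)))"
      unfolding sum_distrib_left cis_mult
      by (intro sum.cong refl arg_cong[of _ _ cis]) (simp add: algebra_simps diff_divide_distrib)
    also have "\<dots> = (if l' = l then 2 * of_nat N else 0)"
      using l by (subst sum_roots_unity[OF N]) auto
    finally show "(\<Sum>j<2*N. cis ((real l - real l') * (\<alpha> - pi * real j / real N))) = (if l' = l then 2 * of_nat N else 0)" .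
  qed
  also have "\<dots> = complex_of_real (2 * real N * real N)" by simp
  finally show ?thesis using of_real_eq_iff by blast
qed

definition fejer_node :: "real \<Rightarrow> nat \<Rightarrow> nat \<Rightarrow> real" where
  "fejer_node b N j = periodic_profile b (ln 2 * (real j / (2 * real N)))"

text \<open>Convolution of the profile with the Fejer kernel as a finite sum over 2 N nodes of one
  period: a trigonometric polynomial of degree below N, obtained without integrals.\<close>

definition fejer_approx :: "real \<Rightarrow> nat \<Rightarrow> real \<Rightarrow> real" where
  "fejer_approx b N s = (\<Sum>j<2*N. fejer_node b N j * fejer N (2 * pi * s / ln 2 - pi * real j / real N)) / (2 * real N * real N)"

text \<open>At a node at chord distance c the profile is off by at most L c, and c \<le> d / 2 + c^2
  / (2 d). The first part is averaged by \<open>fejer_mean\<close>, the second by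
  \<open>fejer_chord_le\<close>. The rate 1 / \<surd>N suffices, because N will be at least
  t^2.\<close>

lemma periodized_tent_approx:
  assumes b: "b > 0"
  shows "\<exists>C>0. \<forall>N\<ge>1. \<forall>s. \<bar>periodized_tent b s - fejer_approx b N s\<bar> \<le> C / sqrt (real N)"
proof -
  obtain L where L: "L > 0" "\<And>x y. x \<in> {0..1} \<Longrightarrow> y \<in> {0..1} \<Longrightarrow>
    \<bar>periodic_profile b (ln 2 * x) - periodic_profile b (ln 2 * y)\<bar> \<le> L * norm (cis (2 * pi * x) - cis (2 * pi * y))"
    using periodic_profile_chord_lipschitz[OF b] by blast
  have "\<bar>periodized_tent b s - fejer_approx b N s\<bar> \<le> 2 * L / sqrt (real N)" if N: "N \<ge> 1" for N s
  proof -
    define x where "x = s / ln 2 - of_int \<lfloor>s / ln 2\<rfloor>"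
    have x: "x \<in> {0..1}" unfolding x_def using of_int_floor_le[of "s / ln 2"] real_of_int_floor_add_one_ge[of "s / ln 2"]
      by (auto simp: algebra_simps)
    have G: "periodized_tent b s = periodic_profile b (ln 2 * x)"
      by (simp add: periodized_tent_def x_def algebra_simps)
    let ?\<theta> = "\<lambda>j. 2 * pi * s / ln 2 - pi * real j / real N"
    \<comment> \<open>This choice balances the two resulting errors d / 2 and 2 / (d N).\<close>
    define d where "d = 2 / sqrt (real N)"
    have d: "d > 0" using N by (simp add: d_def)
    have N0: "real N > 0" using N by simp
    have cisx: "norm (cis (2 * pi * x) - cis (2 * pi * (real j / (2 * real N)))) = norm (cis (?\<theta> j) - 1)" for j
    proof -
      have "2 * pi * s / ln 2 = 2 * pi * x + 2 * pi * of_int \<lfloor>s / ln 2\<rfloor>" by (simp add: x_def algebra_simps)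
      hence "cis (?\<theta> j) = cis (2 * pi * x) * cis (2 * pi * of_int \<lfloor>s / ln 2\<rfloor>) * cis (- (pi * real j / real N))"
        unfolding cis_mult by simp
      also have "\<dots> = cis (2 * pi * x) * cis (- (pi * real j / real N))" by (simp only: cis_int_2pi mult_1_right)
      finally have "cis (?\<theta> j) - 1 = (cis (2 * pi * x) - cis (pi * real j / real N)) * cis (- (pi * real j / real N))"
        by (simp add: left_diff_distrib cis_mult)
      hence "norm (cis (?\<theta> j) - 1) = norm (cis (2 * pi * x) - cis (pi * real j / real N))" by (simp add: norm_mult)
      thus ?thesis by simp
    qed
    have "2 * real N * real N * (periodized_tent b s - fejer_approx b N s) =
          (\<Sum>j<2*N. (periodic_profile b (ln 2 * x) - fejer_node b N j) * fejer N (?\<theta> j))"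
    proof -
      have "2 * real N * real N * periodized_tent b s = (\<Sum>j<2*N. periodic_profile b (ln 2 * x) * fejer N (?\<theta> j))"
        unfolding sum_distrib_left[symmetric] fejer_mean[OF N] G by simp
      moreover have "2 * real N * real N * fejer_approx b N s = (\<Sum>j<2*N. fejer_node b N j * fejer N (?\<theta> j))"
        unfolding fejer_approx_def using N by simp
      ultimately show ?thesis by (simp add: right_diff_distrib left_diff_distrib sum_subtractf)
    qed
    moreover have "2 * real N * real N * \<bar>y\<bar> = \<bar>2 * real N * real N * y\<bar>" for y by (simp add: abs_mult)
    ultimately have "2 * real N * real N * \<bar>periodized_tent b s - fejer_approx b N s\<bar> =
          \<bar>\<Sum>j<2*N. (periodic_profile b (ln 2 * x) - fejer_node b N j) * fejer N (?\<theta> j)\<bar>"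
      by (simp only:)
    also have "\<dots> \<le> (\<Sum>j<2*N. \<bar>(periodic_profile b (ln 2 * x) - fejer_node b N j) * fejer N (?\<theta> j)\<bar>)" by (rule sum_abs)
    also have "\<dots> \<le> (\<Sum>j<2*N. L * (d / 2 * fejer N (?\<theta> j) + 2 / d))"
    proof (rule sum_mono)
      fix j assume j: "j \<in> {..<2*N}"
      let ?c = "norm (cis (?\<theta> j) - 1)"
      have "real j / (2 * real N) \<in> {0..1}" using j N0 by (auto simp: field_simps)
      hence "\<bar>periodic_profile b (ln 2 * x) - fejer_node b N j\<bar> \<le> L * ?c"
        unfolding fejer_node_def cisx[of j, symmetric] by (intro L(2) x)
      hence "\<bar>(periodic_profile b (ln 2 * x) - fejer_node b N j) * fejer N (?\<theta> j)\<bar> \<le> L * ?c * fejer N (?\<theta> j)"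
        unfolding abs_mult by (intro mult_mono) (auto simp: fejer_def)
      also have "L * ?c * fejer N (?\<theta> j) \<le> L * ((d / 2 + ?c^2 / (2 * d)) * fejer N (?\<theta> j))"
      proof -
        have "0 \<le> (d - ?c)^2" by simp
        hence "?c * (2 * d) \<le> d^2 + ?c^2" by (simp add: power2_diff mult_ac)
        hence "?c \<le> (d^2 + ?c^2) / (2 * d)" using d by (simp add: pos_le_divide_eq)
        also have "\<dots> = d / 2 + ?c^2 / (2 * d)" using d by (simp add: add_divide_distrib power2_eq_square)
        finally show ?thesis unfolding mult.assoc using L by (intro mult_left_mono mult_right_mono) (auto simp: fejer_def)
      qed
      also have "\<dots> \<le> L * (d / 2 * fejer N (?\<theta> j) + 2 / d)"
      proof -
        have "fejer N (?\<theta> j) * ?c^2 / (2 * d) \<le> 4 / (2 * d)" using fejer_chord_le d by (intro divide_right_mono) auto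
        moreover have "(d / 2 + e / (2 * d)) * F = d / 2 * F + F * e / (2 * d)" for e F by (simp add: algebra_simps)
        moreover have "4 / (2 * d) = 2 / d" by simp
        ultimately have "(d / 2 + ?c^2 / (2 * d)) * fejer N (?\<theta> j) \<le> d / 2 * fejer N (?\<theta> j) + 2 / d" by (simp only:)
        thus ?thesis using L(1) by (intro mult_left_mono) auto
      qed
      finally show "\<bar>(periodic_profile b (ln 2 * x) - fejer_node b N j) * fejer N (?\<theta> j)\<bar> \<le> L * (d / 2 * fejer N (?\<theta> j) + 2 / d)" .
    qed
    also have "\<dots> = L * (d / 2 * (\<Sum>j<2*N. fejer N (?\<theta> j)) + 2 * real N * (2 / d))"
      unfolding sum_distrib_left[symmetric] sum.distrib by simp
    also have "\<dots> = L * (d * real N * real N + 4 * real N / d)" unfolding fejer_mean[OF N] by simp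
    also have "\<dots> = 2 * real N * real N * (L * (d / 2 + 2 / (d * real N)))" using d N0 by (simp add: field_simps)
    finally have "\<bar>periodized_tent b s - fejer_approx b N s\<bar> \<le> L * (d / 2 + 2 / (d * real N))"
      using N0 by (subst (asm) mult_le_cancel_left_pos) auto
    also have "d * real N = 2 * sqrt (real N)" using real_div_sqrt[of "real N"] by (simp add: d_def)
    finally show ?thesis by (simp add: d_def mult.commute)
  qed
  thus ?thesis using L(1) by (intro exI[of _ "2 * L"]) auto
qed

text \<open>The k-th Fourier coefficient of the profile, computed from its samples.\<close>

definition fejer_coeff :: "real \<Rightarrow> nat \<Rightarrow> int \<Rightarrow> complex" where
  "fejer_coeff b N k = (\<Sum>j<2*N. of_real (fejer_node b N j) * cis (- (of_int k * (pi * real j / real N)))) / (2 * of_nat N)"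

text \<open>The triangular Fejer factors 1 - |k| / N stay implicit, as the number of pairs with l -
  l' = k divided by N.\<close>

lemma fejer_approx_eq:
  "complex_of_real (fejer_approx b N s) =
   (\<Sum>l<N. \<Sum>l'<N. fejer_coeff b N (int l - int l') * cis ((real l - real l') * (2 * pi * s / ln 2))) / of_nat N"
proof -
  have "complex_of_real (\<Sum>j<2*N. fejer_node b N j * fejer N (2 * pi * s / ln 2 - pi * real j / real N)) =
     (\<Sum>j<2*N. \<Sum>l<N. \<Sum>l'<N. of_real (fejer_node b N j) * cis ((real l - real l') * (2 * pi * s / ln 2 - pi * real j / real N)))"
    by (simp add: fejer_eq sum_distrib_left)
  also have "\<dots> = (\<Sum>l<N. \<Sum>l'<N. \<Sum>j<2*N. of_real (fejer_node b N j) * cis ((real l - real l') * (2 * pi * s / ln 2 - pi * real j / real N)))"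
    by (rule sum_swap3)
  also have "\<dots> = (\<Sum>l<N. \<Sum>l'<N. (2 * of_nat N) * (fejer_coeff b N (int l - int l') * cis ((real l - real l') * (2 * pi * s / ln 2))))"
  proof (intro sum.cong refl)
    fix l l' assume "l \<in> {..<N}"
    hence N: "N > 0" by auto
    have "(\<Sum>j<2*N. of_real (fejer_node b N j) * cis ((real l - real l') * (2 * pi * s / ln 2 - pi * real j / real N))) =
       (\<Sum>j<2*N. of_real (fejer_node b N j) * cis (- (of_int (int l - int l') * (pi * real j / real N)))) * cis ((real l - real l') * (2 * pi * s / ln 2))"
      unfolding sum_distrib_right mult.assoc cis_mult by (intro sum.cong refl) (simp add: algebra_simps)
    thus "(\<Sum>j<2*N. of_real (fejer_node b N j) * cis ((real l - real l') * (2 * pi * s / ln 2 - pi * real j / real N))) =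
       (2 * of_nat N) * (fejer_coeff b N (int l - int l') * cis ((real l - real l') * (2 * pi * s / ln 2)))"
      using N by (simp add: fejer_coeff_def)
  qed
  finally show ?thesis
    unfolding fejer_approx_def of_real_divide by (simp add: sum_distrib_left[symmetric])
qed

text \<open>The square equals (q - 1)^2 + 2 q (1 - cos x), whose first term is dropped.\<close>

lemma norm_scaled_cis_minus_1_ge:
  assumes q: "q > 0" and x: "\<bar>x\<bar> \<le> pi"
  shows "(norm (of_real q * cis x - 1))^2 \<ge> q * x^2 / 4"
proof -
  have "(norm (of_real q * cis x - 1))^2 = (q * cos x - 1)^2 + (q * sin x)^2"
    by (simp add: cmod_power2)
  also have "\<dots> = q^2 * (cos x ^ 2 + sin x ^ 2) - 2 * q * cos x + 1"
    unfolding power2_diff power_mult_distrib distrib_left by simp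
  also have "\<dots> = (q - 1)^2 + 2 * q * (1 - cos x)" by (simp add: power2_eq_square algebra_simps)
  also have "\<dots> \<ge> 0 + 2 * q * (x^2 / 8)"
    using q one_minus_cos_ge[OF x] by (intro add_mono mult_left_mono) auto
  finally show ?thesis by simp
qed

text \<open>On the nodes both exponentials of the profile are geometric progressions, with ratios
  \<open>?u\<close> and \<open>?v\<close>. Over a period they contribute -1 / (\<open>?u\<close> -
  1) and 1 / (\<open>?v\<close> - 1), whose sum has numerator of modulus |q1 - q2| = O(1 / M) and a
  denominator of order at least (k / M)^2. This cancellation is the discrete form of continuity at
  the seam; it improves 1 / k to 1 / k^2.\<close>

lemma fejer_coeff_bound:
  assumes b: "b > 0"
  shows "\<exists>C>0. \<forall>N\<ge>1. \<forall>k. k \<noteq> 0 \<longrightarrow> \<bar>k\<bar> < int N \<longrightarrow> norm (fejer_coeff b N k) \<le> C / (of_int k)^2"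
proof -
  define C where "C = (b + 2) * exp b"
  have "norm (fejer_coeff b N k) \<le> C / (of_int k)^2" if N: "N \<ge> 1" and k: "k \<noteq> 0" "\<bar>k\<bar> < int N" for N k
  proof -
    have N0: "real N > 0" using N by simp
    have l2: "0 < ln (2::real)" "ln (2::real) \<le> 1" using ln_le_minus_one[of "2::real"] by auto
    define M where "M = 2 * N"
    have M: "real M = 2 * real N" "M > 0" using N by (auto simp: M_def)
    define q1 where "q1 = exp (- (b * ln 2 / real M))"
    define q2 where "q2 = exp (ln 2 / real M)"
    define y where "y = - (of_int k * pi / real N)"
    have kN: "\<bar>real_of_int k\<bar> < real N" using k by linarith
    have y: "0 < \<bar>y\<bar>" "\<bar>y\<bar> \<le> pi" using kN k N0 by (auto simp: y_def abs_mult field_simps)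
    \<comment> \<open>The M nodes make whole turns, so in the geometric sums only the moduli q1^M =
      2^(-b) and q2^M = 2 survive.\<close>
    have yM: "cis y ^ M = 1"
    proof -
      have "real M * y = 2 * pi * of_int (- k)" using N0 by (simp add: y_def M)
      hence "cis y ^ M = cis (2 * pi * of_int (- k))" by (simp only: Complex.DeMoivre)
      thus ?thesis by (simp only: cis_int_2pi)
    qed
    have q1M: "q1 ^ M = 2 powr (-b)" using M by (simp add: q1_def exp_of_nat_mult[symmetric] powr_def)
    have q2M: "q2 ^ M = 2" using M by (simp add: q2_def exp_of_nat_mult[symmetric])
    have qb: "1 - 2 powr (-b) > (0::real)" using two_powr_minus_less_1[OF b] by simp
    let ?u = "of_real q1 * cis y" and ?v = "of_real q2 * cis y"
    have q1_pos: "q1 > 0" "q1 \<ge> exp (-b)"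
    proof -
      have "b * ln 2 / real M \<le> b * 1 / 1" using b l2 M by (intro frac_le mult_left_mono mult_nonneg_nonneg) auto
      thus "q1 \<ge> exp (-b)" by (simp add: q1_def)
    qed (simp add: q1_def)
    have q2_ge: "q2 \<ge> 1" unfolding q2_def using l2 M by simp
    have nu: "(norm (?u - 1))^2 \<ge> exp (-b) * y^2 / 4"
    proof -
      have "exp (-b) * y^2 / 4 \<le> q1 * y^2 / 4" using q1_pos by (intro divide_right_mono mult_right_mono) auto
      also have "\<dots> \<le> (norm (?u - 1))^2" using q1_pos y by (intro norm_scaled_cis_minus_1_ge) auto
      finally show ?thesis .
    qed
    have nv: "(norm (?v - 1))^2 \<ge> exp (-b) * y^2 / 4"
    proof -
      have "exp (-b) \<le> 1" using b by simp
      hence "exp (-b) \<le> q2" using q2_ge by linarith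
      hence "exp (-b) * y^2 / 4 \<le> q2 * y^2 / 4" by (intro divide_right_mono mult_right_mono) auto
      also have "\<dots> \<le> (norm (?v - 1))^2" using q2_ge y by (intro norm_scaled_cis_minus_1_ge) auto
      finally show ?thesis .
    qed
    have pos: "exp (-b) * y^2 / 4 > 0" using y by simp
    have "norm (?u - 1) \<noteq> 0"
    proof
      assume "norm (?u - 1) = 0"
      thus False using nu pos by simp
    qed
    hence u1: "?u - 1 \<noteq> 0" by simp
    have "norm (?v - 1) \<noteq> 0"
    proof
      assume "norm (?v - 1) = 0"
      thus False using nv pos by simp
    qed
    hence v1: "?v - 1 \<noteq> 0" by simp
    have "(\<Sum>j<M. of_real (fejer_node b N j) * cis (- (of_int k * (pi * real j / real N)))) =
          (\<Sum>j<M. ?u ^ j / of_real (1 - 2 powr (-b)) + ?v ^ j)"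
    proof (intro sum.cong refl)
      fix j
      have "cis (- (of_int k * (pi * real j / real N))) = cis y ^ j" by (simp add: Complex.DeMoivre y_def mult_ac)
      moreover have "fejer_node b N j = q1 ^ j / (1 - 2 powr (-b)) + q2 ^ j"
        by (simp add: fejer_node_def periodic_profile_def q1_def q2_def exp_of_nat_mult[symmetric] M mult_ac)
      ultimately show "of_real (fejer_node b N j) * cis (- (of_int k * (pi * real j / real N))) =
         ?u ^ j / of_real (1 - 2 powr (-b)) + ?v ^ j"
        by (simp add: power_mult_distrib distrib_right)
    qed
    also have "\<dots> = (\<Sum>j<M. ?u ^ j) / of_real (1 - 2 powr (-b)) + (\<Sum>j<M. ?v ^ j)"
      by (simp add: sum.distrib sum_divide_distrib)
    also have "(\<Sum>j<M. ?u ^ j) = (?u ^ M - 1) / (?u - 1)" using u1 by (intro geometric_sum) auto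
    also have "?u ^ M - 1 = - of_real (1 - 2 powr (-b))"
      by (simp add: power_mult_distrib yM of_real_power[symmetric] q1M del: of_real_power)
    also have "(\<Sum>j<M. ?v ^ j) = (?v ^ M - 1) / (?v - 1)" using v1 by (intro geometric_sum) auto
    also have "?v ^ M - 1 = 1"
      by (simp add: power_mult_distrib yM of_real_power[symmetric] q2M del: of_real_power)
    also have "- of_real (1 - 2 powr (-b)) / (?u - 1) / of_real (1 - 2 powr (-b)) + 1 / (?v - 1) = 1 / (?v - 1) - 1 / (?u - 1)"
    proof -
      have "complex_of_real (1 - 2 powr (-b)) \<noteq> 0" using qb by (simp only: of_real_eq_0_iff)
      thus ?thesis by (simp add: divide_simps del: of_real_diff)
    qed
    also have "\<dots> = of_real (q1 - q2) * cis y / ((?u - 1) * (?v - 1))"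
      using u1 v1 by (simp add: diff_frac_eq algebra_simps)
    finally have "norm (fejer_coeff b N k) = \<bar>q1 - q2\<bar> / (norm (?u - 1) * norm (?v - 1)) / real M"
      unfolding fejer_coeff_def M_def[symmetric]
      by (simp add: norm_divide norm_mult M del: of_real_diff)
    also have "\<dots> \<le> ((b + 2) / real M) / (exp (-b) * y^2 / 4) / real M"
    proof (intro divide_right_mono frac_le)
      have "q2 - q1 \<le> (b + 2) / real M"
      proof -
        have a: "1 - q1 \<le> b * ln 2 / real M" unfolding q1_def using exp_ge_add_one_self[of "- (b * ln 2 / real M)"] by linarith
        have "q2 - 1 = q2 * (1 - exp (- (ln 2 / real M)))" by (simp add: q2_def right_diff_distrib exp_minus)
        also have "\<dots> \<le> 2 * (ln 2 / real M)"
        proof (intro mult_mono)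
          have "ln 2 / real M \<le> ln 2 / 1" using l2 M by (intro divide_left_mono) auto
          hence "q2 \<le> exp (ln 2)" unfolding q2_def by (simp del: exp_ln)
          thus "q2 \<le> 2" by simp
          show "1 - exp (- (ln 2 / real M)) \<le> ln 2 / real M" using exp_ge_add_one_self[of "- (ln 2 / real M)"] by linarith
        qed (use l2 M in auto)
        finally have "q2 - q1 \<le> (b + 2) * ln 2 / real M" using a by (simp add: add_divide_distrib distrib_right)
        also have "\<dots> \<le> (b + 2) * 1 / real M" using b l2 M by (intro divide_right_mono mult_left_mono) auto
        finally show ?thesis by simp
      qed
      moreover have "q1 \<le> 1" unfolding q1_def using b l2 M by simp
      ultimately show "\<bar>q1 - q2\<bar> \<le> (b + 2) / real M" using q2_ge by linarith
      have "sqrt (exp (-b) * y^2 / 4) * sqrt (exp (-b) * y^2 / 4) \<le> norm (?u - 1) * norm (?v - 1)"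
        using nu nv pos by (intro mult_mono real_le_lsqrt) auto
      thus "exp (-b) * y^2 / 4 \<le> norm (?u - 1) * norm (?v - 1)" using pos by simp
    qed (use b M pos in auto)
    also have "\<dots> = (b + 2) * exp b * (4 / (real M ^ 2 * y^2))" using M(2) by (simp add: exp_minus divide_simps power2_eq_square)
    also have "real M ^ 2 * y^2 = 4 * pi^2 * of_int k ^ 2" using N0 by (simp add: M y_def power_divide power_mult_distrib)
    also have "(b + 2) * exp b * (4 / (4 * pi^2 * of_int k ^ 2)) \<le> (b + 2) * exp b * (1 / of_int k ^ 2)"
    proof (intro mult_left_mono)
      have "1 \<le> pi^2" using pi_gt3 by (intro one_le_power) auto
      hence "1 * of_int k ^ 2 \<le> pi^2 * (of_int k ^ 2 :: real)" by (intro mult_right_mono) auto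
      thus "4 / (4 * pi^2 * of_int k ^ 2) \<le> 1 / (of_int k ^ 2 :: real)" using k by (simp add: divide_simps)
    qed (use b in auto)
    finally show ?thesis by (simp add: C_def)
  qed
  moreover have "C > 0" using b by (simp add: C_def)
  ultimately show ?thesis by blast
qed

text \<open>The lower bound 1 comes from the rising exponential alone, exp r \<ge> 1; it keeps the
  main term positive without evaluating the mean.\<close>

lemma fejer_coeff_0_bounds:
  assumes b: "b > 0" and N: "N \<ge> 1"
  shows "fejer_coeff b N 0 = of_real ((\<Sum>j<2*N. fejer_node b N j) / (2 * real N))"
    and "(\<Sum>j<2*N. fejer_node b N j) / (2 * real N) \<ge> 1"
    and "(\<Sum>j<2*N. fejer_node b N j) / (2 * real N) \<le> 1 / (1 - 2 powr (-b)) + 2"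
proof -
  have q: "1 - 2 powr (-b) > (0::real)" using two_powr_minus_less_1[OF b] by simp
  show "fejer_coeff b N 0 = of_real ((\<Sum>j<2*N. fejer_node b N j) / (2 * real N))"
    by (simp add: fejer_coeff_def)
  have nd: "1 \<le> fejer_node b N j \<and> fejer_node b N j \<le> 1 / (1 - 2 powr (-b)) + 2" if "j < 2 * N" for j
  proof -
    let ?r = "ln 2 * (real j / (2 * real N))"
    have r: "0 \<le> ?r" "?r \<le> ln 2"
    proof -
      have "ln 2 * (real j / (2 * real N)) \<le> ln 2 * 1" using that N by (intro mult_left_mono) (auto simp: field_simps)
      thus "?r \<le> ln 2" by simp
    qed simp
    have "exp ?r \<le> exp (ln 2)" using r by (simp del: exp_ln)
    moreover have "exp ?r \<ge> 1" using r by simp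
    moreover have "exp (- (b * ?r)) / (1 - 2 powr (-b)) \<le> 1 / (1 - 2 powr (-b))"
      using b r q by (intro divide_right_mono) auto
    moreover have "exp (- (b * ?r)) / (1 - 2 powr (-b)) \<ge> 0" using q by simp
    ultimately show ?thesis unfolding fejer_node_def periodic_profile_def exp_ln[OF zero_less_numeral] by linarith
  qed
  have "(\<Sum>j<2*N. 1) \<le> (\<Sum>j<2*N. fejer_node b N j)" using nd by (intro sum_mono) auto
  thus "(\<Sum>j<2*N. fejer_node b N j) / (2 * real N) \<ge> 1" using N by (simp add: field_simps)
  have "(\<Sum>j<2*N. fejer_node b N j) \<le> (\<Sum>j<2*N. 1 / (1 - 2 powr (-b)) + 2)" using nd by (intro sum_mono) auto
  thus "(\<Sum>j<2*N. fejer_node b N j) / (2 * real N) \<le> 1 / (1 - 2 powr (-b)) + 2"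
    using N by (subst pos_divide_le_eq) (auto simp: mult.commute)
qed

section \<open>Twisted sums\<close>

definition twist :: "real \<Rightarrow> nat \<Rightarrow> complex" where
  "twist \<tau> n = cis (\<tau> * ln (real n))"

lemma norm_twist [simp]: "norm (twist \<tau> n) = 1"
  by (simp add: twist_def)

lemma twist_mult: "m > 0 \<Longrightarrow> n > 0 \<Longrightarrow> twist \<tau> (m * n) = twist \<tau> m * twist \<tau> n"
  by (simp add: twist_def cis_mult ln_mult distrib_left)

lemma twist_power: "m > 0 \<Longrightarrow> twist \<tau> (m ^ j) = twist \<tau> m ^ j"
  by (simp add: twist_def Complex.DeMoivre ln_realpow mult_ac)

lemma norm_one_minus_mult_le:
  fixes a c :: complex
  assumes "norm a = 1"
  shows "norm (1 - a * c) \<le> norm (1 - a) + norm (1 - c)"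
proof -
  have "1 - a * c = (1 - a) + a * (1 - c)" by (simp add: algebra_simps)
  hence "norm (1 - a * c) \<le> norm (1 - a) + norm (a * (1 - c))" by (metis norm_triangle_ineq)
  thus ?thesis using assms by (simp add: norm_mult)
qed

lemma twist_near_one:
  assumes "d \<ge> 0" "n > 0" "\<And>p. prime p \<Longrightarrow> p \<le> n \<Longrightarrow> norm (1 - twist \<tau> p) \<le> d"
  shows "norm (1 - twist \<tau> n) \<le> d * (ln (real n) / ln 2)"
  using assms(2,3)
proof (induction n rule: less_induct)
  case (less n)
  show ?case
  proof (cases "n = 1")
    case True
    thus ?thesis by (simp add: twist_def)
  next
    case False
    then obtain p where p: "prime p" "p dvd n" using prime_factor_nat by blast
    then obtain m where m: "n = p * m" by auto
    have m0: "m > 0" "p > 0" using m less.prems by (auto intro: Nat.gr0I)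
    have p2: "p \<ge> 2" using p prime_ge_2_nat by blast
    have mn: "m < n" using m m0 p2 by simp
    have "norm (1 - twist \<tau> n) \<le> norm (1 - twist \<tau> p) + norm (1 - twist \<tau> m)"
      unfolding m twist_mult[OF m0(2) m0(1)] by (rule norm_one_minus_mult_le) simp
    also have "\<dots> \<le> d * (ln (real p) / ln 2) + d * (ln (real m) / ln 2)"
    proof (rule add_mono)
      have "p \<le> n" using p less.prems dvd_imp_le by blast
      hence "norm (1 - twist \<tau> p) \<le> d * 1" using less.prems(2)[OF p(1)] by simp
      also have "\<dots> \<le> d * (ln (real p) / ln 2)" using assms(1) p2 by (intro mult_left_mono) auto
      finally show "norm (1 - twist \<tau> p) \<le> d * (ln (real p) / ln 2)" .
      show "norm (1 - twist \<tau> m) \<le> d * (ln (real m) / ln 2)"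
        using mn m0 less.prems(2) by (intro less.IH) auto
    qed
    also have "\<dots> = d * (ln (real n) / ln 2)"
      using m m0 by (simp add: ln_mult add_divide_distrib distrib_left)
    finally show ?thesis .
  qed
qed

text \<open>If \<open>p\<^bsup>i\<tau>\<^esup>\<close> were close to 1 for all small primes \<open>p\<close>, the same would hold for
  \<open>((m + 1)\<^sup>2 / (m (m + 2)))\<^bsup>i\<tau>\<^esup>\<close>; for \<open>m\<close> near \<open>\<surd>\<tau>\<close> its angle has order one.\<close>

lemma exists_prime_twist_away_from_one:
  "\<exists>C>0. \<forall>k\<ge>1. \<exists>p. prime p \<and> p \<noteq> 2 \<and> twist (2 * pi * real k / ln 2) p \<noteq> 1 \<and> real p * ln (real p) \<le> C * real k \<and>
     ln (real p) \<le> C * real k * norm (1 - twist (2 * pi * real k / ln 2) p)"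
proof -
  \<comment> \<open>1792 = 256 * 7 collects 128 / ln 2 \<le> 256 and (m + 2)^2 \<le> 7 \<tau>; the
    factor 16 is that of \<tau> \<le> 16 k.\<close>
  define C :: real where "C = 1792 * 16"
  have "\<exists>p. prime p \<and> p \<noteq> 2 \<and> twist (2 * pi * real k / ln 2) p \<noteq> 1 \<and> real p * ln (real p) \<le> C * real k \<and>
     ln (real p) \<le> C * real k * norm (1 - twist (2 * pi * real k / ln 2) p)" if k: "k \<ge> 1" for k :: nat
  proof -
    have l2: "ln 2 \<le> (1::real)" using ln_le_minus_one[of "2::real"] by simp
    define \<tau> where "\<tau> = 2 * pi * real k / ln 2"
    have "2 * 3 * 1 / 1 \<le> \<tau>"
      unfolding \<tau>_def using pi_gt3 k l2 by (intro frac_le mult_mono) auto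
    hence \<tau>6: "\<tau> \<ge> 6" by simp
    have \<tau>k: "\<tau> \<le> 16 * real k"
    proof -
      have "\<tau> \<le> 2 * 4 * real k / (1/2)"
        unfolding \<tau>_def using pi_less_4 ln2_ge_half by (intro frac_le mult_mono) auto
      thus ?thesis by simp
    qed
    define m where "m = nat \<lceil>sqrt \<tau>\<rceil>"
    have s2: "sqrt \<tau> \<ge> 2" by (rule real_le_rsqrt) (use \<tau>6 in auto)
    have ss: "sqrt \<tau> * sqrt \<tau> = \<tau>" using \<tau>6 by simp
    have m: "sqrt \<tau> \<le> real m" "real m \<le> sqrt \<tau> + 1" unfolding m_def using s2 by linarith+
    have m0: "m > 0" using m s2 by (auto intro: Nat.gr0I)
    have mt: "real m * real m \<ge> \<tau>" using mult_mono[OF m(1) m(1)] ss s2 by simp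
    have mt2: "real m * (real m + 2) \<le> 4 * \<tau>"
    proof -
      have "real m * (real m + 2) \<le> (sqrt \<tau> + 1) * (sqrt \<tau> + 3)" using m s2 by (intro mult_mono) auto
      also have "\<dots> = \<tau> + 4 * sqrt \<tau> + 3" using ss by (simp add: algebra_simps)
      also have "4 * sqrt \<tau> \<le> 2 * \<tau>"
        using mult_right_mono[OF s2, of "sqrt \<tau>"] ss s2 by simp
      finally show ?thesis using \<tau>6 by linarith
    qed
    have mt3: "(real m + 2)^2 \<le> 7 * \<tau>"
    proof -
      have "(real m + 2)^2 \<le> (sqrt \<tau> + 3)^2" using m by (intro power_mono) auto
      also have "\<dots> = \<tau> + 6 * sqrt \<tau> + 9" using ss by (simp add: power2_eq_square algebra_simps)
      also have "6 * sqrt \<tau> \<le> 3 * \<tau>"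
        using mult_right_mono[OF s2, of "sqrt \<tau>"] ss s2 by simp
      finally show ?thesis using \<tau>6 by linarith
    qed
    \<comment> \<open>1 + x = (m + 1)^2 / (m (m + 2)) is built from integers up to m + 2, and its
      logarithm has order 1 / \<tau>.\<close>
    define x where "x = 1 / (real m * (real m + 2))"
    have x: "x > 0" "x \<le> 1"
    proof -
      have "1 * 1 \<le> real m * (real m + 2)" using m0 by (intro mult_mono) auto
      thus "x \<le> 1" unfolding x_def by simp
    qed (use m0 in \<open>simp add: x_def\<close>)
    define \<phi> where "\<phi> = \<tau> * ln (1 + x)"
    have \<phi>1: "\<phi> \<le> 1"
    proof -
      have "\<phi> \<le> \<tau> * x" unfolding \<phi>_def using x \<tau>6 by (intro mult_left_mono ln_add_one_self_le_self) auto
      also have "\<dots> \<le> 1"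
      proof -
        have "real m * real m \<le> real m * (real m + 2)" by (intro mult_left_mono) auto
        hence "\<tau> \<le> real m * (real m + 2)" using mt by linarith
        thus ?thesis using m0 by (simp add: x_def)
      qed
      finally show ?thesis .
    qed
    have \<phi>2: "\<phi> \<ge> 1/8"
    proof -
      have "ln (1 / (1 + x)) \<le> 1 / (1 + x) - 1" using x by (intro ln_le_minus_one) auto
      hence "ln (1 + x) \<ge> 1 - 1 / (1 + x)" using x by (simp add: ln_div)
      also have "1 - 1 / (1 + x) = x / (1 + x)" using x by (simp add: field_simps)
      finally have "x / (1 + x) \<le> ln (1 + x)" .
      moreover have "x / 2 \<le> x / (1 + x)" using x by (intro divide_left_mono) auto
      ultimately have "x / 2 \<le> ln (1 + x)" by linarith
      hence "\<tau> * (x / 2) \<le> \<phi>" unfolding \<phi>_def using \<tau>6 by (intro mult_left_mono) auto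
      moreover have "1/8 \<le> \<tau> * (x / 2)"
      proof -
        have "1 / (4 * \<tau>) \<le> x" unfolding x_def using mt2 m0 \<tau>6 by (intro divide_left_mono mult_pos_pos) auto
        hence "\<tau> * (1 / (4 * \<tau>) / 2) \<le> \<tau> * (x / 2)" using \<tau>6 by (intro mult_left_mono) auto
        thus ?thesis using \<tau>6 by simp
      qed
      ultimately show ?thesis by linarith
    qed
    have away: "norm (1 - cis \<phi>) \<ge> 1/16"
    proof -
      have "norm (cis \<phi> - cis 0) \<ge> \<bar>\<phi> - 0\<bar> / 2" using \<phi>1 \<phi>2 pi_gt3 by (intro norm_cis_diff_ge) auto
      thus ?thesis using \<phi>2 by (simp add: norm_minus_commute)
    qed
    \<comment> \<open>Distance at most d at all primes up to m + 2 forces distance at most 1/128 at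
      all integers up to m + 2. The four integer factors of 1 + x then give at most 1/32,
      contradicting the 1/16 of \<open>away\<close>.\<close>
    define d where "d = ln 2 / (128 * ln (real m + 2))"
    have lm: "ln (real m + 2) > 0" using m0 by simp
    have d0: "d > 0" using lm by (simp add: d_def)
    have "\<exists>p. prime p \<and> p \<le> m + 2 \<and> norm (1 - twist \<tau> p) > d"
    proof (rule ccontr)
      assume "\<not> (\<exists>p. prime p \<and> p \<le> m + 2 \<and> norm (1 - twist \<tau> p) > d)"
      hence all: "norm (1 - twist \<tau> p) \<le> d" if "prime p" "p \<le> m + 2" for p using that by (meson not_le)
      have near: "norm (1 - twist \<tau> n) \<le> 1/128" if n: "n > 0" "n \<le> m + 2" for n
      proof -
        have "norm (1 - twist \<tau> n) \<le> d * (ln (real n) / ln 2)"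
          using n d0 all by (intro twist_near_one) auto
        also have "\<dots> \<le> d * (ln (real m + 2) / ln 2)"
          using n d0 by (intro mult_left_mono divide_right_mono ln_mono) auto
        also have "\<dots> = 1/128" using lm by (simp add: d_def)
        finally show ?thesis .
      qed
      have "twist \<tau> ((m+1) * (m+1)) = twist \<tau> (m * (m+2)) * cis \<phi>"
      proof -
        have "real m \<noteq> 0" "real m + 2 \<noteq> 0" using m0 by auto
        hence "real m * (real m + 2) * x = 1" by (simp add: x_def)
        hence "real ((m+1) * (m+1)) = real (m * (m+2)) * (1 + x)" by (simp add: algebra_simps)
        hence "ln (real ((m+1) * (m+1))) = ln (real (m * (m+2))) + ln (1 + x)"
          using m0 x by (simp only:) (subst ln_mult, auto)
        thus ?thesis by (simp only: twist_def cis_mult \<phi>_def distrib_left)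
      qed
      hence "norm (1 - cis \<phi>) = norm (twist \<tau> (m * (m+2)) - twist \<tau> ((m+1) * (m+1)))"
        using norm_mult[of "twist \<tau> (m * (m+2))" "1 - cis \<phi>"] by (simp add: right_diff_distrib)
      also have "\<dots> = norm ((1 - twist \<tau> ((m+1) * (m+1))) - (1 - twist \<tau> (m * (m+2))))" by simp
      also have "\<dots> \<le> norm (1 - twist \<tau> ((m+1) * (m+1))) + norm (1 - twist \<tau> (m * (m+2)))" by (rule norm_triangle_ineq4)
      also have "\<dots> \<le> (1/128 + 1/128) + (1/128 + 1/128)"
      proof (rule add_mono)
        have "norm (1 - twist \<tau> ((m+1) * (m+1))) \<le> norm (1 - twist \<tau> (m+1)) + norm (1 - twist \<tau> (m+1))"
          unfolding twist_mult[OF zero_less_Suc[of m, unfolded Suc_eq_plus1] zero_less_Suc[of m, unfolded Suc_eq_plus1]]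
          by (rule norm_one_minus_mult_le[OF norm_twist])
        also have "\<dots> \<le> 1/128 + 1/128" by (intro add_mono near) auto
        finally show "norm (1 - twist \<tau> ((m+1) * (m+1))) \<le> 1/128 + 1/128" .
        have "norm (1 - twist \<tau> (m * (m+2))) \<le> norm (1 - twist \<tau> m) + norm (1 - twist \<tau> (m+2))"
          using m0 by (subst twist_mult) (auto intro!: norm_one_minus_mult_le)
        also have "\<dots> \<le> 1/128 + 1/128" using m0 by (intro add_mono near) auto
        finally show "norm (1 - twist \<tau> (m * (m+2))) \<le> 1/128 + 1/128" .
      qed
      finally show False using away by simp
    qed
    then obtain p where p: "prime p" "p \<le> m + 2" "norm (1 - twist \<tau> p) > d" by blast
    have p0: "real p \<ge> 1" using p prime_gt_0_nat[of p] by simp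
    have pne: "twist \<tau> p \<noteq> 1" using p(3) d0 by auto
    \<comment> \<open>The frequencies belong to the period ln 2, so the prime found is automatically
      different from 2.\<close>
    have "twist \<tau> 2 = 1" using cis_int_2pi[of "int k"] by (simp add: twist_def \<tau>_def)
    hence "p \<noteq> 2" using pne by auto
    moreover have "real p * ln (real p) \<le> C * real k"
    proof -
      have "ln (real p) \<le> real m + 2" using ln_le_minus_one[of "real p"] p p0 by auto
      hence "real p * ln (real p) \<le> (real m + 2) * (real m + 2)" using p p0 by (intro mult_mono) auto
      also have "\<dots> \<le> 7 * \<tau>" using mt3 by (simp add: power2_eq_square)
      also have "\<dots> \<le> 7 * (16 * real k)" using \<tau>k by simp
      also have "\<dots> \<le> C * real k" by (simp add: C_def)
      finally show ?thesis .
    qed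
    moreover have "ln (real p) \<le> C * real k * norm (1 - twist \<tau> p)"
    proof -
      have "ln (real p) \<le> ln (real m + 2)" using p p0 by (intro ln_mono) auto
      also have "\<dots> = (128 / ln 2) * (ln (real m + 2) * ln (real m + 2)) * d" using lm by (simp add: d_def)
      also have "\<dots> \<le> 256 * (7 * \<tau>) * d"
      proof (rule mult_right_mono[OF mult_mono])
        have "128 / ln 2 \<le> 128 / (1/2::real)" using ln2_ge_half by (intro divide_left_mono) auto
        thus "128 / ln 2 \<le> (256::real)" by simp
        have "ln (real m + 2) \<le> real m + 2" using ln_le_minus_one[of "real m + 2"] by simp
        hence "ln (real m + 2) * ln (real m + 2) \<le> (real m + 2) * (real m + 2)" using lm by (intro mult_mono) auto
        thus "ln (real m + 2) * ln (real m + 2) \<le> 7 * \<tau>" using mt3 by (simp add: power2_eq_square)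
      qed (use d0 in auto)
      also have "\<dots> \<le> 256 * (7 * (16 * real k)) * norm (1 - twist \<tau> p)"
        using \<tau>k \<tau>6 p d0 by (intro mult_mono) auto
      finally show ?thesis by (simp add: C_def)
    qed
    ultimately show ?thesis using p pne unfolding \<tau>_def by blast
  qed
  moreover have "C > 0" by (simp add: C_def)
  ultimately show ?thesis by blast
qed

section \<open>Cancellation in twisted sums\<close>

lemma norm_geometric_le:
  fixes z :: complex
  assumes "norm z = 1" "z \<noteq> 1"
  shows "norm (\<Sum>j=1..n. z ^ j) \<le> 2 / norm (1 - z)"
proof -
  have "(1 - z) * (\<Sum>j=1..n. z ^ j) = z - z ^ Suc n"
  proof (induction n)
    case (Suc n)
    have "(1 - z) * (\<Sum>j=1..Suc n. z ^ j) = (1 - z) * (\<Sum>j=1..n. z ^ j) + (1 - z) * z ^ Suc n"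
      by (simp only: sum.nat_ivl_Suc' distrib_left) (simp add: algebra_simps)
    also have "\<dots> = z - z ^ Suc (Suc n)" unfolding Suc.IH by (simp add: algebra_simps)
    finally show ?case .
  qed simp
  hence "norm (1 - z) * norm (\<Sum>j=1..n. z ^ j) = norm (z - z ^ Suc n)" by (metis norm_mult)
  also have "\<dots> \<le> norm z + norm (z ^ Suc n)" by (rule norm_triangle_ineq4)
  also have "\<dots> = 2" using assms by (simp add: norm_mult norm_power)
  finally show ?thesis using assms by (simp add: pos_le_divide_eq mult.commute)
qed

lemma coprime_upto_restrict:
  "u \<ge> 0 \<Longrightarrow> coprime_upto Q (t - u) = {m \<in> coprime_upto Q t. ln (real m) \<le> t - u}"
  unfolding coprime_upto_def by auto

text \<open>The exponent j of p is summed first: for each m the admissible j form an initial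
  segment, and the geometric sum in p^(i\<tau>) is bounded whatever its length. The remaining sum
  over m coprime to p is estimated trivially.\<close>

lemma norm_twisted_sum_le:
  assumes p: "prime p" "p \<noteq> 2" and z: "twist \<tau> p \<noteq> 1" and t: "t \<ge> 0"
  shows "norm (\<Sum>n\<in>coprime_upto {2} t. of_real (kernel_weight n) * twist \<tau> n) \<le>
         weight_sum {p, 2} t * (1 + 2 / ((real p + 1) * norm (1 - twist \<tau> p)))"
proof -
  have lp: "ln (real p) > 0" using p ln_prime_pos by auto
  have p0: "p > 0" using p prime_gt_0_nat by blast
  define J where "J = nat \<lfloor>t / ln (real p)\<rfloor>"
  have J: "t < real (Suc J) * ln (real p)"
  proof -
    have "t / ln (real p) < real (Suc J)" using t lp unfolding J_def by (simp add: floor_less_iff) linarith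
    thus ?thesis using lp by (simp add: pos_divide_less_eq)
  qed
  let ?U = "coprime_upto {p, 2}" and ?z = "twist \<tau> p"
  let ?w = "\<lambda>m. complex_of_real (kernel_weight m)"
  have "(\<Sum>n\<in>coprime_upto {2} t. ?w n * twist \<tau> n) = (\<Sum>m\<in>?U t. ?w m * twist \<tau> m) +
      (\<Sum>j=1..J. \<Sum>m\<in>?U (t - real j * ln (real p)). ?w (p ^ j * m) * twist \<tau> (p ^ j * m))"
    by (rule sum_coprime_upto_split') (use p J in auto)
  also have "(\<Sum>j=1..J. \<Sum>m\<in>?U (t - real j * ln (real p)). ?w (p ^ j * m) * twist \<tau> (p ^ j * m)) =
      (\<Sum>j=1..J. \<Sum>m | m \<in> ?U t \<and> ln (real m) \<le> t - real j * ln (real p). ?w m * twist \<tau> m * (1 / (of_nat p + 1)) * ?z ^ j)"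
  proof (intro sum.cong)
    fix j assume j: "j \<in> {1..J}"
    have "real j * ln (real p) \<ge> 0" using lp by simp
    thus "?U (t - real j * ln (real p)) = {m \<in> ?U t. ln (real m) \<le> t - real j * ln (real p)}"
      by (rule coprime_upto_restrict)
    fix m assume "m \<in> {m \<in> ?U t. ln (real m) \<le> t - real j * ln (real p)}"
    hence m: "m > 0" "\<not> p dvd m" by (auto simp: coprime_upto_def)
    have "kernel_weight (p ^ j * m) = (1 / (real p + 1)) * kernel_weight m"
      using kernel_weight_power_mult[OF p(1) m(2,1), of j] j by simp
    moreover have "twist \<tau> (p ^ j * m) = ?z ^ j * twist \<tau> m" using m p0 by (simp add: twist_mult twist_power)
    ultimately show "?w (p ^ j * m) * twist \<tau> (p ^ j * m) = ?w m * twist \<tau> m * (1 / (of_nat p + 1)) * ?z ^ j" by simp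
  qed simp
  also have "\<dots> = (\<Sum>m\<in>?U t. \<Sum>j | j \<in> {1..J} \<and> ln (real m) \<le> t - real j * ln (real p). ?w m * twist \<tau> m * (1 / (of_nat p + 1)) * ?z ^ j)"
    by (rule sum.swap_restrict) auto
  also have "(\<Sum>m\<in>?U t. ?w m * twist \<tau> m) + \<dots> = (\<Sum>m\<in>?U t. ?w m * twist \<tau> m * (1 + (1 / (of_nat p + 1)) *
       (\<Sum>j | j \<in> {1..J} \<and> ln (real m) \<le> t - real j * ln (real p). ?z ^ j)))"
    by (simp add: sum.distrib distrib_left sum_distrib_left mult.assoc)
  also have "norm \<dots> \<le> (\<Sum>m\<in>?U t. kernel_weight m * (1 + 2 / ((real p + 1) * norm (1 - ?z))))"
  proof (rule order_trans[OF norm_sum sum_mono])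
    fix m assume "m \<in> ?U t"
    hence m: "m > 0" "ln (real m) \<le> t" by (auto simp: coprime_upto_def)
    define n where "n = min J (nat \<lfloor>(t - ln (real m)) / ln (real p)\<rfloor>)"
    have set: "{j. j \<in> {1..J} \<and> ln (real m) \<le> t - real j * ln (real p)} = {1..n}"
    proof -
      have "ln (real m) \<le> t - real j * ln (real p) \<longleftrightarrow> j \<le> nat \<lfloor>(t - ln (real m)) / ln (real p)\<rfloor>" for j
      proof -
        have "ln (real m) \<le> t - real j * ln (real p) \<longleftrightarrow> real j \<le> (t - ln (real m)) / ln (real p)"
          using lp by (auto simp: pos_le_divide_eq)
        also have "\<dots> \<longleftrightarrow> j \<le> nat \<lfloor>(t - ln (real m)) / ln (real p)\<rfloor>"
          using m lp by (auto simp: le_nat_iff le_floor_iff)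
        finally show ?thesis .
      qed
      hence "{j. j \<in> {1..J} \<and> ln (real m) \<le> t - real j * ln (real p)} = {j. j \<in> {1..J} \<and> j \<le> nat \<lfloor>(t - ln (real m)) / ln (real p)\<rfloor>}"
        by (simp only:)
      also have "\<dots> = {1..n}" unfolding n_def by auto
      finally show ?thesis .
    qed
    have "norm (1 + (1 / (of_nat p + 1)) * (\<Sum>j=1..n. ?z ^ j)) \<le> norm (1::complex) + norm ((1 / (of_nat p + 1)) * (\<Sum>j=1..n. ?z ^ j))"
      by (rule norm_triangle_ineq)
    also have "norm ((1 / (of_nat p + 1)) * (\<Sum>j=1..n. ?z ^ j)) = (1 / (real p + 1)) * norm (\<Sum>j=1..n. ?z ^ j)"
    proof -
      have "norm (of_nat p + 1 :: complex) = real p + 1" by (metis norm_of_nat of_nat_1 of_nat_add)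
      thus ?thesis by (simp add: norm_mult norm_divide)
    qed
    also have "\<dots> \<le> (1 / (real p + 1)) * (2 / norm (1 - ?z))"
      using z by (intro mult_left_mono norm_geometric_le) auto
    finally have "norm (1 + (1 / (of_nat p + 1)) * (\<Sum>j=1..n. ?z ^ j)) \<le> 1 + 2 / ((real p + 1) * norm (1 - ?z))" by simp
    thus "norm (?w m * twist \<tau> m * (1 + (1 / (of_nat p + 1)) * (\<Sum>j | j \<in> {1..J} \<and> ln (real m) \<le> t - real j * ln (real p). ?z ^ j))) \<le>
       kernel_weight m * (1 + 2 / ((real p + 1) * norm (1 - ?z)))"
      unfolding set norm_mult by (simp add: mult_left_mono)
  qed
  also have "\<dots> = weight_sum {p, 2} t * (1 + 2 / ((real p + 1) * norm (1 - ?z)))"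
    by (simp add: weight_sum_def sum_distrib_right)
  finally show ?thesis .
qed

text \<open>Excluding p multiplies the sum by O(p ln p / \<open>root_scale t\<close>). Together with
  the geometric factor this leaves the terms p ln p and ln p / |1 - p^(i\<tau>)|, both O(k) for the
  prime of \<open>exists_prime_twist_away_from_one\<close>. Negative k follow by
  conjugation.\<close>

lemma norm_twisted_sum_bound:
  "\<exists>C>0. \<forall>\<^sub>F t in at_top. \<forall>k::int. k \<noteq> 0 \<longrightarrow>
     norm (\<Sum>n\<in>coprime_upto {2} t. of_real (kernel_weight n) * twist (2 * pi * of_int k / ln 2) n) \<le>
     C * \<bar>of_int k\<bar> / root_scale t * weight_sum {2} t"
proof -
  obtain C1 where C1: "C1 > 0" "\<And>k. k \<ge> 1 \<Longrightarrow> \<exists>p. prime p \<and> p \<noteq> 2 \<and> twist (2 * pi * real k / ln 2) p \<noteq> 1 \<and> real p * ln (real p) \<le> C1 * real k \<and>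
     ln (real p) \<le> C1 * real k * norm (1 - twist (2 * pi * real k / ln 2) p)"
    using exists_prime_twist_away_from_one by blast
  obtain C2 where C2: "C2 > 0" and ev: "\<forall>\<^sub>F t in at_top. \<forall>Q p. prime p \<longrightarrow> p \<notin> Q \<longrightarrow> admissible (insert p Q) \<longrightarrow>
     weight_sum (insert p Q) t \<le> C2 * (real p * ln (real p)) / root_scale t * weight_sum Q t"
    using weight_sum_exclude_prime by blast
  have "\<forall>\<^sub>F t in at_top. \<forall>k::int. k \<noteq> 0 \<longrightarrow>
     norm (\<Sum>n\<in>coprime_upto {2} t. of_real (kernel_weight n) * twist (2 * pi * of_int k / ln 2) n) \<le>
     (3 * C2 * C1) * \<bar>of_int k\<bar> / root_scale t * weight_sum {2} t"
    using ev eventually_gt_at_top[of 1]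
  proof eventually_elim
    case (elim t)
    have rp: "root_scale t > 0" using elim by (intro root_scale_pos) auto
    have pos: "norm (\<Sum>n\<in>coprime_upto {2} t. of_real (kernel_weight n) * twist (2 * pi * real k / ln 2) n) \<le>
       (3 * C2 * C1) * real k / root_scale t * weight_sum {2} t" if k: "k \<ge> 1" for k
    proof -
      define \<tau> where "\<tau> = 2 * pi * real k / ln 2"
      obtain p where p: "prime p" "p \<noteq> 2" "twist \<tau> p \<noteq> 1" "real p * ln (real p) \<le> C1 * real k"
         "ln (real p) \<le> C1 * real k * norm (1 - twist \<tau> p)"
        using C1(2)[OF k] unfolding \<tau>_def by blast
      have nz: "norm (1 - twist \<tau> p) > 0" using p by simp
      have lp: "ln (real p) > 0" using p ln_prime_pos by auto
      have p0: "real p > 0" using p prime_gt_0_nat by simp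
      have "norm (\<Sum>n\<in>coprime_upto {2} t. of_real (kernel_weight n) * twist \<tau> n) \<le>
         weight_sum {p, 2} t * (1 + 2 / ((real p + 1) * norm (1 - twist \<tau> p)))"
        using elim p by (intro norm_twisted_sum_le) auto
      also have "\<dots> \<le> (C2 * (real p * ln (real p)) / root_scale t * weight_sum {2} t) * (1 + 2 / (real p * norm (1 - twist \<tau> p)))"
      proof (intro mult_mono add_left_mono)
        have "admissible {p, 2}" using p by (auto simp: admissible_def card_insert_if)
        thus "weight_sum {p, 2} t \<le> C2 * (real p * ln (real p)) / root_scale t * weight_sum {2} t"
          using elim(1) p by auto
        show "2 / ((real p + 1) * norm (1 - twist \<tau> p)) \<le> 2 / (real p * norm (1 - twist \<tau> p))"
          using p0 nz by (intro divide_left_mono mult_right_mono) auto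
      qed (use C2 lp p0 rp in auto)
      also have "\<dots> = C2 / root_scale t * weight_sum {2} t * (real p * ln (real p) + 2 * (ln (real p) / norm (1 - twist \<tau> p)))"
      proof -
        have "(real p * l) * (1 + 2 / (real p * n)) = real p * l + 2 * (l / n)" for l n
          using p0 by (simp add: distrib_left)
        moreover have "(C2 * X / root_scale t * weight_sum {2} t) * Y = C2 / root_scale t * weight_sum {2} t * (X * Y)" for X Y
          by simp
        ultimately show ?thesis by (simp only:)
      qed
      also have "\<dots> \<le> C2 / root_scale t * weight_sum {2} t * (C1 * real k + 2 * (C1 * real k))"
        using p C2 rp nz by (intro mult_left_mono add_mono) (auto simp: pos_divide_le_eq)
      also have "\<dots> = (3 * C2 * C1) * real k / root_scale t * weight_sum {2} t"
        by (simp add: field_simps)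
      finally show ?thesis unfolding \<tau>_def .
    qed
    show ?case
    proof (intro allI impI)
      fix k :: int assume k: "k \<noteq> 0"
      let ?S = "\<lambda>\<tau>. (\<Sum>n\<in>coprime_upto {2} t. of_real (kernel_weight n) * twist \<tau> n)"
      show "norm (?S (2 * pi * of_int k / ln 2)) \<le> (3 * C2 * C1) * \<bar>of_int k\<bar> / root_scale t * weight_sum {2} t"
      proof (cases "k > 0")
        case True
        thus ?thesis using pos[of "nat k"] by simp
      next
        case False
        have "cnj (?S (- \<tau>)) = ?S \<tau>" for \<tau> by (simp add: twist_def cis_cnj)
        hence "norm (?S \<tau>) = norm (?S (- \<tau>))" for \<tau> by (metis complex_mod_cnj)
        moreover have "- (2 * pi * of_int k / ln 2) = 2 * pi * real (nat (- k)) / ln 2" using False by simp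
        ultimately have "norm (?S (2 * pi * of_int k / ln 2)) = norm (?S (2 * pi * real (nat (- k)) / ln 2))"
          by metis
        thus ?thesis using pos[of "nat (- k)"] False k by simp
      qed
    qed
  qed
  thus ?thesis using C1 C2 by (intro exI[of _ "3 * C2 * C1"]) auto
qed

lemma harm_le_one_plus_ln: "n \<ge> 1 \<Longrightarrow> harm n \<le> 1 + ln (real n)"
proof -
  assume "n \<ge> 1"
  then obtain m where m: "n = Suc m" by (cases n) auto
  have "harm (Suc m) - ln (real (Suc m)) \<le> harm (Suc 0) - ln (real (Suc 0))"
    using decseq_harm_diff_ln by (rule decseqD) simp
  thus ?thesis using m by (simp add: harm_def)
qed

lemma sum_recip_distance_le:
  assumes "l < N"
  shows "(\<Sum>l'\<in>{..<N} - {l}. 1 / \<bar>real l - real l'\<bar>) \<le> 2 * (1 + ln (real N))"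
proof -
  have "(\<Sum>l'\<in>{..<N} - {l}. 1 / \<bar>real l - real l'\<bar>) = (\<Sum>l'\<in>{..<l} \<union> {l<..<N}. 1 / \<bar>real l - real l'\<bar>)"
    using assms by (intro sum.cong) auto
  also have "\<dots> = (\<Sum>l'\<in>{..<l}. 1 / \<bar>real l - real l'\<bar>) + (\<Sum>l'\<in>{l<..<N}. 1 / \<bar>real l - real l'\<bar>)"
    by (rule sum.union_disjoint) auto
  also have "(\<Sum>l'\<in>{..<l}. 1 / \<bar>real l - real l'\<bar>) = harm l"
    unfolding harm_def by (rule sum.reindex_bij_witness[of _ "\<lambda>i. l - i" "\<lambda>i. l - i"]) (auto simp: of_nat_diff field_simps)
  also have "(\<Sum>l'\<in>{l<..<N}. 1 / \<bar>real l - real l'\<bar>) = harm (N - l - 1)"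
    unfolding harm_def by (rule sum.reindex_bij_witness[of _ "\<lambda>i. l + i" "\<lambda>i. i - l"]) (auto simp: of_nat_diff field_simps)
  also have "harm l + harm (N - l - 1) \<le> harm N + (harm N :: real)"
    using assms by (intro add_mono harm_mono) auto
  also have "\<dots> \<le> 2 * (1 + ln (real N))" using harm_le_one_plus_ln[of N] assms by simp
  finally show ?thesis .
qed

definition fejer_mean_value :: "real \<Rightarrow> nat \<Rightarrow> real" where
  "fejer_mean_value b N = (\<Sum>j<2*N. fejer_node b N j) / (2 * real N)"

lemma root_scale_le: "t > 1 \<Longrightarrow> root_scale t \<le> t"
proof -
  assume t: "t > 1"
  hence "t * ln t \<le> t * t" using ln_le_minus_one[of t] by (intro mult_left_mono) auto
  hence "root_scale t \<le> sqrt (t * t)" unfolding root_scale_def by (rule real_sqrt_le_mono)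
  thus ?thesis using t by simp
qed

text \<open>N \<ge> t^2 makes the approximation error 1 / \<surd>N at most 1 / t, and N \<le> t^4
  keeps ln N = O(ln t). Coefficient times twisted sum is O(1 / |l - l'|) relative to 1 /
  \<open>root_scale t\<close>; summing over l' gives O(ln N), and the average over l removes the
  factor N.\<close>

lemma periodized_sum_asymp:
  assumes b: "b > 0"
  shows "\<exists>C>0. \<forall>\<^sub>F t in at_top. \<forall>N. t^2 \<le> real N \<longrightarrow> real N \<le> t^4 \<longrightarrow>
     \<bar>(\<Sum>m\<in>coprime_upto {2} t. kernel_weight m * periodized_tent b (t - ln (real m))) - fejer_mean_value b N * weight_sum {2} t\<bar>
     \<le> C * ln t / root_scale t * weight_sum {2} t"
proof -
  obtain C1 where C1: "C1 > 0" "\<And>N s. N \<ge> 1 \<Longrightarrow> \<bar>periodized_tent b s - fejer_approx b N s\<bar> \<le> C1 / sqrt (real N)"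
    using periodized_tent_approx[OF b] by blast
  obtain C2 where C2: "C2 > 0" "\<And>N k. N \<ge> 1 \<Longrightarrow> k \<noteq> 0 \<Longrightarrow> \<bar>k\<bar> < int N \<Longrightarrow> norm (fejer_coeff b N k) \<le> C2 / (of_int k)^2"
    using fejer_coeff_bound[OF b] by blast
  obtain C3 where C3: "C3 > 0" and ev: "\<forall>\<^sub>F t in at_top. \<forall>k::int. k \<noteq> 0 \<longrightarrow>
     norm (\<Sum>n\<in>coprime_upto {2} t. of_real (kernel_weight n) * twist (2 * pi * of_int k / ln 2) n) \<le>
     C3 * \<bar>of_int k\<bar> / root_scale t * weight_sum {2} t"
    using norm_twisted_sum_bound by blast
  define C where "C = C1 + 10 * C2 * C3"
  have "\<forall>\<^sub>F t::real in at_top. ln t \<ge> 1" by real_asymp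
  with ev have "\<forall>\<^sub>F t in at_top. \<forall>N. t^2 \<le> real N \<longrightarrow> real N \<le> t^4 \<longrightarrow>
     \<bar>(\<Sum>m\<in>coprime_upto {2} t. kernel_weight m * periodized_tent b (t - ln (real m))) - fejer_mean_value b N * weight_sum {2} t\<bar>
     \<le> C * ln t / root_scale t * weight_sum {2} t"
    using eventually_gt_at_top[of 1]
  proof eventually_elim
    case (elim t)
    show ?case
    proof (intro allI impI)
      fix N :: nat assume N: "t^2 \<le> real N" "real N \<le> t^4"
      have rp: "root_scale t > 0" using elim by (intro root_scale_pos) auto
      have "1 \<le> t^2" using elim by (intro one_le_power) auto
      hence N1: "N \<ge> 1" using N by simp
      let ?U = "coprime_upto {2} t" and ?W = "weight_sum {2} t"
      let ?s = "\<lambda>m. t - ln (real m)"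
      have 1: "\<bar>(\<Sum>m\<in>?U. kernel_weight m * periodized_tent b (?s m)) - (\<Sum>m\<in>?U. kernel_weight m * fejer_approx b N (?s m))\<bar>
          \<le> C1 * ln t / root_scale t * ?W"
      proof -
        have "\<bar>(\<Sum>m\<in>?U. kernel_weight m * periodized_tent b (?s m)) - (\<Sum>m\<in>?U. kernel_weight m * fejer_approx b N (?s m))\<bar> =
          \<bar>\<Sum>m\<in>?U. kernel_weight m * (periodized_tent b (?s m) - fejer_approx b N (?s m))\<bar>"
          by (simp add: right_diff_distrib sum_subtractf)
        also have "\<dots> \<le> (\<Sum>m\<in>?U. \<bar>kernel_weight m * (periodized_tent b (?s m) - fejer_approx b N (?s m))\<bar>)" by (rule sum_abs)
        also have "\<dots> \<le> (\<Sum>m\<in>?U. kernel_weight m * (C1 * ln t / root_scale t))"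
        proof (rule sum_mono)
          fix m
          have "\<bar>periodized_tent b (?s m) - fejer_approx b N (?s m)\<bar> \<le> C1 / sqrt (real N)" by (rule C1(2)[OF N1])
          also have "\<dots> \<le> C1 / root_scale t"
          proof -
            have "root_scale t \<le> t" using elim by (intro root_scale_le) auto
            also have "t = sqrt (t^2)" using elim by simp
            also have "\<dots> \<le> sqrt (real N)" using N by (intro real_sqrt_le_mono)
            finally show ?thesis using rp C1(1) N1 by (intro divide_left_mono mult_pos_pos) auto
          qed
          also have "\<dots> \<le> C1 * ln t / root_scale t" using elim C1(1) rp by (intro divide_right_mono) auto
          finally show "\<bar>kernel_weight m * (periodized_tent b (?s m) - fejer_approx b N (?s m))\<bar> \<le> kernel_weight m * (C1 * ln t / root_scale t)"
            unfolding abs_mult by (intro mult_mono) auto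
        qed
        also have "\<dots> = C1 * ln t / root_scale t * ?W" by (simp add: weight_sum_def sum_distrib_left mult.commute)
        finally show ?thesis .
      qed
      define T where "T k = (\<Sum>m\<in>?U. of_real (kernel_weight m) * cis (of_int k * (2 * pi * ?s m / ln 2)))" for k :: int
      have T: "norm (T k) \<le> C3 * \<bar>of_int k\<bar> / root_scale t * ?W" if "k \<noteq> 0" for k
      proof -
        have "T k = cis (of_int k * (2 * pi * t / ln 2)) * (\<Sum>n\<in>?U. of_real (kernel_weight n) * twist (2 * pi * of_int (- k) / ln 2) n)"
          unfolding T_def twist_def sum_distrib_left
        proof (intro sum.cong refl)
          fix m
          have "cis (of_int k * (2 * pi * ?s m / ln 2)) = cis (of_int k * (2 * pi * t / ln 2)) * cis (2 * pi * of_int (- k) / ln 2 * ln (real m))"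
            unfolding cis_mult by (intro arg_cong[of _ _ cis]) (simp add: field_simps)
          thus "of_real (kernel_weight m) * cis (of_int k * (2 * pi * ?s m / ln 2)) =
             cis (of_int k * (2 * pi * t / ln 2)) * (of_real (kernel_weight m) * cis (2 * pi * of_int (- k) / ln 2 * ln (real m)))"
            by (simp only: mult_ac)
        qed
        hence "norm (T k) = norm (\<Sum>n\<in>?U. of_real (kernel_weight n) * twist (2 * pi * of_int (- k) / ln 2) n)"
          by (simp add: norm_mult)
        also have "\<dots> \<le> C3 * \<bar>of_int (- k)\<bar> / root_scale t * ?W"
          using elim(1) that by (metis neg_equal_0_iff_equal)
        finally show ?thesis by simp
      qed
      have T0: "T 0 = of_real ?W" by (simp add: T_def weight_sum_def)
      have "complex_of_real (\<Sum>m\<in>?U. kernel_weight m * fejer_approx b N (?s m)) =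
         (\<Sum>m\<in>?U. \<Sum>l<N. \<Sum>l'<N. of_real (kernel_weight m) * (fejer_coeff b N (int l - int l') * cis (of_int (int l - int l') * (2 * pi * ?s m / ln 2)) / of_nat N))"
        by (simp add: fejer_approx_eq sum_distrib_left sum_divide_distrib)
      also have "\<dots> = (\<Sum>l<N. \<Sum>l'<N. \<Sum>m\<in>?U. of_real (kernel_weight m) * (fejer_coeff b N (int l - int l') * cis (of_int (int l - int l') * (2 * pi * ?s m / ln 2)) / of_nat N))"
        by (rule sum_swap3)
      also have "\<dots> = (\<Sum>l<N. \<Sum>l'<N. fejer_coeff b N (int l - int l') * T (int l - int l') / of_nat N)"
        unfolding T_def sum_distrib_left sum_divide_distrib by (intro sum.cong refl) (simp add: mult_ac)
      also have "\<dots> = (\<Sum>l<N. fejer_coeff b N 0 * T 0 / of_nat N + (\<Sum>l'\<in>{..<N} - {l}. fejer_coeff b N (int l - int l') * T (int l - int l') / of_nat N))"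
        by (intro sum.cong refl, subst sum.remove) auto
      also have "\<dots> = of_real (fejer_mean_value b N * ?W) + (\<Sum>l<N. \<Sum>l'\<in>{..<N} - {l}. fejer_coeff b N (int l - int l') * T (int l - int l') / of_nat N)"
        using N1 by (simp add: sum.distrib T0 fejer_coeff_0_bounds(1)[OF b N1] fejer_mean_value_def)
      finally have "complex_of_real ((\<Sum>m\<in>?U. kernel_weight m * fejer_approx b N (?s m)) - fejer_mean_value b N * ?W) =
          (\<Sum>l<N. \<Sum>l'\<in>{..<N} - {l}. fejer_coeff b N (int l - int l') * T (int l - int l') / of_nat N)" by simp
      from arg_cong[OF this, of norm]
      have "\<bar>(\<Sum>m\<in>?U. kernel_weight m * fejer_approx b N (?s m)) - fejer_mean_value b N * ?W\<bar> =
          norm (\<Sum>l<N. \<Sum>l'\<in>{..<N} - {l}. fejer_coeff b N (int l - int l') * T (int l - int l') / of_nat N)"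
        unfolding norm_of_real .
      also have "\<dots> \<le> (\<Sum>l<N. \<Sum>l'\<in>{..<N} - {l}. norm (fejer_coeff b N (int l - int l') * T (int l - int l') / of_nat N))"
        by (intro order_trans[OF norm_sum] sum_mono norm_sum)
      also have "\<dots> \<le> (\<Sum>l<N. \<Sum>l'\<in>{..<N} - {l}. (C2 * C3 / root_scale t * ?W / real N) * (1 / \<bar>real l - real l'\<bar>))"
      proof (intro sum_mono)
        fix l l' assume l: "l \<in> {..<N}" "l' \<in> {..<N} - {l}"
        define k where "k = int l - int l'"
        have k: "k \<noteq> 0" "\<bar>k\<bar> < int N" using l by (auto simp: k_def)
        have "norm (fejer_coeff b N k * T k / of_nat N) \<le> (C2 / (of_int k)^2) * (C3 * \<bar>of_int k\<bar> / root_scale t * ?W) / real N"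
          unfolding norm_divide norm_mult norm_of_nat
          using k C2(2)[OF N1 k] T[OF k(1)] C2(1) by (intro divide_right_mono mult_mono) auto
        also have "\<dots> = (C2 * C3 / root_scale t * ?W / real N) * (\<bar>of_int k\<bar> / (of_int k)^2)" by (simp add: field_simps)
        also have "\<bar>of_int k\<bar> / (of_int k)^2 = 1 / \<bar>real_of_int k\<bar>"
        proof -
          have "\<bar>x\<bar> / x^2 = 1 / \<bar>x\<bar>" if "x \<noteq> 0" for x :: real
            using that by (cases "x > 0") (auto simp: power2_eq_square field_simps)
          thus ?thesis using k by simp
        qed
        finally show "norm (fejer_coeff b N (int l - int l') * T (int l - int l') / of_nat N) \<le> (C2 * C3 / root_scale t * ?W / real N) * (1 / \<bar>real l - real l'\<bar>)"
          by (simp add: k_def)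
      qed
      also have "\<dots> \<le> (\<Sum>l<N. (C2 * C3 / root_scale t * ?W / real N) * (2 * (1 + ln (real N))))"
      proof (intro sum_mono)
        fix l assume "l \<in> {..<N}"
        thus "(\<Sum>l'\<in>{..<N} - {l}. (C2 * C3 / root_scale t * ?W / real N) * (1 / \<bar>real l - real l'\<bar>)) \<le> (C2 * C3 / root_scale t * ?W / real N) * (2 * (1 + ln (real N)))"
          unfolding sum_distrib_left[symmetric] using C2(1) C3 rp
          by (intro mult_left_mono sum_recip_distance_le) auto
      qed
      also have "\<dots> = (C2 * C3 / root_scale t * ?W) * (2 * (1 + ln (real N)))" using N1 by simp
      also have "\<dots> \<le> (C2 * C3 / root_scale t * ?W) * (10 * ln t)"
      proof (intro mult_left_mono)
        have "ln (real N) \<le> ln (t^4)" using N N1 by (intro ln_mono) auto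
        also have "\<dots> = 4 * ln t" using ln_realpow[of t 4] by simp
        finally have "ln (real N) \<le> 4 * ln t" .
        hence "2 * (1 + ln (real N)) \<le> 2 * (ln t + 4 * ln t)" using elim(2) by (intro mult_left_mono add_mono) auto
        thus "2 * (1 + ln (real N)) \<le> 10 * ln t" by simp
      qed (use C2(1) C3 rp in auto)
      also have "\<dots> = (10 * C2 * C3) * ln t / root_scale t * ?W" by simp
      finally have 2: "\<bar>(\<Sum>m\<in>?U. kernel_weight m * fejer_approx b N (?s m)) - fejer_mean_value b N * ?W\<bar> \<le> (10 * C2 * C3) * ln t / root_scale t * ?W" .
      have "C * ln t / root_scale t * ?W = C1 * ln t / root_scale t * ?W + (10 * C2 * C3) * ln t / root_scale t * ?W"
        by (simp add: C_def distrib_right add_divide_distrib)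
      thus "\<bar>(\<Sum>m\<in>?U. kernel_weight m * periodized_tent b (?s m)) - fejer_mean_value b N * ?W\<bar> \<le> C * ln t / root_scale t * ?W"
        using 1 2 by linarith
    qed
  qed
  moreover have "C > 0" using C1 C2 C3 by (auto simp: C_def intro!: add_pos_pos mult_pos_pos)
  ultimately show ?thesis by blast
qed

section \<open>Tent sums\<close>

text \<open>For n = m / k(m) and s = t - ln n, the two conditions on m bound k(m) by a constant
  times exp s and exp (- b s) respectively, with b = \<theta> / (1 - \<theta>). The stricter one is
  m \<le> x for s < 0 and the kernel condition for s \<ge> 0.\<close>

definition tent :: "real \<Rightarrow> real \<Rightarrow> real" where
  "tent b s = (if s \<ge> 0 then exp (- (b * s)) else exp s)"

text \<open>A truncation of L(t). The cut-off R will be ln x, because m / k(m) never exceeds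
  x.\<close>

definition tent_sum :: "real \<Rightarrow> real \<Rightarrow> real \<Rightarrow> real" where
  "tent_sum b R t = (\<Sum>n\<in>coprime_upto {} R. kernel_weight n * tent b (t - ln (real n)))"

lemma tent_pos: "tent b s > 0"
  by (simp add: tent_def)

lemma tent_nonneg [simp]: "tent b s \<ge> 0"
  using tent_pos[of b s] by simp

lemma sum_over_windows_le:
  fixes g \<phi> :: "'a \<Rightarrow> real" and c :: "nat \<Rightarrow> real"
  assumes "finite S" "\<And>i. finite (B i)" "\<And>i. c i \<ge> 0" "\<And>m. g m \<ge> 0"
    and cover: "\<And>m. m \<in> S \<Longrightarrow> \<exists>i<I. m \<in> B i - A i \<and> \<phi> m \<le> c i"
  shows "(\<Sum>m\<in>S. g m * \<phi> m) \<le> (\<Sum>i<I. c i * (\<Sum>m\<in>B i - A i. g m))"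
proof -
  have "(\<Sum>m\<in>S. g m * \<phi> m) \<le> (\<Sum>m\<in>S. \<Sum>i<I. c i * (g m * of_bool (m \<in> B i - A i)))"
  proof (rule sum_mono)
    fix m assume "m \<in> S"
    then obtain i where i: "i < I" "m \<in> B i - A i" "\<phi> m \<le> c i" using cover by blast
    have "g m * \<phi> m \<le> c i * (g m * of_bool (m \<in> B i - A i))"
      using i assms(4)[of m] by (simp add: mult.commute mult_right_mono)
    also have "\<dots> \<le> (\<Sum>i<I. c i * (g m * of_bool (m \<in> B i - A i)))"
      using i assms(3,4) by (intro member_le_sum) auto
    finally show "g m * \<phi> m \<le> (\<Sum>i<I. c i * (g m * of_bool (m \<in> B i - A i)))" .
  qed
  also have "\<dots> = (\<Sum>i<I. c i * (\<Sum>m\<in>S. g m * of_bool (m \<in> B i - A i)))"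
    unfolding sum_distrib_left by (rule sum.swap)
  also have "\<dots> \<le> (\<Sum>i<I. c i * (\<Sum>m\<in>B i - A i. g m))"
  proof (intro sum_mono mult_left_mono assms(3))
    fix i
    have "(\<Sum>m\<in>S. g m * of_bool (m \<in> B i - A i)) = (\<Sum>m\<in>S \<inter> (B i - A i). g m)"
      using assms(1) by (simp add: sum.inter_restrict of_bool_def if_distrib cong: if_cong)
    also have "\<dots> \<le> (\<Sum>m\<in>B i - A i. g m)" using assms by (intro sum_mono2) auto
    finally show "(\<Sum>m\<in>S. g m * of_bool (m \<in> B i - A i)) \<le> (\<Sum>m\<in>B i - A i. g m)" .
  qed
  finally show ?thesis .
qed

lemma upper_window_index:
  fixes x t :: real
  assumes "x > t"
  shows "\<exists>i. t + real i < x \<and> x \<le> t + real i + 1 \<and> real i < x - t"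
proof -
  define i where "i = nat (\<lceil>x - t\<rceil> - 1)"
  have "\<lceil>x - t\<rceil> \<ge> 1" using assms by (simp add: one_le_ceiling)
  hence "real i = of_int \<lceil>x - t\<rceil> - 1" unfolding i_def by simp
  moreover have "of_int \<lceil>x - t\<rceil> < x - t + 1" "x - t \<le> of_int \<lceil>x - t\<rceil>" by linarith+
  ultimately show ?thesis by (intro exI[of _ i]) linarith
qed

lemma sum_exp_half_le: "(\<Sum>i<I. exp (- (real i / 2))) \<le> 3"
proof -
  have "1 + 1/2 \<le> exp (1/2::real)" by (rule exp_ge_add_one_self)
  hence "exp (- (1/2)) \<le> (2/3::real)" by (simp add: exp_minus field_simps)
  hence "exp (- (real i / 2)) \<le> (2/3) ^ i" for i
    using power_mono[of "exp (- (1/2)) :: real" "2/3" i] by (simp add: exp_of_nat_mult[symmetric])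
  hence "(\<Sum>i<I. exp (- (real i / 2))) \<le> (\<Sum>i<I. (2/3) ^ i)" by (intro sum_mono)
  also have "\<dots> \<le> 3" by (subst geometric_sum) auto
  finally show ?thesis .
qed

lemma sum_quadratic_exp_le:
  assumes b: "b > 0"
  shows "\<exists>K>0. \<forall>I. (\<Sum>i<I. exp (- (b * real i)) * (real i + 2)^2) \<le> K"
proof -
  have "(\<lambda>i::nat. (real i + 2)^2 * exp (- ((b / 2) * real i))) \<longlonglongrightarrow> 0" using b by real_asymp
  hence "Bseq (\<lambda>i::nat. (real i + 2)^2 * exp (- ((b / 2) * real i)))"
    by (intro convergent_imp_Bseq) (auto simp: convergent_def)
  then obtain M where M: "M > 0" "\<And>i. norm ((real i + 2)^2 * exp (- ((b / 2) * real i))) \<le> M"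
    by (auto elim: BseqE)
  have "(\<Sum>i<I. exp (- (b * real i)) * (real i + 2)^2) \<le> M * (1 + 2 / b)" for I
  proof -
    have "(\<Sum>i<I. exp (- (b * real i)) * (real i + 2)^2) \<le> (\<Sum>i<I. M * exp (- ((b / 2) * real i)))"
    proof (rule sum_mono)
      fix i
      have "exp (- (b * real i)) * (real i + 2)^2 = ((real i + 2)^2 * exp (- ((b / 2) * real i))) * exp (- ((b / 2) * real i))"
        unfolding mult.assoc exp_add[symmetric] by (simp add: mult.commute)
      also have "\<dots> \<le> M * exp (- ((b / 2) * real i))" using M(2)[of i] by (intro mult_right_mono) auto
      finally show "exp (- (b * real i)) * (real i + 2)^2 \<le> M * exp (- ((b / 2) * real i))" .
    qed
    also have "\<dots> = M * (\<Sum>i<I. exp (- ((b / 2) * real i)))" by (simp add: sum_distrib_left)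
    also have "(\<Sum>i<I. exp (- ((b / 2) * real i))) \<le> (\<Sum>i\<in>insert 0 {1..I}. exp (- ((b / 2) * real i)))"
      by (intro sum_mono2) auto
    hence "M * (\<Sum>i<I. exp (- ((b / 2) * real i))) \<le> M * (1 + (\<Sum>i=1..I. exp (- ((b / 2) * real i))))"
      using M(1) by (intro mult_left_mono) auto
    also have "\<dots> \<le> M * (1 + 1 / (b / 2))"
      using M(1) b by (intro mult_left_mono add_left_mono sum_exp_multiples_le) auto
    finally show ?thesis by simp
  qed
  thus ?thesis using M(1) b by (intro exI[of _ "M * (1 + 2 / b)"]) (auto intro!: mult_pos_pos add_pos_pos)
qed

lemma weight_sum_minus: "s \<le> t \<Longrightarrow> (\<Sum>m\<in>coprime_upto Q t - coprime_upto Q s. kernel_weight m) = weight_sum Q t - weight_sum Q s"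
  unfolding weight_sum_def by (subst sum_diff) (auto dest: coprime_upto_mono)

text \<open>Each window of bounded length carries a share O(1 / \<open>root_scale t\<close>) of the
  total. Above t the growth exp (i / 2) loses against the tent's exp (- i); below t the window bound
  may be as crude as (i + 2)^2, since exp (- b i) absorbs any power of i.\<close>

lemma odd_tent_sum_le:
  assumes b: "b > 0"
  shows "\<exists>C>0. \<forall>\<^sub>F t in at_top. \<forall>R. (\<Sum>m\<in>coprime_upto {2} R. kernel_weight m * tent b (t - ln (real m))) \<le> C / root_scale t * weight_sum {2} t"
proof -
  obtain C1 where C1: "C1 > 0" and ev1: "\<forall>\<^sub>F t in at_top. \<forall>Q\<in>{{}, {2}}. \<forall>u. 0 \<le> u \<longrightarrow> u \<le> t / 2 \<longrightarrow>
     weight_sum Q t - weight_sum Q (t - u) \<le> C1 * (1 + u) / root_scale t * weight_sum Q t"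
    using weight_sum_window by blast
  then obtain T where T: "\<And>t Q u. t \<ge> T \<Longrightarrow> Q \<in> {{}, {2}} \<Longrightarrow> 0 \<le> u \<Longrightarrow> u \<le> t / 2 \<Longrightarrow>
     weight_sum Q t - weight_sum Q (t - u) \<le> C1 * (1 + u) / root_scale t * weight_sum Q t"
    unfolding eventually_at_top_linorder by blast
  have ev2: "\<forall>\<^sub>F t in at_top. \<forall>Q\<in>{{}, {2}}. \<forall>s\<ge>0. weight_sum Q (t + s) \<le> 2 * exp (1/2 * s) * weight_sum Q t"
    by (rule weight_sum_growth) auto
  obtain K where K: "K > 0" "\<And>I. (\<Sum>i<I. exp (- (b * real i)) * (real i + 2)^2) \<le> K"
    using sum_quadratic_exp_le[OF b] by blast
  define C where "C = 24 * C1 + (C1 + 1) * K"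
  have "\<forall>\<^sub>F t in at_top. \<forall>R. (\<Sum>m\<in>coprime_upto {2} R. kernel_weight m * tent b (t - ln (real m))) \<le> C / root_scale t * weight_sum {2} t"
    using ev2 eventually_ge_at_top[of T] eventually_ge_at_top[of 4]
  proof eventually_elim
    case (elim t)
    have rp: "root_scale t > 0" using elim by (intro root_scale_pos) auto
    let ?W = "weight_sum {2} t" and ?U = "coprime_upto {2}"
    show ?case
    proof
      fix R
      let ?\<phi> = "\<lambda>m. tent b (t - ln (real m))"
      have "(\<Sum>m\<in>?U R. kernel_weight m * ?\<phi> m) = (\<Sum>m\<in>?U R - ?U t. kernel_weight m * ?\<phi> m) + (\<Sum>m\<in>?U R \<inter> ?U t. kernel_weight m * ?\<phi> m)"
        by (subst sum.Int_Diff[of _ _ "?U t"]) auto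
      also have "(\<Sum>m\<in>?U R - ?U t. kernel_weight m * ?\<phi> m) \<le> 24 * C1 / root_scale t * ?W"
      proof -
        define I where "I = nat \<lceil>R - t\<rceil>"
        have "(\<Sum>m\<in>?U R - ?U t. kernel_weight m * ?\<phi> m) \<le> (\<Sum>i<I. exp (- real i) * (\<Sum>m\<in>?U (t + real i + 1) - ?U (t + real i). kernel_weight m))"
        proof (rule sum_over_windows_le)
          fix m assume m: "m \<in> ?U R - ?U t"
          hence m': "ln (real m) > t" "ln (real m) \<le> R" by (auto simp: coprime_upto_def)
          then obtain i where i: "t + real i < ln (real m)" "ln (real m) \<le> t + real i + 1" "real i < ln (real m) - t"
            using upper_window_index by blast
          have "i < I" unfolding I_def using i m' by linarith
          moreover have "m \<in> ?U (t + real i + 1) - ?U (t + real i)" using i m by (auto simp: coprime_upto_def)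
          moreover have "?\<phi> m \<le> exp (- real i)" using i m' by (auto simp: tent_def)
          ultimately show "\<exists>i<I. m \<in> ?U (t + real i + 1) - ?U (t + real i) \<and> ?\<phi> m \<le> exp (- real i)" by blast
        qed auto
        also have "\<dots> \<le> (\<Sum>i<I. (8 * C1 / root_scale t * ?W) * exp (- (real i / 2)))"
        proof (rule sum_mono)
          fix i
          let ?v = "t + real i + 1"
          have "(\<Sum>m\<in>?U ?v - ?U (t + real i). kernel_weight m) = weight_sum {2} ?v - weight_sum {2} (?v - 1)"
            by (subst weight_sum_minus) auto
          also have "\<dots> \<le> C1 * (1 + 1) / root_scale ?v * weight_sum {2} ?v"
            using elim by (intro T) auto
          also have "\<dots> \<le> (C1 * 2 / root_scale t) * (2 * exp (1/2 * (real i + 1)) * ?W)"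
          proof (intro mult_mono)
            have "root_scale t \<le> root_scale ?v" using elim by (intro root_scale_mono) auto
            thus "C1 * (1 + 1) / root_scale ?v \<le> C1 * 2 / root_scale t" using rp C1 by (intro frac_le) auto
            have "weight_sum {2} (t + (real i + 1)) \<le> 2 * exp (1/2 * (real i + 1)) * ?W"
              using elim(1)[rule_format, of "{2}" "real i + 1"] by simp
            thus "weight_sum {2} ?v \<le> 2 * exp (1/2 * (real i + 1)) * ?W" by (simp add: add_ac)
          qed (use C1 rp in auto)
          also have "\<dots> = (4 * C1 / root_scale t * ?W) * exp (1/2 * (real i + 1))" by simp
          also have "\<dots> \<le> (4 * C1 / root_scale t * ?W) * (2 * exp (real i / 2))"
          proof (intro mult_left_mono)
            have "exp (1/2 * (real i + 1)) = exp (1/2) * exp (real i / 2)" unfolding exp_add[symmetric] by (simp add: field_simps)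
            also have "exp (1/2) \<le> (2::real)" using exp_bound[of "1/2"] by (simp add: power2_eq_square)
            finally show "exp (1/2 * (real i + 1)) \<le> 2 * exp (real i / 2)" by simp
          qed (use C1 rp in auto)
          finally have "exp (- real i) * (\<Sum>m\<in>?U ?v - ?U (t + real i). kernel_weight m) \<le> exp (- real i) * ((4 * C1 / root_scale t * ?W) * (2 * exp (real i / 2)))"
            by (intro mult_left_mono) auto
          also have "\<dots> = (8 * C1 / root_scale t * ?W) * (exp (- real i) * exp (real i / 2))" by simp
          also have "exp (- real i) * exp (real i / 2) = exp (- (real i / 2))" unfolding exp_add[symmetric] by simp
          finally show "exp (- real i) * (\<Sum>m\<in>?U ?v - ?U (t + real i). kernel_weight m) \<le> (8 * C1 / root_scale t * ?W) * exp (- (real i / 2))" .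
        qed
        also have "\<dots> = (8 * C1 / root_scale t * ?W) * (\<Sum>i<I. exp (- (real i / 2)))" by (simp add: sum_distrib_left)
        also have "\<dots> \<le> (8 * C1 / root_scale t * ?W) * 3" using C1 rp by (intro mult_left_mono sum_exp_half_le) auto
        finally show ?thesis by (simp add: mult_ac)
      qed
      also have "(\<Sum>m\<in>?U R \<inter> ?U t. kernel_weight m * ?\<phi> m) \<le> (C1 + 1) * K / root_scale t * ?W"
      proof -
        define I where "I = nat \<lfloor>t\<rfloor> + 1"
        have "(\<Sum>m\<in>?U R \<inter> ?U t. kernel_weight m * ?\<phi> m) \<le> (\<Sum>i<I. exp (- (b * real i)) * (\<Sum>m\<in>?U (t - real i) - ?U (t - real i - 1). kernel_weight m))"
        proof (rule sum_over_windows_le)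
          fix m assume m: "m \<in> ?U R \<inter> ?U t"
          hence m': "ln (real m) \<le> t" "m > 0" by (auto simp: coprime_upto_def)
          have lm: "ln (real m) \<ge> 0" using m' by simp
          define i where "i = nat \<lfloor>t - ln (real m)\<rfloor>"
          have i: "real i \<le> t - ln (real m)" "t - ln (real m) < real i + 1" unfolding i_def using m' by linarith+
          have "i < I" unfolding I_def using i lm by linarith
          moreover have "m \<in> ?U (t - real i) - ?U (t - real i - 1)" using i m by (auto simp: coprime_upto_def)
          moreover have "?\<phi> m \<le> exp (- (b * real i))" using i m' b by (auto simp: tent_def)
          ultimately show "\<exists>i<I. m \<in> ?U (t - real i) - ?U (t - real i - 1) \<and> ?\<phi> m \<le> exp (- (b * real i))" by blast
        qed auto
        also have "\<dots> \<le> (\<Sum>i<I. ((C1 + 1) / root_scale t * ?W) * (exp (- (b * real i)) * (real i + 2)^2))"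
        proof (rule sum_mono)
          fix i
          have "(\<Sum>m\<in>?U (t - real i) - ?U (t - real i - 1). kernel_weight m) = weight_sum {2} (t - real i) - weight_sum {2} (t - real i - 1)"
            by (subst weight_sum_minus) auto
          also have "\<dots> \<le> weight_sum {2} t - weight_sum {2} (t - (real i + 1))"
          proof (rule diff_mono)
            show "weight_sum {2} (t - real i) \<le> weight_sum {2} t" by (intro weight_sum_mono) auto
          qed (simp add: algebra_simps)
          also have "\<dots> \<le> ((C1 + 1) / root_scale t * ?W) * (real i + 2)^2"
          proof (cases "real i + 1 \<le> t / 2")
            case True
            have "weight_sum {2} t - weight_sum {2} (t - (real i + 1)) \<le> C1 * (1 + (real i + 1)) / root_scale t * ?W"
              using elim True by (intro T) auto
            also have "\<dots> = (C1 / root_scale t * ?W) * (real i + 2)" by (simp add: algebra_simps)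
            also have "\<dots> \<le> ((C1 + 1) / root_scale t * ?W) * (real i + 2)^2"
            proof (intro mult_mono divide_right_mono)
              have "(real i + 2) * 1 \<le> (real i + 2) * (real i + 2)" by (intro mult_left_mono) auto
              thus "real i + 2 \<le> (real i + 2)^2" by (simp add: power2_eq_square)
            qed (use C1 rp in auto)
            finally show ?thesis .
          next
            \<comment> \<open>Windows reaching below t / 2 get the trivial bound: here (i + 2)^2
              \<ge> (t / 2)^2 \<ge> t \<ge> \<open>root_scale t\<close>, as t \<ge> 4.\<close>
            case False
            have "weight_sum {2} t - weight_sum {2} (t - (real i + 1)) \<le> 1 * ?W" by simp
            also have "1 \<le> (1 / root_scale t) * (real i + 2)^2"
            proof -
              have "(t/2)^2 \<le> (real i + 2)^2" using False elim by (intro power_mono) auto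
              moreover have "t * 4 \<le> t * t" using elim by (intro mult_left_mono) auto
              ultimately have "t \<le> (real i + 2)^2" by (simp add: power2_eq_square)
              moreover have "root_scale t \<le> t" using elim by (intro root_scale_le) auto
              ultimately show ?thesis using rp by simp
            qed
            also have "(1 / root_scale t) * (real i + 2)^2 \<le> ((C1 + 1) / root_scale t) * (real i + 2)^2"
              using C1 rp by (intro mult_right_mono divide_right_mono) auto
            finally show ?thesis by (simp add: mult_ac mult_right_mono)
          qed
          finally have "exp (- (b * real i)) * (\<Sum>m\<in>?U (t - real i) - ?U (t - real i - 1). kernel_weight m) \<le> exp (- (b * real i)) * (((C1 + 1) / root_scale t * ?W) * (real i + 2)^2)"
            by (intro mult_left_mono) auto
          thus "exp (- (b * real i)) * (\<Sum>m\<in>?U (t - real i) - ?U (t - real i - 1). kernel_weight m) \<le> ((C1 + 1) / root_scale t * ?W) * (exp (- (b * real i)) * (real i + 2)^2)"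
            by (simp only: mult_ac)
        qed
        also have "\<dots> = ((C1 + 1) / root_scale t * ?W) * (\<Sum>i<I. exp (- (b * real i)) * (real i + 2)^2)" by (simp add: sum_distrib_left)
        also have "\<dots> \<le> ((C1 + 1) / root_scale t * ?W) * K" using C1 rp by (intro mult_left_mono K) auto
        finally show ?thesis by (simp add: mult_ac)
      qed
      finally have "(\<Sum>m\<in>?U R. kernel_weight m * ?\<phi> m) \<le> 24 * C1 / root_scale t * ?W + (C1 + 1) * K / root_scale t * ?W" by simp
      also have "\<dots> = C / root_scale t * ?W" by (simp add: C_def add_divide_distrib distrib_right)
      finally show "(\<Sum>m\<in>?U R. kernel_weight m * ?\<phi> m) \<le> C / root_scale t * ?W" .
    qed
  qed
  moreover have "C > 0" using C1 K by (auto simp: C_def intro!: add_pos_pos mult_pos_pos)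
  ultimately show ?thesis by blast
qed

text \<open>Geometric sums of the two branches of the tent: the periodization differs from the one-sided sum
  only by boundary terms at both ends.\<close>

lemma tent_lattice_sum:
  assumes b: "b > 0" and s: "s \<ge> 0" and n: "nat \<lfloor>s / ln 2\<rfloor> \<le> n"
  shows "(\<Sum>j\<le>n. tent b (s - real j * ln 2)) =
         periodized_tent b s - 2 powr (-b) / (1 - 2 powr (-b)) * exp (- (b * s)) - exp (s - real n * ln 2)"
  using n
proof (induction n rule: dec_induct)
  case base
  define q where "q = (2::real) powr (-b)"
  have q: "q < 1" "q > 0" using two_powr_minus_less_1[OF b] by (auto simp: q_def)
  define i where "i = nat \<lfloor>s / ln 2\<rfloor>"
  have ri: "real i = of_int \<lfloor>s / ln 2\<rfloor>" unfolding i_def using s by simp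
  have il: "real j * ln 2 \<le> s" if "j \<le> i" for j
  proof -
    have "real j \<le> s / ln 2" using that ri of_int_floor_le[of "s / ln 2"] by linarith
    thus ?thesis by (simp add: pos_le_divide_eq)
  qed
  have "(\<Sum>j\<le>i. tent b (s - real j * ln 2)) = (\<Sum>j\<le>i. exp (- (b * (s - real j * ln 2))))"
    using il by (intro sum.cong) (auto simp: tent_def)
  also have "\<dots> = (exp (- (b * (s - real i * ln 2))) - q * exp (- (b * s))) / (1 - q)"
  proof (induction i)
    case 0
    show ?case using q by (simp add: field_simps)
  next
    case (Suc i)
    have "exp (- (b * (s - real i * ln 2))) = q * exp (- (b * (s - real (Suc i) * ln 2)))"
      unfolding q_def powr_def exp_add[symmetric] by (simp add: algebra_simps exp_add[symmetric])
    thus ?case using q Suc by (simp add: divide_simps) (simp add: algebra_simps)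
  qed
  also have "\<dots> = exp (- (b * (s - real i * ln 2))) / (1 - q) - q / (1 - q) * exp (- (b * s))"
    by (simp add: diff_divide_distrib)
  also have "exp (- (b * (s - real i * ln 2))) / (1 - q) = periodized_tent b s - exp (s - real i * ln 2)"
    by (simp add: periodized_tent_def periodic_profile_def ri q_def mult.commute)
  finally show ?case unfolding i_def q_def by simp
next
  case (step n)
  have "\<not> real (Suc n) * ln 2 \<le> s"
  proof
    assume "real (Suc n) * ln 2 \<le> s"
    hence "real (Suc n) \<le> s / ln 2" by (simp add: pos_le_divide_eq)
    hence "int (Suc n) \<le> \<lfloor>s / ln 2\<rfloor>" by (simp add: le_floor_iff)
    thus False using step by linarith
  qed
  hence "tent b (s - real (Suc n) * ln 2) = exp (s - real (Suc n) * ln 2)" by (simp add: tent_def)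
  moreover have "exp (s - real n * ln 2) = 2 * exp (s - real (Suc n) * ln 2)"
  proof -
    have "2 * exp (s - real (Suc n) * ln 2) = exp (ln 2 + (s - real (Suc n) * ln 2))" by (simp only: exp_add) simp
    thus ?thesis by (simp add: algebra_simps)
  qed
  ultimately show ?case using step.IH by simp
qed

text \<open>Write n = 2^j m with m odd. The weight factor is 1 for j = 0 and 1/3 for j \<ge> 1;
  splitting 1 = 2/3 + 1/3 gives all j the same factor and exposes a lattice sum. The leftover 2/3 is
  negligible by \<open>odd_tent_sum_le\<close>.\<close>

lemma tent_sum_split:
  assumes R: "R \<ge> 0"
  shows "tent_sum b R t = (\<Sum>m\<in>coprime_upto {2} R. kernel_weight m * ((2/3) * tent b (t - ln (real m)) +
     (1/3) * (\<Sum>j\<le>nat \<lfloor>(R - ln (real m)) / ln 2\<rfloor>. tent b (t - ln (real m) - real j * ln 2))))"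
proof -
  define J where "J = nat \<lfloor>R / ln 2\<rfloor>"
  have J: "R < real (Suc J) * ln (real 2)"
  proof -
    have "R / ln 2 < real (Suc J)" using R unfolding J_def by (simp add: floor_less_iff) linarith
    thus ?thesis by (simp add: pos_divide_less_eq)
  qed
  let ?U = "coprime_upto {2}" and ?s = "\<lambda>m. t - ln (real m)"
  have "tent_sum b R t = (\<Sum>m\<in>?U R. kernel_weight m * tent b (?s m)) +
     (\<Sum>j=1..J. \<Sum>m\<in>?U (R - real j * ln (real 2)). kernel_weight (2 ^ j * m) * tent b (t - ln (real (2 ^ j * m))))"
    unfolding tent_sum_def by (rule sum_coprime_upto_split') (use J in auto)
  also have "(\<Sum>j=1..J. \<Sum>m\<in>?U (R - real j * ln (real 2)). kernel_weight (2 ^ j * m) * tent b (t - ln (real (2 ^ j * m)))) =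
     (\<Sum>j=1..J. \<Sum>m | m \<in> ?U R \<and> ln (real m) \<le> R - real j * ln 2. kernel_weight m * ((1/3) * tent b (?s m - real j * ln 2)))"
  proof (intro sum.cong refl)
    fix j assume j: "j \<in> {1..J}"
    have "real j * ln 2 \<ge> 0" by simp
    thus "?U (R - real j * ln (real 2)) = {m \<in> ?U R. ln (real m) \<le> R - real j * ln 2}"
      using coprime_upto_restrict by simp
    fix m assume "m \<in> {m \<in> ?U R. ln (real m) \<le> R - real j * ln 2}"
    hence m: "m > 0" "\<not> 2 dvd m" by (auto simp: coprime_upto_def)
    have "kernel_weight (2 ^ j * m) = (1/3) * kernel_weight m"
      using kernel_weight_power_mult[OF two_is_prime_nat m(2,1), of j] j by simp
    moreover have "ln (real (2 ^ j * m)) = real j * ln 2 + ln (real m)" using m by (simp add: ln_mult ln_realpow)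
    ultimately show "kernel_weight (2 ^ j * m) * tent b (t - ln (real (2 ^ j * m))) = kernel_weight m * ((1/3) * tent b (?s m - real j * ln 2))"
      by (simp add: algebra_simps)
  qed
  also have "\<dots> = (\<Sum>m\<in>?U R. \<Sum>j | j \<in> {1..J} \<and> ln (real m) \<le> R - real j * ln 2. kernel_weight m * ((1/3) * tent b (?s m - real j * ln 2)))"
    by (rule sum.swap_restrict) auto
  also have "\<dots> = (\<Sum>m\<in>?U R. kernel_weight m * ((1/3) * ((\<Sum>j\<le>nat \<lfloor>(R - ln (real m)) / ln 2\<rfloor>. tent b (?s m - real j * ln 2)) - tent b (?s m))))"
  proof (rule sum.cong)
    fix m assume "m \<in> ?U R"
    hence m: "m > 0" "ln (real m) \<le> R" by (auto simp: coprime_upto_def)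
    have lm: "ln (real m) \<ge> 0" using m by simp
    define n where "n = nat \<lfloor>(R - ln (real m)) / ln 2\<rfloor>"
    have iff: "ln (real m) \<le> R - real j * ln 2 \<longleftrightarrow> j \<le> n" for j
    proof -
      have "ln (real m) \<le> R - real j * ln 2 \<longleftrightarrow> real j \<le> (R - ln (real m)) / ln 2"
        by (auto simp: pos_le_divide_eq)
      also have "\<dots> \<longleftrightarrow> j \<le> n" unfolding n_def using m by (auto simp: le_nat_iff le_floor_iff)
      finally show ?thesis .
    qed
    have nJ: "n \<le> J" unfolding n_def J_def using lm by (intro nat_mono floor_mono divide_right_mono) auto
    have "{j. j \<in> {1..J} \<and> ln (real m) \<le> R - real j * ln 2} = {j. j \<in> {1..J} \<and> j \<le> n}" by (simp only: iff)
    also have "\<dots> = {1..n}" using nJ by auto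
    finally have "(\<Sum>j | j \<in> {1..J} \<and> ln (real m) \<le> R - real j * ln 2. kernel_weight m * ((1/3) * tent b (?s m - real j * ln 2))) =
        kernel_weight m * ((1/3) * (\<Sum>j=1..n. tent b (?s m - real j * ln 2)))"
      by (simp only: sum_distrib_left)
    moreover have "{..n} = insert 0 {1..n}" by auto
    hence "(\<Sum>j\<le>n. tent b (?s m - real j * ln 2)) = tent b (?s m) + (\<Sum>j=1..n. tent b (?s m - real j * ln 2))" by simp
    ultimately show "(\<Sum>j | j \<in> {1..J} \<and> ln (real m) \<le> R - real j * ln 2. kernel_weight m * ((1/3) * tent b (?s m - real j * ln 2))) =
       kernel_weight m * ((1/3) * ((\<Sum>j\<le>nat \<lfloor>(R - ln (real m)) / ln 2\<rfloor>. tent b (?s m - real j * ln 2)) - tent b (?s m)))"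
      unfolding n_def by simp
  qed simp
  finally show ?thesis by (simp add: sum.distrib[symmetric] algebra_simps)
qed

text \<open>For m \<le> exp t the lattice sum is the periodization up to a multiple of the tent and
  a truncation term below 2 exp (t - R), where exp (t - R) \<le> 1 / t because R \<ge> t + ln t. For
  larger m all points lie on the rising branch and the lattice sum is at most twice the tent, hence
  again covered by \<open>odd_tent_sum_le\<close>.\<close>

lemma tent_sum_asymp:
  assumes b: "b > 0"
  shows "\<exists>C>0. \<forall>\<^sub>F t in at_top. \<forall>R N. R \<ge> t + ln t \<longrightarrow> t^2 \<le> real N \<longrightarrow> real N \<le> t^4 \<longrightarrow>
     \<bar>tent_sum b R t - fejer_mean_value b N / 3 * weight_sum {2} t\<bar> \<le> C * ln t / root_scale t * weight_sum {2} t"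
proof -
  obtain C1 where C1: "C1 > 0" and ev1: "\<forall>\<^sub>F t in at_top. \<forall>N. t^2 \<le> real N \<longrightarrow> real N \<le> t^4 \<longrightarrow>
     \<bar>(\<Sum>m\<in>coprime_upto {2} t. kernel_weight m * periodized_tent b (t - ln (real m))) - fejer_mean_value b N * weight_sum {2} t\<bar>
     \<le> C1 * ln t / root_scale t * weight_sum {2} t"
    using periodized_sum_asymp[OF b] by blast
  obtain C2 where C2: "C2 > 0" and ev2: "\<forall>\<^sub>F t in at_top. \<forall>R. (\<Sum>m\<in>coprime_upto {2} R. kernel_weight m * tent b (t - ln (real m))) \<le> C2 / root_scale t * weight_sum {2} t"
    using odd_tent_sum_le[OF b] by blast
  define q where "q = (2::real) powr (-b)"
  have q: "q < 1" "q > 0" using two_powr_minus_less_1[OF b] by (auto simp: q_def)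
  define D where "D = 2 + q / (1 - q)"
  have D: "D > 0" "q / (1 - q) > 0" unfolding D_def using q by (auto intro!: add_pos_pos)
  define C where "C = C1 + D * C2 + 1"
  have "\<forall>\<^sub>F t::real in at_top. ln t \<ge> 1" by real_asymp
  with ev1 ev2 have "\<forall>\<^sub>F t in at_top. \<forall>R N. R \<ge> t + ln t \<longrightarrow> t^2 \<le> real N \<longrightarrow> real N \<le> t^4 \<longrightarrow>
     \<bar>tent_sum b R t - fejer_mean_value b N / 3 * weight_sum {2} t\<bar> \<le> C * ln t / root_scale t * weight_sum {2} t"
    using eventually_gt_at_top[of 1]
  proof eventually_elim
    case (elim t)
    have rp: "root_scale t > 0" using elim by (intro root_scale_pos) auto
    show ?case
    proof (intro allI impI)
      fix R :: real and N :: nat assume R: "R \<ge> t + ln t" and N: "t^2 \<le> real N" "real N \<le> t^4"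
      let ?U = "coprime_upto {2}" and ?s = "\<lambda>m. t - ln (real m)" and ?W = "weight_sum {2} t"
      have R0: "R \<ge> 0" "R \<ge> t" using R elim by auto
      have sub: "?U t \<subseteq> ?U R" using R0 by (intro coprime_upto_mono)
      define X where "X m = (2/3) * tent b (?s m) + (1/3) * (\<Sum>j\<le>nat \<lfloor>(R - ln (real m)) / ln 2\<rfloor>. tent b (?s m - real j * ln 2))" for m
      define Y where "Y m = (if m \<in> ?U t then (1/3) * periodized_tent b (?s m) else 0)" for m
      define E where "E m = (if m \<in> ?U t then exp (t - R) else 0)" for m
      have pw: "\<bar>X m - Y m\<bar> \<le> D * tent b (?s m) + E m" if m: "m \<in> ?U R" for m
      proof -
        define n where "n = nat \<lfloor>(R - ln (real m)) / ln 2\<rfloor>"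
        have m': "m > 0" "ln (real m) \<le> R" using m by (auto simp: coprime_upto_def)
        show ?thesis
        proof (cases "m \<in> ?U t")
          case True
          hence s0: "?s m \<ge> 0" by (auto simp: coprime_upto_def)
          have "nat \<lfloor>?s m / ln 2\<rfloor> \<le> n" unfolding n_def using R0 by (intro nat_mono floor_mono divide_right_mono) auto
          from tent_lattice_sum[OF b s0 this]
          have eq: "(\<Sum>j\<le>n. tent b (?s m - real j * ln 2)) = periodized_tent b (?s m) - q / (1 - q) * tent b (?s m) - exp (?s m - real n * ln 2)"
            using s0 by (simp add: q_def tent_def)
          have ex: "exp (?s m - real n * ln 2) \<le> 2 * exp (t - R)"
          proof -
            have "(R - ln (real m)) / ln 2 < real n + 1" unfolding n_def using m' by linarith
            hence "R - ln (real m) < (real n + 1) * ln 2" by (simp add: pos_divide_less_eq)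
            hence "?s m - real n * ln 2 \<le> ln 2 + (t - R)" by (simp add: algebra_simps)
            hence "exp (?s m - real n * ln 2) \<le> exp (ln 2 + (t - R))" by (simp only: exp_le_cancel_iff)
            thus ?thesis by (simp add: exp_add)
          qed
          have "X m - Y m = (2/3) * tent b (?s m) - (1/3) * (q / (1 - q) * tent b (?s m)) - (1/3) * exp (?s m - real n * ln 2)"
            unfolding X_def Y_def n_def[symmetric] eq using True by (simp add: algebra_simps)
          hence "\<bar>X m - Y m\<bar> \<le> (2/3) * tent b (?s m) + (1/3) * (q / (1 - q) * tent b (?s m)) + (1/3) * exp (?s m - real n * ln 2)"
          proof -
            have "tent b (?s m) \<ge> 0" "q / (1 - q) * tent b (?s m) \<ge> 0" "exp (?s m - real n * ln 2) \<ge> 0" using D(2) by (auto intro!: mult_nonneg_nonneg simp del: times_divide_eq_left)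
            thus ?thesis using \<open>X m - Y m = _\<close> by linarith
          qed
          also have "\<dots> \<le> 2 * tent b (?s m) + q / (1 - q) * tent b (?s m) + exp (t - R)"
          proof -
            have "tent b (?s m) \<ge> 0" "q / (1 - q) * tent b (?s m) \<ge> 0" "exp (t - R) \<ge> 0" using D(2) by (auto intro!: mult_nonneg_nonneg simp del: times_divide_eq_left)
            moreover have "(2/3) * a + (1/3) * c + (1/3) * e \<le> 2 * a + c + f" if "a \<ge> 0" "c \<ge> 0" "f \<ge> 0" "e \<le> 2 * f" for a c e f :: real
              using that by linarith
            ultimately show ?thesis using ex by blast
          qed
          finally show ?thesis using True by (simp add: D_def E_def distrib_right)
        next
          case False
          hence s0: "?s m < 0" using m by (auto simp: coprime_upto_def)
          have "(\<Sum>j\<le>n. tent b (?s m - real j * ln 2)) = (\<Sum>j\<le>n. tent b (?s m) * (1/2)^j)"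
          proof (intro sum.cong refl)
            fix j
            have "real j * ln 2 \<ge> 0" by simp
            hence "?s m - real j * ln 2 < 0" using s0 by linarith
            hence "tent b (?s m - real j * ln 2) = exp (?s m) * exp (- (real j * ln 2))"
              by (simp add: tent_def exp_add[symmetric])
            also have "exp (- (real j * ln 2)) = inverse (exp (ln 2) ^ j)" by (simp only: exp_minus exp_of_nat_mult)
            also have "\<dots> = (1/2)^j" by (simp add: power_one_over inverse_eq_divide)
            finally show "tent b (?s m - real j * ln 2) = tent b (?s m) * (1/2)^j" using s0 by (simp add: tent_def)
          qed
          also have "\<dots> = tent b (?s m) * (\<Sum>j<Suc n. (1/2)^j)" by (simp add: sum_distrib_left lessThan_Suc_atMost)
          also have "\<dots> \<le> tent b (?s m) * 2" by (intro mult_left_mono sum_half_powers_le) auto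
          finally have "X m \<le> 2 * tent b (?s m)" unfolding X_def n_def[symmetric] using tent_nonneg[of b "?s m"] by linarith
          moreover have "X m \<ge> 0" unfolding X_def by (intro add_nonneg_nonneg mult_nonneg_nonneg sum_nonneg) auto
          moreover have "2 * tent b (?s m) \<le> D * tent b (?s m)" unfolding D_def using D(2) by (intro mult_right_mono) auto
          ultimately show ?thesis using False by (simp add: Y_def E_def)
        qed
      qed
      have "tent_sum b R t = (\<Sum>m\<in>?U R. kernel_weight m * X m)" unfolding X_def by (rule tent_sum_split[OF R0(1)])
      moreover have "(\<Sum>m\<in>?U R. kernel_weight m * Y m) = (1/3) * (\<Sum>m\<in>?U t. kernel_weight m * periodized_tent b (?s m))"
      proof -
        have "(\<Sum>m\<in>?U R. kernel_weight m * Y m) = (\<Sum>m\<in>?U t. kernel_weight m * Y m)"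
          using sub by (intro sum.mono_neutral_right) (auto simp: Y_def)
        also have "\<dots> = (\<Sum>m\<in>?U t. kernel_weight m * ((1/3) * periodized_tent b (?s m)))"
          by (intro sum.cong refl) (simp add: Y_def)
        finally show ?thesis by (simp add: sum_distrib_left mult_ac)
      qed
      ultimately have "\<bar>tent_sum b R t - (1/3) * (\<Sum>m\<in>?U t. kernel_weight m * periodized_tent b (?s m))\<bar> = \<bar>\<Sum>m\<in>?U R. kernel_weight m * (X m - Y m)\<bar>"
        by (simp add: right_diff_distrib sum_subtractf)
      also have "\<dots> \<le> (\<Sum>m\<in>?U R. \<bar>kernel_weight m * (X m - Y m)\<bar>)" by (rule sum_abs)
      also have "\<dots> \<le> (\<Sum>m\<in>?U R. kernel_weight m * (D * tent b (?s m) + E m))"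
        unfolding abs_mult by (intro sum_mono mult_mono pw) auto
      also have "\<dots> = D * (\<Sum>m\<in>?U R. kernel_weight m * tent b (?s m)) + (\<Sum>m\<in>?U R. kernel_weight m * E m)"
        by (simp add: distrib_left sum.distrib sum_distrib_left mult_ac)
      also have "(\<Sum>m\<in>?U R. kernel_weight m * E m) = exp (t - R) * ?W"
      proof -
        have "(\<Sum>m\<in>?U R. kernel_weight m * E m) = (\<Sum>m\<in>?U t. kernel_weight m * E m)"
          using sub by (intro sum.mono_neutral_right) (auto simp: E_def)
        also have "\<dots> = (\<Sum>m\<in>?U t. kernel_weight m * exp (t - R))"
          by (intro sum.cong refl) (simp add: E_def)
        finally show ?thesis by (simp add: weight_sum_def sum_distrib_left mult_ac)
      qed
      also have "D * (\<Sum>m\<in>?U R. kernel_weight m * tent b (?s m)) + exp (t - R) * ?W \<le> D * (C2 / root_scale t * ?W) + (1 / root_scale t) * ?W"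
      proof (intro add_mono mult_left_mono mult_right_mono)
        show "(\<Sum>m\<in>?U R. kernel_weight m * tent b (?s m)) \<le> C2 / root_scale t * ?W" using elim by blast
        have "exp (t - R) \<le> exp (- ln t)" using R by simp
        also have "\<dots> = 1 / t" using elim by (simp add: exp_minus divide_inverse)
        also have "\<dots> \<le> 1 / root_scale t" using elim rp root_scale_le[of t] by (intro divide_left_mono) auto
        finally show "exp (t - R) \<le> 1 / root_scale t" .
      qed (use D in auto)
      also have "\<dots> = (D * C2 + 1) * 1 / root_scale t * ?W" by (simp add: add_divide_distrib distrib_right)
      also have "\<dots> \<le> (D * C2 + 1) * ln t / root_scale t * ?W"
        using elim D C2 rp by (intro mult_right_mono divide_right_mono mult_left_mono) auto
      finally have 1: "\<bar>tent_sum b R t - (1/3) * (\<Sum>m\<in>?U t. kernel_weight m * periodized_tent b (?s m))\<bar> \<le> (D * C2 + 1) * ln t / root_scale t * ?W" .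
      have 2: "\<bar>(\<Sum>m\<in>?U t. kernel_weight m * periodized_tent b (?s m)) - fejer_mean_value b N * ?W\<bar> \<le> C1 * ln t / root_scale t * ?W"
        using elim N by blast
      have 3: "C * ln t / root_scale t * ?W = C1 * ln t / root_scale t * ?W + (D * C2 + 1) * ln t / root_scale t * ?W"
        by (simp add: C_def distrib_right add_divide_distrib)
      define S where "S = (\<Sum>m\<in>?U t. kernel_weight m * periodized_tent b (?s m))"
      have "\<bar>tent_sum b R t - fejer_mean_value b N / 3 * ?W\<bar> \<le> \<bar>tent_sum b R t - (1/3) * S\<bar> + (1/3) * \<bar>S - fejer_mean_value b N * ?W\<bar>"
        by (simp add: abs_if field_simps)
      thus "\<bar>tent_sum b R t - fejer_mean_value b N / 3 * ?W\<bar> \<le> C * ln t / root_scale t * ?W"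
        using 1 2 unfolding 3 S_def[symmetric] by linarith
    qed
  qed
  moreover have "C > 0" using C1 C2 D by (auto simp: C_def intro!: add_pos_pos mult_pos_pos)
  ultimately show ?thesis by blast
qed

section \<open>Squarefree integers coprime to a modulus\<close>

text \<open>P sieves by squares and Q by the primes themselves. If P is the set of all primes up to
  some bound \<ge> X, this is the set of squarefree l \<le> X prime to Q; keeping P and Q as finite
  parameters permits induction on both.\<close>

definition sieve_set :: "nat set \<Rightarrow> nat set \<Rightarrow> real \<Rightarrow> nat set" where
  "sieve_set P Q X = {l. 1 \<le> l \<and> real l \<le> X \<and> (\<forall>p\<in>P. \<not> p^2 dvd l) \<and> (\<forall>q\<in>Q. \<not> q dvd l)}"

definition sieve_density :: "nat set \<Rightarrow> real" where
  "sieve_density P = (\<Prod>p\<in>P. 1 - 1 / (real p)^2)"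

lemma finite_sieve_set [simp, intro]: "finite (sieve_set P Q X)"
proof (rule finite_subset)
  show "sieve_set P Q X \<subseteq> {..nat \<lfloor>X\<rfloor>}" by (auto simp: sieve_set_def le_nat_floor)
qed auto

lemma prime_square_dvd_mult_other:
  fixes p q l :: nat
  assumes "prime p" "prime q" "p \<noteq> q"
  shows "q^2 dvd p^j * l \<longleftrightarrow> q^2 dvd l"
proof -
  have "coprime q p" using assms by (simp add: primes_coprime)
  hence "coprime (q^2) (p^j)" by simp
  thus ?thesis by (simp add: coprime_dvd_mult_right_iff)
qed

lemma prime_dvd_mult_other:
  fixes p q l :: nat
  assumes "prime p" "prime q" "p \<noteq> q"
  shows "q dvd p * l \<longleftrightarrow> q dvd l"
  using assms by (simp add: prime_dvd_mult_iff primes_dvd_imp_eq) (metis primes_dvd_imp_eq)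

lemma sieve_set_insert_square:
  assumes p: "prime p" "p \<notin> P" and P: "\<And>q. q \<in> P \<Longrightarrow> prime q"
  shows "real (card (sieve_set (insert p P) {} X)) = real (card (sieve_set P {} X)) - real (card (sieve_set P {} (X / (real p)^2)))"
proof -
  let ?A = "sieve_set P {} X" and ?B = "sieve_set (insert p P) {} X" and ?C = "sieve_set P {} (X / (real p)^2)"
  have p0: "real p > 0" using p prime_gt_0_nat by simp
  have "?A - ?B = (\<lambda>l. p^2 * l) ` ?C"
  proof (intro equalityI subsetI)
    fix l assume l: "l \<in> ?A - ?B"
    hence "p^2 dvd l" by (auto simp: sieve_set_def)
    then obtain k where k: "l = p^2 * k" by auto
    have "1 \<le> k" using l k by (cases k) (auto simp: sieve_set_def)
    moreover have "real k \<le> X / (real p)^2" using l k p0 by (auto simp: sieve_set_def field_simps)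
    moreover have "\<not> q^2 dvd k" if "q \<in> P" for q
      using l k that by (auto simp: sieve_set_def)
    ultimately have "k \<in> ?C" by (auto simp: sieve_set_def)
    thus "l \<in> (\<lambda>l. p^2 * l) ` ?C" using k by blast
  next
    fix l assume "l \<in> (\<lambda>l. p^2 * l) ` ?C"
    then obtain k where k: "k \<in> ?C" "l = p^2 * k" by blast
    have "\<not> q^2 dvd l" if "q \<in> P" for q
    proof -
      have "q^2 dvd p^2 * k \<longleftrightarrow> q^2 dvd k" using p P[OF that] that by (intro prime_square_dvd_mult_other) auto
      thus ?thesis using k that by (auto simp: sieve_set_def)
    qed
    moreover have "1 \<le> l" using k p0 by (auto simp: sieve_set_def)
    moreover have "real l \<le> X" using k p0 by (auto simp: sieve_set_def field_simps)
    ultimately show "l \<in> ?A - ?B" using k by (auto simp: sieve_set_def)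
  qed
  moreover have "inj_on (\<lambda>l. p^2 * l) ?C" using p0 by (auto simp: inj_on_def)
  ultimately have "card (?A - ?B) = card ?C" by (simp add: card_image)
  moreover have sub: "?B \<subseteq> ?A" by (auto simp: sieve_set_def)
  hence "card (?A - ?B) = card ?A - card ?B" by (intro card_Diff_subset) auto
  moreover have "card ?B \<le> card ?A" using sub by (intro card_mono) auto
  ultimately show ?thesis by linarith
qed

text \<open>A removed l contains p exactly once, because p^2 is sieved out, so l / p avoids p
  altogether. Hence the set for \<open>insert p Q\<close> occurs on both sides, at X and at X /
  p.\<close>

lemma sieve_set_insert_prime:
  assumes p: "prime p" "p \<in> P" "p \<notin> Q" and P: "\<And>q. q \<in> P \<Longrightarrow> prime q" and Q: "Q \<subseteq> P"
  shows "real (card (sieve_set P (insert p Q) X)) = real (card (sieve_set P Q X)) - real (card (sieve_set P (insert p Q) (X / real p)))"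
proof -
  let ?A = "sieve_set P Q X" and ?B = "sieve_set P (insert p Q) X" and ?C = "sieve_set P (insert p Q) (X / real p)"
  have p0: "real p > 0" using p prime_gt_0_nat by simp
  have "?A - ?B = (\<lambda>l. p * l) ` ?C"
  proof (intro equalityI subsetI)
    fix l assume l: "l \<in> ?A - ?B"
    hence "p dvd l" by (auto simp: sieve_set_def)
    then obtain k where k: "l = p * k" by auto
    have "1 \<le> k" using l k by (cases k) (auto simp: sieve_set_def)
    moreover have "real k \<le> X / real p" using l k p0 by (auto simp: sieve_set_def field_simps)
    moreover have "\<not> q^2 dvd k" if "q \<in> P" for q
      using l k that by (auto simp: sieve_set_def)
    moreover have "\<not> q dvd k" if "q \<in> Q" for q
      using l k that by (auto simp: sieve_set_def)
    moreover have "\<not> p dvd k"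
    proof
      assume "p dvd k"
      hence "p^2 dvd l" using k by (simp add: power2_eq_square)
      thus False using l p by (auto simp: sieve_set_def)
    qed
    ultimately have "k \<in> ?C" by (auto simp: sieve_set_def)
    thus "l \<in> (\<lambda>l. p * l) ` ?C" using k by blast
  next
    fix l assume "l \<in> (\<lambda>l. p * l) ` ?C"
    then obtain k where k: "k \<in> ?C" "l = p * k" by blast
    have "\<not> q^2 dvd l" if "q \<in> P" for q
    proof (cases "q = p")
      case True
      have "\<not> p dvd k" using k by (auto simp: sieve_set_def)
      thus ?thesis using k True p0 by (simp add: power2_eq_square)
    next
      case False
      hence "q^2 dvd p^1 * k \<longleftrightarrow> q^2 dvd k" using p P[OF that] by (intro prime_square_dvd_mult_other) auto
      thus ?thesis using k that by (auto simp: sieve_set_def)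
    qed
    moreover have "\<not> q dvd l" if "q \<in> Q" for q
    proof -
      have "q dvd p * k \<longleftrightarrow> q dvd k" using p P Q that by (intro prime_dvd_mult_other) auto
      thus ?thesis using k that by (auto simp: sieve_set_def)
    qed
    moreover have "1 \<le> l" using k p0 by (auto simp: sieve_set_def)
    moreover have "real l \<le> X" using k p0 by (auto simp: sieve_set_def field_simps)
    ultimately show "l \<in> ?A - ?B" using k by (auto simp: sieve_set_def)
  qed
  moreover have "inj_on (\<lambda>l. p * l) ?C" using p0 by (auto simp: inj_on_def)
  ultimately have "card (?A - ?B) = card ?C" by (simp add: card_image)
  moreover have sub: "?B \<subseteq> ?A" by (auto simp: sieve_set_def)
  hence "card (?A - ?B) = card ?A - card ?B" by (intro card_Diff_subset) auto
  moreover have "card ?B \<le> card ?A" using sub by (intro card_mono) auto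
  ultimately show ?thesis by linarith
qed

lemma sieve_set_le: "X \<ge> 0 \<Longrightarrow> real (card (sieve_set P Q X)) \<le> X"
proof -
  assume X: "X \<ge> 0"
  have "card (sieve_set P Q X) \<le> card {1..nat \<lfloor>X\<rfloor>}"
    by (intro card_mono) (auto simp: sieve_set_def le_nat_floor)
  thus ?thesis using X by (simp add: le_nat_iff) linarith
qed

lemma sieve_set_small: "X < 1 \<Longrightarrow> sieve_set P Q X = {}"
  by (auto simp: sieve_set_def)

lemma le_powr_34: "0 \<le> X \<Longrightarrow> X \<le> 1 \<Longrightarrow> X \<le> X powr (3/4)" for X :: real
  using powr_mono'[of "3/4" 1 X] by (cases "X = 0") auto

text \<open>The exponent 3/4 exceeds 1/2, so inserting p multiplies the error by 1 + p^(-3/2) and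
  the product over any set of primes stays bounded; it is below 1, so the error has lower order than
  X.\<close>

lemma sieve_square_error:
  assumes "finite P" "\<And>q. q \<in> P \<Longrightarrow> prime q" "X \<ge> 0"
  shows "\<bar>real (card (sieve_set P {} X)) - sieve_density P * X\<bar> \<le> (\<Prod>p\<in>P. 1 + real p powr (-3/2)) * X powr (3/4)"
  using assms
proof (induction P arbitrary: X rule: finite_induct)
  case empty
  have "sieve_set {} {} X = {1..nat \<lfloor>X\<rfloor>}" using empty by (auto simp: sieve_set_def le_nat_floor) linarith
  hence c: "real (card (sieve_set {} {} X)) = of_int \<lfloor>X\<rfloor>" using empty by simp
  show ?case
  proof (cases "X < 1")
    case True
    hence "\<lfloor>X\<rfloor> = 0" using empty by (simp add: floor_eq_iff)
    thus ?thesis using c le_powr_34[of X] True empty by (simp add: sieve_density_def)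
  next
    case False
    hence "1 \<le> X powr (3/4)" by (intro ge_one_powr_ge_zero) auto
    moreover have "\<bar>of_int \<lfloor>X\<rfloor> - X\<bar> \<le> 1" by linarith
    ultimately show ?thesis using c by (simp add: sieve_density_def)
  qed
next
  case (insert p P)
  have p: "prime p" using insert by auto
  have p0: "real p > 0" using p prime_gt_0_nat by simp
  let ?F = "\<lambda>P X. real (card (sieve_set P {} X))" and ?c = "\<Prod>p\<in>P. 1 + real p powr (-3/2)"
  have "?F (Set.insert p P) X - sieve_density (Set.insert p P) * X =
     (?F P X - sieve_density P * X) - (?F P (X / (real p)^2) - sieve_density P * (X / (real p)^2))"
    using sieve_set_insert_square[OF p insert.hyps(2)] insert by (simp add: sieve_density_def algebra_simps)
  also have "\<bar>\<dots>\<bar> \<le> ?c * X powr (3/4) + ?c * (X / (real p)^2) powr (3/4)"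
    using insert.IH[of X] insert.IH[of "X / (real p)^2"] insert.prems by (intro order_trans[OF abs_triangle_ineq4 add_mono]) auto
  also have "(X / (real p)^2) powr (3/4) = X powr (3/4) * real p powr (-3/2)"
  proof -
    have "(real p)^2 = real p powr 2" using p0 by simp
    hence "((real p)^2) powr (3/4) = real p powr (2 * (3/4))" by (simp only: powr_powr)
    hence "((real p)^2) powr (3/4) = real p powr (3/2)" by simp
    moreover have "real p powr (-3/2) = inverse (real p powr (3/2))" using powr_minus[of "real p" "3/2"] by simp
    moreover have "(X / (real p)^2) powr (3/4) = X powr (3/4) / ((real p)^2) powr (3/4)"
      by (rule powr_divide)
    ultimately show ?thesis by (simp only: divide_inverse)
  qed
  also have "?c * X powr (3/4) + ?c * (X powr (3/4) * real p powr (-3/2)) = (\<Prod>p\<in>Set.insert p P. 1 + real p powr (-3/2)) * X powr (3/4)"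
    using insert.hyps by (simp add: algebra_simps)
  finally show ?case .
qed

lemma sieve_error_product_bounded:
  "\<exists>C\<ge>1. \<forall>P. finite P \<longrightarrow> (\<Prod>p\<in>P. 1 + real p powr (-3/2)) \<le> C"
proof -
  have sm: "summable (\<lambda>n::nat. real n powr (-3/2))" by (simp add: summable_real_powr_iff)
  define C where "C = exp (\<Sum>n. real n powr (-3/2))"
  have "(\<Prod>p\<in>P. 1 + real p powr (-3/2)) \<le> C" if P: "finite P" for P
  proof -
    have "(\<Prod>p\<in>P. 1 + real p powr (-3/2)) \<le> (\<Prod>p\<in>P. exp (real p powr (-3/2)))"
      by (intro prod_mono conjI exp_ge_add_one_self) (auto intro: add_nonneg_nonneg)
    also have "\<dots> = exp (\<Sum>p\<in>P. real p powr (-3/2))" using P by (simp add: exp_sum)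
    also have "\<dots> \<le> C" unfolding C_def using P sm by (simp add: sum_le_suminf)
    finally show ?thesis .
  qed
  moreover have "C \<ge> 1" unfolding C_def using sm by (simp add: suminf_nonneg)
  ultimately show ?thesis by blast
qed

lemma sieve_density_bounds:
  assumes "finite P" "\<And>q. q \<in> P \<Longrightarrow> prime q"
  shows "sieve_density P \<ge> 1/2" "sieve_density P \<le> 1"
proof -
  have f: "0 \<le> 1 - 1 / (real n)^2" "1 - 1 / (real n)^2 \<le> 1" if "n \<ge> 1" for n
  proof -
    have "1 \<le> (real n)^2" using that by (intro one_le_power) auto
    hence "1 / (real n)^2 \<le> 1 / 1" using that by (intro divide_left_mono) auto
    thus "0 \<le> 1 - 1 / (real n)^2" by simp
  qed simp
  have p1: "q \<ge> 1" if "q \<in> P" for q using assms(2)[OF that] prime_gt_0_nat[of q] by linarith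
  show "sieve_density P \<le> 1" unfolding sieve_density_def by (intro prod_le_1 conjI f p1)
  obtain n where n: "P \<subseteq> {..n}" using assms(1) finite_nat_iff_bounded_le by blast
  \<comment> \<open>The product over consecutive k telescopes and stays above 1/2; dropping factors
    only increases it, which handles arbitrary sets of primes.\<close>
  have prod: "(\<Prod>k=2..m + 1. 1 - 1 / (real k)^2) = (real m + 2) / (2 * (real m + 1))" for m
  proof (induction m)
    case (Suc m)
    have "(\<Prod>k=2..Suc m + 1. 1 - 1 / (real k)^2) = (real m + 2) / (2 * (real m + 1)) * (1 - 1 / (real m + 2)^2)"
      using Suc by (simp add: prod.nat_ivl_Suc' mult.commute add_ac)
    also have "1 - 1 / (real m + 2)^2 = (real m + 1) * (real m + 3) / (real m + 2)^2"
    proof -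
      have "1 - 1 / a^2 = (a - 1) * (a + 1) / a^2" if "a > 0" for a :: real
      proof -
        have "(a - 1) * (a + 1) = a^2 - 1" by (simp add: power2_eq_square algebra_simps)
        thus ?thesis using that by (simp add: diff_divide_distrib)
      qed
      from this[of "real m + 2"] show ?thesis by (simp add: add.commute)
    qed
    also have "(real m + 2) / (2 * (real m + 1)) * ((real m + 1) * (real m + 3) / (real m + 2)^2) = (real (Suc m) + 2) / (2 * (real (Suc m) + 1))"
    proof -
      have "a / (2 * c) * (c * d / a^2) = d / (2 * a)" if "a > 0" "c > 0" for a c d :: real
        using that by (simp add: power2_eq_square)
      from this[of "real m + 2" "real m + 1" "real m + 3"] show ?thesis by (simp add: add_ac)
    qed
    finally show ?case .
  qed simp
  have sub: "P \<subseteq> {2..n + 1}"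
  proof
    fix q assume "q \<in> P"
    thus "q \<in> {2..n + 1}" using n prime_ge_2_nat[OF assms(2)] by force
  qed
  have "1/2 \<le> (\<Prod>k=2..n + 1. 1 - 1 / (real k)^2)" unfolding prod by (simp add: field_simps)
  also have "\<dots> = (\<Prod>k\<in>{2..n + 1} - P. 1 - 1 / (real k)^2) * sieve_density P"
    unfolding sieve_density_def by (rule prod.subset_diff[OF sub]) auto
  also have "\<dots> \<le> 1 * sieve_density P"
    unfolding sieve_density_def by (intro mult_right_mono prod_le_1 prod_nonneg conjI f) (auto dest: p1)
  finally show "sieve_density P \<ge> 1/2" by simp
qed

text \<open>Inserting p into Q gives E'(X) = E(X) - E'(X / p) between the errors. Unrolling this is
  harmless because p^(-3/4) \<le> 3/4, and p^2 is a convenient cost per prime since 1 + (3/4) p^2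
  \<le> p^2 for p \<ge> 2.\<close>

lemma sieve_error:
  "\<exists>C\<ge>1. \<forall>P Q X. finite P \<longrightarrow> (\<forall>p\<in>P. prime p) \<longrightarrow> Q \<subseteq> P \<longrightarrow> X \<ge> 0 \<longrightarrow>
     \<bar>real (card (sieve_set P Q X)) - sieve_density P * (\<Prod>q\<in>Q. real q / (real q + 1)) * X\<bar> \<le> C * (\<Prod>q\<in>Q. (real q)^2) * X powr (3/4)"
proof -
  obtain C where C: "C \<ge> 1" "\<And>P. finite P \<Longrightarrow> (\<Prod>p\<in>P. 1 + real p powr (-3/2)) \<le> C"
    using sieve_error_product_bounded by blast
  have "\<bar>real (card (sieve_set P Q X)) - sieve_density P * (\<Prod>q\<in>Q. real q / (real q + 1)) * X\<bar> \<le> C * (\<Prod>q\<in>Q. (real q)^2) * X powr (3/4)"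
    if P: "finite P" "\<And>p. p \<in> P \<Longrightarrow> prime p" and "Q \<subseteq> P" "X \<ge> 0" for P Q X
  proof -
    have "finite Q" using that finite_subset by blast
    thus ?thesis using \<open>Q \<subseteq> P\<close> \<open>X \<ge> 0\<close>
    proof (induction Q arbitrary: X rule: finite_induct)
      case empty
      have "\<bar>real (card (sieve_set P {} X)) - sieve_density P * X\<bar> \<le> (\<Prod>p\<in>P. 1 + real p powr (-3/2)) * X powr (3/4)"
        using P empty by (intro sieve_square_error) auto
      also have "\<dots> \<le> C * X powr (3/4)" using C P by (intro mult_right_mono) auto
      finally show ?case by simp
    next
      case (insert p Q)
      have p: "prime p" "p \<in> P" "p \<notin> Q" using insert P by auto
      have p2: "real p \<ge> 2" using prime_ge_2_nat[OF p(1)] by simp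
      have QP: "Q \<subseteq> P" using insert by auto
      define D where "D = C * (\<Prod>q\<in>Q. (real q)^2)"
      define c where "c = sieve_density P * (\<Prod>q\<in>Q. real q / (real q + 1))"
      have q1: "real q \<ge> 1" if "q \<in> Q" for q using P(2)[of q] QP that prime_gt_0_nat[of q] by auto
      have D1: "D \<ge> 1"
      proof -
        have "1 \<le> (\<Prod>q\<in>Q. (real q)^2)" by (intro prod_ge_1 one_le_power q1)
        hence "1 * 1 \<le> C * (\<Prod>q\<in>Q. (real q)^2)" using C by (intro mult_mono) auto
        thus ?thesis by (simp add: D_def)
      qed
      have c1: "0 \<le> c" "c \<le> 1"
      proof -
        have "0 \<le> (\<Prod>q\<in>Q. real q / (real q + 1))" "(\<Prod>q\<in>Q. real q / (real q + 1)) \<le> 1"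
          by (auto intro!: prod_nonneg prod_le_1)
        moreover have "0 \<le> sieve_density P" "sieve_density P \<le> 1" using sieve_density_bounds[OF P] by auto
        ultimately show "0 \<le> c" "c \<le> 1" unfolding c_def by (auto intro: mult_nonneg_nonneg mult_le_one)
      qed
      define c' where "c' = c * (real p / (real p + 1))"
      have c'1: "0 \<le> c'" "c' \<le> 1"
      proof -
        have r: "0 \<le> real p / (real p + 1)" "real p / (real p + 1) \<le> 1" by auto
        show "0 \<le> c'" "c' \<le> 1" unfolding c'_def
          using mult_nonneg_nonneg[OF c1(1) r(1)] mult_le_one[OF c1(2) r] by auto
      qed
      let ?E = "\<lambda>X. real (card (sieve_set P Q X)) - c * X"
      let ?E' = "\<lambda>X. real (card (sieve_set P (Set.insert p Q) X)) - c' * X"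
      have IH: "\<bar>?E X\<bar> \<le> D * X powr (3/4)" if "X \<ge> 0" for X
        using insert.IH[OF QP that] unfolding c_def D_def .
      have rec: "?E' X = ?E X - ?E' (X / real p)" for X
      proof -
        have "c * X = c' * X + c' * (X / real p)"
        proof -
          have "real p / (real p + 1) * (1 + 1 / real p) = 1" using p2 by (simp add: divide_simps)
          moreover have "c' * X + c' * (X / real p) = c * X * (real p / (real p + 1) * (1 + 1 / real p))"
            unfolding c'_def by (simp only: distrib_left mult_1_right divide_inverse mult_1_left mult_ac)
          ultimately show ?thesis by (simp only: mult_1_right)
        qed
        thus ?thesis using sieve_set_insert_prime[OF p P(2) QP, of X] by linarith
      qed
      have pp: "real p powr (-3/4) \<le> 3/4"
      proof -
        have "real p powr (-3/4) \<le> 2 powr (-3/4)" using p2 by (intro powr_mono2') auto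
        also have "\<dots> \<le> 2 powr (-1/2)" by (intro powr_mono) auto
        also have "2 powr (-1/2) = inverse ((2::real) powr (1/2))" using powr_minus[of "2::real" "1/2"] by simp
        also have "\<dots> = 1 / sqrt 2" by (simp only: powr_half_sqrt[OF zero_le_numeral] inverse_eq_divide)
        also have "\<dots> \<le> 3/4"
        proof -
          have "4/3 \<le> sqrt (2::real)" by (rule real_le_rsqrt) (simp add: power2_eq_square)
          thus ?thesis by (simp add: divide_simps)
        qed
        finally show ?thesis .
      qed
      \<comment> \<open>Induction on the dyadic size of X, since X / p \<le> X / 2; it starts at X <
        1, where the set is empty.\<close>
      have main: "0 \<le> X \<Longrightarrow> X < 2 ^ n \<Longrightarrow> \<bar>?E' X\<bar> \<le> (D * (real p)^2) * X powr (3/4)" for n X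
      proof (induction n arbitrary: X)
        case 0
        have "\<bar>?E' X\<bar> = c' * X" using 0 c'1 by (simp add: sieve_set_small)
        also have "\<dots> \<le> 1 * X powr (3/4)" using 0 c'1 le_powr_34[of X] by (intro mult_mono) auto
        also have "\<dots> \<le> (D * (real p)^2) * X powr (3/4)"
        proof (intro mult_right_mono)
          have "1 \<le> (real p)^2" using p2 by (intro one_le_power) auto
          hence "1 * 1 \<le> D * (real p)^2" using D1 by (intro mult_mono) auto
          thus "1 \<le> D * (real p)^2" by simp
        qed auto
        finally show ?case .
      next
        case (Suc n)
        have "X / real p \<le> X / 2" using p2 Suc by (intro divide_left_mono) auto
        moreover have "X / 2 < 2 ^ n" using Suc.prems by simp
        ultimately have Xp: "X / real p < 2 ^ n" "0 \<le> X / real p" using Suc.prems p2 by (linarith, simp)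
        have "\<bar>?E' X\<bar> \<le> \<bar>?E X\<bar> + \<bar>?E' (X / real p)\<bar>" unfolding rec[of X] by (rule abs_triangle_ineq4)
        also have "\<dots> \<le> D * X powr (3/4) + (D * (real p)^2) * (X / real p) powr (3/4)"
          using Suc Xp by (intro add_mono IH Suc.IH) auto
        also have "(X / real p) powr (3/4) = X powr (3/4) * real p powr (-3/4)"
        proof -
          have "real p powr (-3/4) = inverse (real p powr (3/4))" using powr_minus[of "real p" "3/4"] by simp
          moreover have "(X / real p) powr (3/4) = X powr (3/4) / real p powr (3/4)" by (rule powr_divide)
          ultimately show ?thesis by (simp only: divide_inverse)
        qed
        also have "D * X powr (3/4) + (D * (real p)^2) * (X powr (3/4) * real p powr (-3/4)) =
           D * X powr (3/4) * (1 + (real p)^2 * real p powr (-3/4))" by (simp add: algebra_simps)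
        also have "\<dots> \<le> D * X powr (3/4) * (real p)^2"
        proof (intro mult_left_mono)
          have "2^2 \<le> (real p)^2" using p2 by (intro power_mono) auto
          moreover have "(real p)^2 * real p powr (-3/4) \<le> (real p)^2 * (3/4)" using pp by (intro mult_left_mono) auto
          moreover have "1 + c \<le> a" if "2^2 \<le> a" "c \<le> a * (3/4)" for a c :: real using that by simp
          ultimately show "1 + (real p)^2 * real p powr (-3/4) \<le> (real p)^2" by blast
        qed (use D1 in auto)
        finally show ?case by (simp add: mult_ac)
      qed
      obtain n where n: "X < 2 ^ n" using real_arch_pow[of 2 X] by auto
      have "\<bar>?E' X\<bar> \<le> (D * (real p)^2) * X powr (3/4)" using main[OF _ n] insert.prems by simp
      moreover have "c' = sieve_density P * (\<Prod>q\<in>Set.insert p Q. real q / (real q + 1))"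
        using insert.hyps by (simp add: c'_def c_def)
      moreover have "D * (real p)^2 = C * (\<Prod>q\<in>Set.insert p Q. (real q)^2)" using insert.hyps by (simp add: D_def)
      ultimately show ?case by simp
    qed
  qed
  thus ?thesis using C(1) by (intro exI[of _ C] conjI allI impI) simp_all
qed

section \<open>The kernel and the fibres of m / k(m)\<close>

lemma kernel_pos: "kernel n > 0"
  unfolding kernel_def by (auto intro!: prod_pos simp: in_prime_factors_iff prime_gt_0_nat)

lemma prime_factors_kernel: "prime_factors (kernel n) = prime_factors n"
proof -
  have "p dvd kernel n \<longleftrightarrow> p \<in> prime_factors n" if "prime p" for p
  proof
    assume "p dvd kernel n"
    hence "p dvd (\<Prod>q\<in>prime_factors n. q)" by (simp add: kernel_def)
    hence "\<exists>q\<in>prime_factors n. p dvd q" using that by (subst (asm) prime_dvd_prod_iff) auto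
    then obtain q where "q \<in> prime_factors n" "p dvd q" by blast
    thus "p \<in> prime_factors n" using that primes_dvd_imp_eq by (metis in_prime_factors_iff)
  next
    assume "p \<in> prime_factors n"
    thus "p dvd kernel n" unfolding kernel_def by (intro dvd_prodI) auto
  qed
  moreover have "kernel n \<noteq> 0" using kernel_pos[of n] by simp
  ultimately have "p \<in> prime_factors (kernel n) \<longleftrightarrow> p \<in> prime_factors n" for p
    by (metis in_prime_factors_iff)
  thus ?thesis by blast
qed

lemma kernel_mult_coprime:
  assumes "prime_factors m \<inter> prime_factors n = {}" "m > 0" "n > 0"
  shows "kernel (m * n) = kernel m * kernel n"
  unfolding kernel_def using assms by (simp add: prime_factors_product prod.union_disjoint)

lemma kernel_dvd: "n > 0 \<Longrightarrow> kernel n dvd n"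
proof -
  assume n: "n > 0"
  have "n = (\<Prod>p\<in>prime_factors n. p ^ multiplicity p n)" using prime_factorization_nat[OF n] .
  moreover have "kernel n dvd (\<Prod>p\<in>prime_factors n. p ^ multiplicity p n)"
    unfolding kernel_def
    by (intro prod_dvd_prod dvd_power) (auto simp: in_prime_factors_iff prime_factors_multiplicity)
  ultimately show ?thesis by simp
qed

lemma square_not_dvd_kernel: "prime p \<Longrightarrow> \<not> p^2 dvd kernel n"
proof
  assume p: "prime p" and d: "p^2 dvd kernel n"
  hence "p dvd kernel n" by (meson dvd_power dvd_trans zero_less_numeral)
  hence pn: "p \<in> prime_factors n" using p kernel_pos[of n] prime_factors_kernel[of n] by (metis in_prime_factors_iff not_gr_zero)
  have "kernel n = p * (\<Prod>q\<in>prime_factors n - {p}. q)"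
    unfolding kernel_def using pn by (subst prod.remove[of _ p]) auto
  hence "p dvd (\<Prod>q\<in>prime_factors n - {p}. q)" using d p prime_gt_0_nat[OF p] by (simp add: power2_eq_square)
  then obtain q where "q \<in> prime_factors n - {p}" "p dvd q" using p by (subst (asm) prime_dvd_prod_iff) auto
  thus False using p primes_dvd_imp_eq by (metis DiffD1 DiffD2 in_prime_factors_iff singletonI)
qed

lemma kernel_squarefree:
  assumes "l > 0" "\<And>p. prime p \<Longrightarrow> \<not> p^2 dvd l"
  shows "kernel l = l"
proof -
  have "multiplicity p l = 1" if p: "p \<in> prime_factors l" for p
  proof -
    have pr: "prime p" "p dvd l" using p by (auto simp: in_prime_factors_iff)
    have "\<not> 2 \<le> multiplicity p l" using assms(2)[OF pr(1)] multiplicity_dvd'[of 2 p l] by auto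
    moreover have "multiplicity p l > 0" using p by (simp add: prime_factors_multiplicity)
    ultimately show ?thesis by linarith
  qed
  hence "kernel l = (\<Prod>p\<in>prime_factors l. p ^ multiplicity p l)" unfolding kernel_def by simp
  thus ?thesis using prime_factorization_nat[OF assms(1)] by simp
qed

text \<open>Sieving by the primes up to x already makes l squarefree: p^2 | l would force p \<le> l
  \<le> Y \<le> x.\<close>

lemma kernel_mult_sieved:
  assumes n: "n > 0" and P: "P = primes_upto x" and Y: "Y \<le> x" and l: "l \<in> sieve_set P (prime_factors n) Y"
  shows "kernel (n * kernel n * l) = kernel n * l"
proof -
  have l': "l > 0" "real l \<le> Y" "\<forall>q\<in>prime_factors n. \<not> q dvd l" using l by (auto simp: sieve_set_def)
  have sf: "\<not> p^2 dvd l" if "prime p" for p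
  proof
    assume d: "p^2 dvd l"
    hence "p^2 \<le> l" using l' by (simp add: dvd_imp_le)
    moreover have "p \<le> p^2" using that prime_gt_0_nat[OF that] by (simp add: power2_eq_square)
    ultimately have "real p \<le> x" using l' Y by linarith
    hence "p \<in> P" using that by (simp add: P primes_upto_def)
    thus False using l d by (auto simp: sieve_set_def)
  qed
  have pf: "prime_factors (n * kernel n) = prime_factors n"
    using n kernel_pos[of n] by (simp add: prime_factors_product prime_factors_kernel)
  have "kernel (n * kernel n * l) = kernel (n * kernel n) * kernel l"
    by (rule kernel_mult_coprime) (use pf n kernel_pos[of n] l' in \<open>auto simp: in_prime_factors_iff\<close>)
  also have "kernel (n * kernel n) = kernel n" using pf by (simp add: kernel_def)
  also have "kernel l = l" using l' sf by (intro kernel_squarefree) auto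
  finally show ?thesis .
qed

text \<open>The inverse map is l = k(m) / k(n). Since k(m) = k(n) l on the fibre, a bound on k(m) is
  the same as a bound on l.\<close>

lemma kernel_fiber:
  assumes n: "n > 0" and P: "P = primes_upto x" and Y: "Y \<le> x"
  shows "bij_betw (\<lambda>l. n * kernel n * l) (sieve_set P (prime_factors n) Y)
           {m. m > 0 \<and> m div kernel m = n \<and> real (kernel m) \<le> real (kernel n) * Y}"
proof (rule bij_betwI[where g = "\<lambda>m. kernel m div kernel n"])
  show "(\<lambda>l. n * kernel n * l) \<in> sieve_set P (prime_factors n) Y \<rightarrow> {m. m > 0 \<and> m div kernel m = n \<and> real (kernel m) \<le> real (kernel n) * Y}"
  proof
    fix l assume l: "l \<in> sieve_set P (prime_factors n) Y"
    hence l': "l > 0" "real l \<le> Y" "\<forall>q\<in>prime_factors n. \<not> q dvd l" by (auto simp: sieve_set_def)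
    have k: "kernel (n * kernel n * l) = kernel n * l" by (rule kernel_mult_sieved[OF n P Y l])
    have "n * kernel n * l div (kernel n * l) = n" using kernel_pos[of n] l' by (simp add: mult.assoc)
    moreover have "real (kernel n) * real l \<le> real (kernel n) * Y" using l' by (intro mult_left_mono) auto
    ultimately show "n * kernel n * l \<in> {m. m > 0 \<and> m div kernel m = n \<and> real (kernel m) \<le> real (kernel n) * Y}"
      using n kernel_pos[of n] l' unfolding k by (auto simp: k)
  qed
next
  have dec: "kernel n * (kernel m div kernel n) = kernel m \<and> m = n * kernel m" if m: "m > 0" "m div kernel m = n" for m
  proof -
    have mk: "m = n * kernel m" using m kernel_dvd[of m] by auto
    hence "prime_factors n \<subseteq> prime_factors m" using m n by (metis dvd_prime_factors dvd_triv_left less_numeral_extra(3))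
    hence "kernel n dvd kernel m" unfolding kernel_def by (intro prod_dvd_prod_subset) auto
    thus ?thesis using mk by simp
  qed
  show "(\<lambda>m. kernel m div kernel n) \<in> {m. m > 0 \<and> m div kernel m = n \<and> real (kernel m) \<le> real (kernel n) * Y} \<rightarrow> sieve_set P (prime_factors n) Y"
  proof
    fix m assume "m \<in> {m. m > 0 \<and> m div kernel m = n \<and> real (kernel m) \<le> real (kernel n) * Y}"
    hence m: "m > 0" "m div kernel m = n" "real (kernel m) \<le> real (kernel n) * Y" by auto
    define l where "l = kernel m div kernel n"
    have kl: "kernel n * l = kernel m" "m = n * kernel m" using dec[OF m(1,2)] by (auto simp: l_def)
    have l0: "l > 0" using kl kernel_pos[of m] by (auto intro: Nat.gr0I)
    have "real (kernel n) * real l \<le> real (kernel n) * Y" using m kl by (metis of_nat_mult)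
    hence "real l \<le> Y" using kernel_pos[of n] by simp
    moreover have "\<not> p^2 dvd l" if "p \<in> P" for p
      using that square_not_dvd_kernel[of p m] kl by (metis P dvd_mult mem_Collect_eq primes_upto_def)
    moreover have "\<not> q dvd l" if q: "q \<in> prime_factors n" for q
    proof
      assume "q dvd l"
      moreover have "q dvd kernel n" using q prime_factors_kernel[of n] by (metis in_prime_factors_iff)
      ultimately have "q^2 dvd kernel m" using kl by (metis mult_dvd_mono power2_eq_square)
      thus False using q square_not_dvd_kernel[of q m] by (auto simp: in_prime_factors_iff)
    qed
    ultimately show "kernel m div kernel n \<in> sieve_set P (prime_factors n) Y"
      using l0 unfolding l_def[symmetric] by (auto simp: sieve_set_def)
  qed
  fix m assume "m \<in> {m. m > 0 \<and> m div kernel m = n \<and> real (kernel m) \<le> real (kernel n) * Y}"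
  hence m: "m > 0" "m div kernel m = n" by auto
  show "n * kernel n * (kernel m div kernel n) = m" using dec[OF m] by (metis mult.assoc)
next
  fix l assume "l \<in> sieve_set P (prime_factors n) Y"
  from kernel_mult_sieved[OF n P Y this]
  show "kernel (n * kernel n * l) div kernel n = l" using kernel_pos[of n] by simp
qed

section \<open>Counting by the kernel\<close>

lemma tent_eq: "b > 0 \<Longrightarrow> tent b s = exp (min s (- (b * s)))"
proof -
  assume b: "b > 0"
  show ?thesis
  proof (cases "s \<ge> 0")
    case True
    hence "b * s \<ge> 0" using b by simp
    hence "min s (- (b * s)) = - (b * s)" using True by linarith
    thus ?thesis using True by (simp add: tent_def)
  next
    case False
    hence "b * s \<le> 0" using b by (simp add: mult_le_0_iff)
    hence "min s (- (b * s)) = s" using False by linarith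
    thus ?thesis using False by (simp add: tent_def)
  qed
qed

lemma min_tent_nonpos: "b > 0 \<Longrightarrow> min s (- (b * s)) \<le> (0::real)"
proof (cases "s \<ge> 0")
  case True
  assume "b > 0"
  hence "b * s \<ge> 0" using True by simp
  thus ?thesis by linarith
qed auto

text \<open>v stands for m / k(m) and a for k(m). In logarithms both conditions are upper bounds for
  ln a that are linear in ln v, and t is the value of ln v at which they coincide.\<close>

lemma kernel_condition_iff:
  fixes \<theta> b z x a v R t Y :: real
  assumes \<theta>: "0 < \<theta>" "\<theta> < 1" and b: "b = \<theta> / (1 - \<theta>)" and z: "z > 0" and x: "x = exp R"
    and t: "t = (1 - \<theta>) * R - ln z" and Y: "Y = exp (\<theta> * R) * z" and a: "a > 0" and v: "v > 0"
  shows "v * a \<le> x \<and> a \<le> z * (v * a) powr \<theta> \<longleftrightarrow> a \<le> Y * tent b (t - ln v)"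
proof -
  have b0: "b > 0" using \<theta> b by simp
  define s where "s = t - ln v"
  have va: "v * a > 0" using v a by simp
  have ll: "p \<le> q \<longleftrightarrow> ln p \<le> ln q" if "p > 0" "q > 0" for p q :: real using that by simp
  have 1: "v * a \<le> x \<longleftrightarrow> ln a \<le> (\<theta> * R + ln z) + s"
  proof -
    have "v * a \<le> x \<longleftrightarrow> ln (v * a) \<le> ln x" by (rule ll) (use va x in auto)
    also have "\<dots> \<longleftrightarrow> ln v + ln a \<le> R" using v a x by (simp add: ln_mult)
    finally show ?thesis unfolding s_def t by (auto simp: algebra_simps)
  qed
  have 2: "a \<le> z * (v * a) powr \<theta> \<longleftrightarrow> ln a \<le> (\<theta> * R + ln z) - b * s"
  proof -
    have "a \<le> z * (v * a) powr \<theta> \<longleftrightarrow> ln a \<le> ln (z * (v * a) powr \<theta>)" by (rule ll) (use a v z in auto)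
    also have "ln (z * (v * a) powr \<theta>) = ln z + \<theta> * (ln v + ln a)"
    proof -
      have "ln (z * (v * a) powr \<theta>) = ln z + ln ((v * a) powr \<theta>)" using z va by (intro ln_mult_pos) auto
      also have "ln ((v * a) powr \<theta>) = \<theta> * ln (v * a)" using va by (simp add: ln_powr)
      also have "ln (v * a) = ln v + ln a" using v a by (intro ln_mult_pos)
      finally show ?thesis .
    qed
    also have "ln a \<le> ln z + \<theta> * (ln v + ln a) \<longleftrightarrow> (1 - \<theta>) * ln a \<le> ln z + \<theta> * ln v" by (auto simp: algebra_simps)
    also have "ln z + \<theta> * ln v = (1 - \<theta>) * ((\<theta> * R + ln z) - b * s)"
    proof -
      have "(1 - \<theta>) * (b * s) = \<theta> * s" using \<theta> b by simp
      hence "(1 - \<theta>) * ((\<theta> * R + ln z) - b * s) = (1 - \<theta>) * (\<theta> * R + ln z) - \<theta> * s" by (simp only: right_diff_distrib)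
      thus ?thesis unfolding s_def t by (simp add: algebra_simps)
    qed
    also have "(1 - \<theta>) * ln a \<le> (1 - \<theta>) * ((\<theta> * R + ln z) - b * s) \<longleftrightarrow> ln a \<le> (\<theta> * R + ln z) - b * s"
      using \<theta> by (intro mult_le_cancel_left_pos) auto
    finally show ?thesis .
  qed
  have "a \<le> Y * tent b s \<longleftrightarrow> ln a \<le> ln (Y * tent b s)" by (rule ll) (use a Y z tent_pos in auto)
  also have "ln (Y * tent b s) = (\<theta> * R + ln z) + min s (- (b * s))"
    unfolding tent_eq[OF b0] Y using z by (simp add: ln_mult_pos)
  finally show ?thesis unfolding 1 2 s_def[symmetric] by (auto simp: min_def)
qed

lemma B_count_eq:
  fixes \<theta> z x :: real
  assumes \<theta>: "0 < \<theta>" "\<theta> < 1" and b: "b = \<theta> / (1 - \<theta>)" and z: "z > 0" and x: "x = exp R"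
    and t: "t = (1 - \<theta>) * R - ln z" and Y: "Y = exp (\<theta> * R) * z"
  shows "real (B_count \<theta> x z) = (\<Sum>n\<in>coprime_upto {} R.
     real (card (sieve_set (primes_upto x) (prime_factors n) (Y * tent b (t - ln (real n)) / real (kernel n)))))"
proof -
  let ?S = "{n::nat. 1 \<le> n \<and> real n \<le> x \<and> real (kernel n) \<le> z * real n powr \<theta>}"
  let ?f = "\<lambda>m. m div kernel m" and ?T = "coprime_upto {} R"
  have finS: "finite ?S" by (rule finite_subset[of _ "{..nat \<lfloor>x\<rfloor>}"]) (auto simp: le_nat_floor)
  have fm: "m = ?f m * kernel m" "?f m > 0" if "m > 0" for m
    using kernel_dvd[OF that] that kernel_pos[of m] by (auto simp: div_greater_zero_iff dvd_imp_le)
  have img: "?f ` ?S \<subseteq> ?T"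
  proof
    fix n assume "n \<in> ?f ` ?S"
    then obtain m where "m \<in> ?S" "n = ?f m" by blast
    hence m: "m > 0" "real m \<le> x" "n = ?f m" by auto
    have "real n \<le> real m" using m by simp
    hence "real n \<le> x" using m(2) by linarith
    moreover have "n > 0" using m(3) fm(2)[OF m(1)] by simp
    ultimately have "ln (real n) \<le> ln x" by (intro ln_mono) auto
    thus "n \<in> ?T" using m fm(2)[OF m(1)] x by (auto simp: coprime_upto_def)
  qed
  have "real (B_count \<theta> x z) = (\<Sum>m\<in>?S. 1)" by (simp add: B_count_def)
  also have "\<dots> = (\<Sum>n\<in>?T. \<Sum>m | m \<in> ?S \<and> ?f m = n. 1)" by (rule sum.group[symmetric]) (use finS img in auto)
  also have "\<dots> = (\<Sum>n\<in>?T. real (card (sieve_set (primes_upto x) (prime_factors n) (Y * tent b (t - ln (real n)) / real (kernel n)))))"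
  proof (rule sum.cong)
    fix n assume "n \<in> ?T"
    hence n: "n > 0" by (auto simp: coprime_upto_def)
    define K where "K = Y * tent b (t - ln (real n))"
    have k0: "real (kernel n) > 0" using kernel_pos[of n] by simp
    have K0: "K > 0" unfolding K_def Y using z tent_pos by simp
    \<comment> \<open>The equivalence is applied to the extreme value K itself: it yields n K \<le>
      x, hence K \<le> x, as required for sieving by the primes up to x only.\<close>
    have "K \<le> Y * tent b (t - ln (real n))" by (simp add: K_def)
    hence "real n * K \<le> x"
      using kernel_condition_iff[OF \<theta> b z x t Y K0, of "real n"] n by simp
    moreover have "1 * K \<le> real n * K" using n K0 by (intro mult_right_mono) auto
    ultimately have Kx: "K \<le> x" by simp
    have "K / real (kernel n) \<le> K / 1" using K0 kernel_pos[of n] by (intro divide_left_mono) auto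
    hence "K / real (kernel n) \<le> x" using Kx by simp
    from bij_betw_same_card[OF kernel_fiber[OF n refl this]]
    have "card (sieve_set (primes_upto x) (prime_factors n) (K / real (kernel n))) =
          card {m. m > 0 \<and> ?f m = n \<and> real (kernel m) \<le> K}" using k0 by simp
    also have "{m. m > 0 \<and> ?f m = n \<and> real (kernel m) \<le> K} = {m. m \<in> ?S \<and> ?f m = n}"
    proof -
      have "real (kernel m) \<le> K \<longleftrightarrow> real m \<le> x \<and> real (kernel m) \<le> z * real m powr \<theta>" if "m > 0" "?f m = n" for m
      proof -
        have "real m = real n * real (kernel m)" using fm(1)[OF that(1)] that(2) by (metis of_nat_mult)
        thus ?thesis using kernel_condition_iff[OF \<theta> b z x t Y, of "real (kernel m)" "real n"] n kernel_pos[of m]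
          by (simp add: K_def)
      qed
      thus ?thesis by auto
    qed
    finally show "(\<Sum>m | m \<in> ?S \<and> ?f m = n. 1) = real (card (sieve_set (primes_upto x) (prime_factors n) (Y * tent b (t - ln (real n)) / real (kernel n))))"
      by (simp add: K_def)
  qed simp
  finally show ?thesis .
qed

lemma min_le_powr: "v > 0 \<Longrightarrow> 0 \<le> \<rho> \<Longrightarrow> \<rho> \<le> 1 \<Longrightarrow> min 1 v \<le> v powr \<rho>" for v \<rho> :: real
proof (cases "v \<le> 1")
  case True
  assume "v > 0" "0 \<le> \<rho>" "\<rho> \<le> 1"
  hence "v powr 1 \<le> v powr \<rho>" using True by (intro powr_mono') auto
  thus ?thesis using True \<open>v > 0\<close> by simp
next
  case False
  assume "0 \<le> \<rho>"
  thus ?thesis using False ge_one_powr_ge_zero[of v \<rho>] by simp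
qed

lemma kernel_weight_times_kernel:
  "(\<Prod>q\<in>prime_factors n. real q / (real q + 1)) / real (kernel n) = kernel_weight n"
proof -
  have "(\<Prod>q\<in>prime_factors n. real q / (real q + 1)) = kernel_weight n * real (kernel n)"
    unfolding kernel_weight_def kernel_def of_nat_prod prod.distrib[symmetric] by simp
  thus ?thesis using kernel_pos[of n] by simp
qed

text \<open>The sieve error is at most both \<open>X\<close> and \<open>C k\<^sup>2 X\<^bsup>3/4\<^esup>\<close>; the geometric mean with exponent
  \<open>4 l / 9\<close> on the second bound leaves exactly the factor \<open>k\<^sup>l\<close> that the tilted sums can absorb.\<close>

lemma sieve_interpolated_error:
  "\<exists>C\<ge>1. \<forall>R n y s l. n \<in> coprime_upto {} R \<longrightarrow> s \<le> 0 \<longrightarrow> 0 \<le> l \<longrightarrow> l \<le> 1 \<longrightarrow>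
     \<bar>real (card (sieve_set (primes_upto (exp R)) (prime_factors n) (exp y * exp s / real (kernel n))))
       - sieve_density (primes_upto (exp R)) * (exp y * exp s * kernel_weight n)\<bar>
     \<le> C * (exp y * exp (- (l / 9 * y))) * (\<Prod>p\<in>primes_upto (exp R). 1 + 1 / real p) *
        (kernel_weight n * tilt (primes_upto (exp R)) l n * exp (s / 2))"
proof -
  obtain C where C: "C \<ge> 1" "\<And>P Q X. finite P \<Longrightarrow> (\<forall>p\<in>P. prime p) \<Longrightarrow> Q \<subseteq> P \<Longrightarrow> X \<ge> 0 \<Longrightarrow>
     \<bar>real (card (sieve_set P Q X)) - sieve_density P * (\<Prod>q\<in>Q. real q / (real q + 1)) * X\<bar> \<le> C * (\<Prod>q\<in>Q. (real q)^2) * X powr (3/4)"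
    using sieve_error by blast
  have "\<bar>real (card (sieve_set (primes_upto (exp R)) (prime_factors n) (exp y * exp s / real (kernel n))))
       - sieve_density (primes_upto (exp R)) * (exp y * exp s * kernel_weight n)\<bar>
     \<le> C * (exp y * exp (- (l / 9 * y))) * (\<Prod>p\<in>primes_upto (exp R). 1 + 1 / real p) *
        (kernel_weight n * tilt (primes_upto (exp R)) l n * exp (s / 2))"
    if n: "n \<in> coprime_upto {} R" and s: "s \<le> 0" and l: "0 \<le> l" "l \<le> 1" for R n y s l
  proof -
    define P where "P = primes_upto (exp R)"
    define k where "k = real (kernel n)"
    define X where "X = exp y * exp s / k"
    define Q where "Q = prime_factors n"
    have n': "n > 0" "ln (real n) \<le> R" using n by (auto simp: coprime_upto_def)
    have k1: "k \<ge> 1" unfolding k_def using kernel_pos[of n] by simp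
    have X0: "X > 0" using k1 by (simp add: X_def)
    have "real n \<le> exp R" using n' by (metis exp_le_cancel_iff exp_ln of_nat_0_less_iff)
    hence QP: "Q \<subseteq> P" unfolding Q_def P_def primes_upto_def using n' by (auto simp: in_prime_factors_iff dest!: dvd_imp_le)
    have P: "finite P" "\<forall>p\<in>P. prime p" by (auto simp: P_def primes_upto_def)
    let ?c = "real (card (sieve_set P Q X))"
    define M where "M = sieve_density P * (\<Prod>q\<in>Q. real q / (real q + 1)) * X"
    have sd: "0 \<le> sieve_density P" "sieve_density P \<le> 1" using sieve_density_bounds[OF P(1)] P(2) by auto
    have M: "M = sieve_density P * (exp y * exp s * kernel_weight n)"
      unfolding M_def X_def Q_def k_def kernel_weight_times_kernel[symmetric] by simp
    have "0 \<le> (\<Prod>q\<in>Q. real q / (real q + 1))" "(\<Prod>q\<in>Q. real q / (real q + 1)) \<le> 1"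
      by (auto intro!: prod_nonneg prod_le_1)
    hence "0 \<le> sieve_density P * (\<Prod>q\<in>Q. real q / (real q + 1))" "sieve_density P * (\<Prod>q\<in>Q. real q / (real q + 1)) \<le> 1"
      using sd by (auto intro: mult_le_one)
    hence "0 \<le> M" "M \<le> 1 * X" unfolding M_def using X0 by (auto intro: mult_right_mono simp del: mult_1_left)
    moreover have "0 \<le> ?c" "?c \<le> X" using X0 by (auto intro: sieve_set_le)
    ultimately have b1: "\<bar>?c - M\<bar> \<le> X" by linarith
    have pk: "(\<Prod>q\<in>Q. (real q)^2) = k^2" unfolding k_def Q_def kernel_def by (simp add: prod_power_distrib)
    have b2: "\<bar>?c - M\<bar> \<le> C * k^2 * X powr (3/4)" unfolding M_def pk[symmetric] using C(2)[OF P QP] X0 by simp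
    define v where "v = k^2 * X powr (-1/4)"
    have v0: "v > 0" using k1 X0 by (simp add: v_def)
    have Xv: "X * v = k^2 * X powr (3/4)"
    proof -
      have "X powr (3/4) = X powr (1 + -1/4)" by simp
      also have "\<dots> = X powr 1 * X powr (-1/4)" by (rule powr_add)
      also have "X powr 1 = X" using X0 by simp
      finally show ?thesis unfolding v_def by (simp only: mult_ac)
    qed
    have b3: "\<bar>?c - M\<bar> \<le> C * X * min 1 v"
    proof (cases "v \<le> 1")
      case True
      have "\<bar>?c - M\<bar> \<le> C * (X * v)" unfolding Xv using b2 by (simp add: mult.assoc)
      thus ?thesis using True by (simp add: mult.assoc)
    next
      case False
      have "1 * X \<le> C * X" using C(1) X0 by (intro mult_right_mono) auto
      thus ?thesis using False b1 by simp
    qed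
    \<comment> \<open>With X = exp (y + s) / k and v = k^2 X^(-1/4), the product X v^\<rho> contains
      k to the power 9 \<rho> / 4 - 1 = l - 1 and exp y to the power 1 - \<rho> / 4 = 1 - l /
      9.\<close>
    define \<rho> where "\<rho> = 4 * l / 9"
    have "min 1 v \<le> v powr \<rho>" using v0 l by (intro min_le_powr) (auto simp: \<rho>_def)
    hence "(C * X) * min 1 v \<le> (C * X) * v powr \<rho>" using C(1) X0 by (intro mult_left_mono) auto
    hence "\<bar>?c - M\<bar> \<le> C * (X * v powr \<rho>)" using b3 by (simp only: mult.assoc)
    also have "X * v powr \<rho> \<le> (exp y * exp (- (l / 9 * y))) * (k powr l / k) * exp (s / 2)"
    proof -
      define \<kappa> where "\<kappa> = ln k"
      have k: "k = exp \<kappa>" using k1 by (simp add: \<kappa>_def)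
      have X: "X = exp (y + s - \<kappa>)" unfolding X_def k by (simp add: exp_add exp_diff)
      have v: "v = exp (2 * \<kappa> - (y + s - \<kappa>) / 4)"
      proof -
        have "X powr (-1/4) = exp ((-1/4) * (y + s - \<kappa>))" unfolding X by (simp add: powr_def)
        moreover have "k^2 = exp (2 * \<kappa>)" unfolding k by (simp add: power2_eq_square exp_add[symmetric])
        ultimately have "v = exp (2 * \<kappa> + (-1/4) * (y + s - \<kappa>))" unfolding v_def exp_add by (simp only:)
        also have "2 * \<kappa> + (-1/4) * (y + s - \<kappa>) = 2 * \<kappa> - (y + s - \<kappa>) / 4" by linarith
        finally show ?thesis .
      qed
      have "X * v powr \<rho> = exp ((y + s - \<kappa>) + \<rho> * (2 * \<kappa> - (y + s - \<kappa>) / 4))"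
        unfolding X v by (simp add: powr_def exp_add[symmetric])
      also have "(y + s - \<kappa>) + \<rho> * (2 * \<kappa> - (y + s - \<kappa>) / 4) = y - l / 9 * y + (l * \<kappa> - \<kappa>) + (1 - l / 9) * s"
        unfolding \<rho>_def by (simp add: field_simps)
      also have "exp \<dots> \<le> exp (y - l / 9 * y + (l * \<kappa> - \<kappa>) + s / 2)"
      proof -
        \<comment> \<open>As s \<le> 0, giving away up to half of the tent exponent makes this
          factor independent of l.\<close>
        have "(1 - l / 9) * s \<le> (1/2) * s" using l s by (intro mult_right_mono_neg) auto
        thus ?thesis by simp
      qed
      also have "\<dots> = (exp y * exp (- (l / 9 * y))) * (k powr l / k) * exp (s / 2)"
        unfolding k by (simp add: powr_def exp_add[symmetric] exp_diff[symmetric])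
      finally show ?thesis .
    qed
    also have "k powr l / k \<le> kernel_weight n * tilt P l n * (\<Prod>p\<in>P. 1 + 1 / real p)"
    proof -
      have tk: "tilt P l n = k powr l"
      proof -
        have "P \<inter> prime_factors n = prime_factors n" using QP by (auto simp: Q_def)
        hence "tilt P l n = (\<Prod>p\<in>prime_factors n. real p powr l)" by (simp add: tilt_def)
        also have "\<dots> = k powr l" unfolding k_def kernel_def of_nat_prod by (simp add: prod_powr_distrib)
        finally show ?thesis .
      qed
      \<comment> \<open>Replacing 1 / k(n) by the weight costs the product of 1 + 1 / q over q | n;
        extended to all of P it is still only a power of R.\<close>
      have "1 / k = kernel_weight n * (\<Prod>q\<in>Q. 1 + 1 / real q)"
      proof -
        have "kernel_weight n * (\<Prod>q\<in>Q. 1 + 1 / real q) = (\<Prod>q\<in>Q. 1 / real q)"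
          unfolding kernel_weight_def Q_def prod.distrib[symmetric]
        proof (rule prod.cong)
          fix q assume "q \<in> prime_factors n"
          hence "real q > 0" by (auto simp: in_prime_factors_iff prime_gt_0_nat)
          thus "1 / (real q + 1) * (1 + 1 / real q) = 1 / real q" by (simp add: divide_simps)
        qed simp
        thus ?thesis by (simp add: k_def kernel_def Q_def prod_dividef)
      qed
      also have "(\<Prod>q\<in>Q. 1 + 1 / real q) \<le> (\<Prod>p\<in>P. 1 + 1 / real p)"
      proof -
        have "(\<Prod>p\<in>P. 1 + 1 / real p) = (\<Prod>p\<in>P - Q. 1 + 1 / real p) * (\<Prod>q\<in>Q. 1 + 1 / real q)"
          by (rule prod.subset_diff[OF QP P(1)])
        moreover have "1 * (\<Prod>q\<in>Q. 1 + 1 / real q) \<le> (\<Prod>p\<in>P - Q. 1 + 1 / real p) * (\<Prod>q\<in>Q. 1 + 1 / real q)"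
          by (intro mult_right_mono prod_ge_1 prod_nonneg) auto
        ultimately show ?thesis by simp
      qed
      finally have "1 / k \<le> kernel_weight n * (\<Prod>p\<in>P. 1 + 1 / real p)" by (simp add: mult_left_mono)
      hence "(1 / k) * k powr l \<le> (kernel_weight n * (\<Prod>p\<in>P. 1 + 1 / real p)) * k powr l" by (intro mult_right_mono) auto
      thus ?thesis unfolding tk by (simp add: mult_ac)
    qed
    finally have "\<bar>?c - M\<bar> \<le> C * ((exp y * exp (- (l / 9 * y))) * (kernel_weight n * tilt P l n * (\<Prod>p\<in>P. 1 + 1 / real p)) * exp (s / 2))"
      using C(1) by (simp add: mult_left_mono mult_right_mono)
    also have "\<dots> = C * (exp y * exp (- (l / 9 * y))) * (\<Prod>p\<in>P. 1 + 1 / real p) * (kernel_weight n * tilt P l n * exp (s / 2))"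
      by (simp only: mult_ac)
    finally show ?thesis unfolding M unfolding P_def Q_def X_def k_def .
  qed
  thus ?thesis using C(1) by (intro exI[of _ C] conjI allI impI) simp_all
qed

text \<open>Windows above t decay like exp (- i / 2), half the tent exponent, against growth exp (i
  / 4). The last window may reach up to R + 1 and \<open>decay_rate\<close> is decreasing, so a tilt
  below its value at R + 1 is admissible for every window.\<close>

lemma tilted_tent_sum_le:
  assumes b: "b > 0"
  shows "\<forall>\<^sub>F t in at_top. \<forall>R l. t \<le> R \<longrightarrow> 0 < l \<longrightarrow> l \<le> decay_rate (R + 1) \<longrightarrow>
     (\<Sum>n\<in>coprime_upto {} R. kernel_weight n * tilt (primes_upto (exp R)) l n * exp (min (t - ln (real n)) (- (b * (t - ln (real n)))) / 2))
     \<le> 42 * (\<Prod>p\<in>primes_upto (exp R). 1 + 1 / real p) * weight_sum {} t"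
proof -
  have ev1: "\<forall>\<^sub>F t in at_top. \<forall>Q\<in>{{}, {2}}. \<forall>s\<ge>0. weight_sum Q (t + s) \<le> 2 * exp (1/4 * s) * weight_sum Q t"
    by (rule weight_sum_growth) auto
  have ev2: "\<forall>\<^sub>F t::real in at_top. ln t \<ge> 6" by real_asymp
  show ?thesis
    using ev1 ev2 eventually_gt_at_top[of 1]
  proof eventually_elim
    case (elim t)
    show ?case
    proof (intro allI impI)
      fix R l :: real assume R: "t \<le> R" and l: "0 < l" "l \<le> decay_rate (R + 1)"
      define P where "P = primes_upto (exp R)"
      define g where "g n = kernel_weight n * tilt P l n" for n
      define D where "D = (\<Prod>p\<in>P. 1 + 1 / real p)"
      have g0: "g n \<ge> 0" for n by (simp add: g_def)
      have D0: "D \<ge> 0" unfolding D_def by (intro prod_nonneg) auto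
      let ?U = "coprime_upto {}" and ?W = "weight_sum {} t"
      let ?\<phi> = "\<lambda>n. exp (min (t - ln (real n)) (- (b * (t - ln (real n)))) / 2)"
      have A: "(\<Sum>n\<in>?U u. g n) \<le> 2 * weight_sum {} u * D" if u: "t \<le> u" "u \<le> R + 1" for u
      proof -
        have u1: "u > 1" "ln u \<ge> 6"
        proof -
          show "u > 1" using u elim by linarith
          have "ln t \<le> ln u" using u elim by (intro ln_mono) auto
          thus "ln u \<ge> 6" using elim by linarith
        qed
        have "decay_rate (R + 1) \<le> decay_rate u"
        proof -
          have "root_scale u \<le> root_scale (R + 1)" using u u1 by (intro root_scale_mono) auto
          thus ?thesis unfolding decay_rate_def using root_scale_pos[OF u1(1)] by (intro divide_left_mono) auto
        qed
        hence lu: "l \<le> decay_rate u" using l by linarith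
        have "(\<Sum>n\<in>?U u. g n) \<le> 2 * weight_sum {} u * exp (- (l * (u - u))) * (\<Prod>p\<in>P. 1 + 1 / (real p + 1))"
          unfolding g_def using u1 lu l by (intro tilted_weight_sum_le) (auto simp: P_def primes_upto_def)
        also have "\<dots> = 2 * weight_sum {} u * (\<Prod>p\<in>P. 1 + 1 / (real p + 1))" by simp
        also have "\<dots> \<le> 2 * weight_sum {} u * D"
          unfolding D_def by (intro mult_left_mono prod_mono conjI add_left_mono divide_left_mono)
             (auto simp: P_def primes_upto_def prime_gt_0_nat)
        finally show ?thesis .
      qed
      have "(\<Sum>n\<in>?U R. g n * ?\<phi> n) = (\<Sum>n\<in>?U R - ?U t. g n * ?\<phi> n) + (\<Sum>n\<in>?U R \<inter> ?U t. g n * ?\<phi> n)"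
        by (subst sum.Int_Diff[of _ _ "?U t"]) auto
      also have "(\<Sum>n\<in>?U R \<inter> ?U t. g n * ?\<phi> n) \<le> 2 * D * ?W"
      proof -
        have "(\<Sum>n\<in>?U R \<inter> ?U t. g n * ?\<phi> n) \<le> (\<Sum>n\<in>?U R \<inter> ?U t. g n * 1)"
          using min_tent_nonpos[OF b] g0 by (intro sum_mono mult_left_mono) auto
        also have "\<dots> \<le> (\<Sum>n\<in>?U t. g n)" using g0 by (simp, intro sum_mono2) auto
        also have "\<dots> \<le> 2 * ?W * D" using R by (intro A) auto
        finally show ?thesis by (simp add: mult_ac)
      qed
      also have "(\<Sum>n\<in>?U R - ?U t. g n * ?\<phi> n) \<le> 40 * D * ?W"
      proof -
        define I where "I = nat \<lceil>R - t\<rceil>"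
        have "(\<Sum>n\<in>?U R - ?U t. g n * ?\<phi> n) \<le> (\<Sum>i<I. exp (- (real i / 2)) * (\<Sum>m\<in>?U (t + real i + 1) - ?U (t + real i). g m))"
        proof (rule sum_over_windows_le)
          fix m assume m: "m \<in> ?U R - ?U t"
          hence m': "ln (real m) > t" "ln (real m) \<le> R" by (auto simp: coprime_upto_def)
          then obtain i where i: "t + real i < ln (real m)" "ln (real m) \<le> t + real i + 1" "real i < ln (real m) - t"
            using upper_window_index by blast
          have "i < I" unfolding I_def using i m' by linarith
          moreover have "m \<in> ?U (t + real i + 1) - ?U (t + real i)" using i m by (auto simp: coprime_upto_def)
          moreover have "?\<phi> m \<le> exp (- (real i / 2))"
          proof -
            have "min (t - ln (real m)) (- (b * (t - ln (real m)))) \<le> t - ln (real m)" by (rule min.cobounded1)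
            moreover have "q / 2 \<le> - (r / 2)" if "q \<le> t - L" "r < L - t" for q r L :: real using that by linarith
            ultimately have "min (t - ln (real m)) (- (b * (t - ln (real m)))) / 2 \<le> - (real i / 2)" using i(3) by blast
            thus ?thesis by (simp only: exp_le_cancel_iff)
          qed
          ultimately show "\<exists>i<I. m \<in> ?U (t + real i + 1) - ?U (t + real i) \<and> ?\<phi> m \<le> exp (- (real i / 2))" by blast
        qed (use g0 in auto)
        also have "\<dots> \<le> (\<Sum>i<I. (8 * D * ?W) * exp (- (1/4 * real i)))"
        proof (rule sum_mono)
          fix i assume "i \<in> {..<I}"
          hence iR: "real i < R - t" unfolding I_def by simp linarith
          let ?v = "t + real i + 1"
          have "(\<Sum>m\<in>?U ?v - ?U (t + real i). g m) \<le> (\<Sum>m\<in>?U ?v. g m)" using g0 by (intro sum_mono2) auto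
          also have "\<dots> \<le> 2 * weight_sum {} ?v * D" using iR by (intro A) auto
          also have "\<dots> \<le> 2 * (2 * exp (1/4 * (real i + 1)) * ?W) * D"
          proof (intro mult_right_mono mult_left_mono)
            have "weight_sum {} (t + (real i + 1)) \<le> 2 * exp (1/4 * (real i + 1)) * ?W"
              using elim(1)[rule_format, of "{}" "real i + 1"] by simp
            thus "weight_sum {} ?v \<le> 2 * exp (1/4 * (real i + 1)) * ?W" by (simp add: add_ac)
          qed (use D0 in auto)
          also have "\<dots> = (4 * D * ?W) * exp (1/4 * (real i + 1))" by simp
          also have "\<dots> \<le> (4 * D * ?W) * (2 * exp (1/4 * real i))"
          proof (intro mult_left_mono)
            have "exp (1/4 * (real i + 1)) = exp (1/4) * exp (1/4 * real i)" unfolding exp_add[symmetric] by (simp add: field_simps)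
            also have "exp (1/4) \<le> (2::real)" using exp_bound[of "1/4"] by (simp add: power2_eq_square)
            finally show "exp (1/4 * (real i + 1)) \<le> 2 * exp (1/4 * real i)" by simp
          qed (use D0 in auto)
          finally have "exp (- (real i / 2)) * (\<Sum>m\<in>?U ?v - ?U (t + real i). g m) \<le> exp (- (real i / 2)) * ((4 * D * ?W) * (2 * exp (1/4 * real i)))"
            by (intro mult_left_mono) auto
          also have "\<dots> = (8 * D * ?W) * (exp (- (real i / 2)) * exp (1/4 * real i))" by simp
          also have "exp (- (real i / 2)) * exp (1/4 * real i) = exp (- (1/4 * real i))" unfolding exp_add[symmetric] by simp
          finally show "exp (- (real i / 2)) * (\<Sum>m\<in>?U ?v - ?U (t + real i). g m) \<le> (8 * D * ?W) * exp (- (1/4 * real i))" .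
        qed
        also have "\<dots> = (8 * D * ?W) * (\<Sum>i<I. exp (- (1/4 * real i)))" by (simp add: sum_distrib_left)
        also have "\<dots> \<le> (8 * D * ?W) * 5"
        proof (intro mult_left_mono)
          have "(\<Sum>i<I. exp (- (1/4 * real i))) \<le> (\<Sum>i\<in>insert 0 {1..I}. exp (- (1/4 * real i)))"
            by (intro sum_mono2) auto
          also have "\<dots> = 1 + (\<Sum>i=1..I. exp (- (1/4 * real i)))" by simp
          also have "(\<Sum>i=1..I. exp (- (1/4 * real i))) \<le> 1 / (1/4)" by (rule sum_exp_multiples_le) simp
          finally show "(\<Sum>i<I. exp (- (1/4 * real i))) \<le> 5" by simp
        qed (use D0 in auto)
        finally show ?thesis by (simp add: mult_ac)
      qed
      finally have "(\<Sum>n\<in>?U R. g n * ?\<phi> n) \<le> 42 * D * ?W" by simp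
      thus "(\<Sum>n\<in>?U R. kernel_weight n * tilt (primes_upto (exp R)) l n * ?\<phi> n) \<le> 42 * (\<Prod>p\<in>primes_upto (exp R). 1 + 1 / real p) * ?W"
        unfolding g_def P_def D_def .
    qed
  qed
qed

text \<open>A crude return to odd n, affordable because it is applied to an error that is smaller
  than any power of R.\<close>

lemma weight_sum_le_odd:
  assumes "t \<ge> 0"
  shows "weight_sum {} t \<le> (1 + t) * weight_sum {2} t"
proof -
  define J where "J = nat \<lfloor>t / ln 2\<rfloor>"
  have J: "t < real (Suc J) * ln (real 2)"
  proof -
    have "t / ln 2 < real (Suc J)" using assms unfolding J_def by (simp add: floor_less_iff) linarith
    thus ?thesis by (simp add: pos_divide_less_eq)
  qed
  have Jt: "real J \<le> 2 * t"
  proof -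
    have "real J \<le> t / ln 2" unfolding J_def using assms by (simp add: of_nat_floor)
    also have "\<dots> \<le> t / (1/2)" using assms ln2_ge_half by (intro divide_left_mono) auto
    finally show ?thesis by simp
  qed
  have "weight_sum {} t = weight_sum {2} t + (1 / (real 2 + 1)) * (\<Sum>j=1..J. weight_sum {2} (t - real j * ln (real 2)))"
    by (rule weight_sum_split) (use J in auto)
  also have "(\<Sum>j=1..J. weight_sum {2} (t - real j * ln (real 2))) \<le> (\<Sum>j=1..J. weight_sum {2} t)"
    by (intro sum_mono weight_sum_mono) auto
  also have "(\<Sum>j=1..J. weight_sum {2} t) = real J * weight_sum {2} t" by simp
  also have "\<dots> \<le> 2 * t * weight_sum {2} t" using Jt by (intro mult_right_mono) auto
  finally have "weight_sum {} t \<le> weight_sum {2} t + (1/3) * (2 * t * weight_sum {2} t)" by simp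
  moreover have "t * weight_sum {2} t \<ge> 0" using assms by simp
  ultimately show ?thesis by (simp add: distrib_right)
qed

section \<open>Asymptotics\<close>

text \<open>Apart from the factor z, the main term depends only on R = ln x:
  \<open>weight_sum\<close> is taken at (1 - \<theta>) R instead of t, and the sampling parameter is
  the cube of (1 - \<theta>) R, rounded up, which lies between t^2 and t^4 for every t within a
  factor 2 of (1 - \<theta>) R.\<close>

lemma B_count_asymp:
  fixes \<theta> A b :: real
  assumes \<theta>: "0 < \<theta>" "\<theta> < 1" and A: "A > 0" and b: "b = \<theta> / (1 - \<theta>)"
  shows "\<exists>C>0. \<forall>\<^sub>F R in at_top. \<forall>z>0. \<bar>ln z\<bar> \<le> A * ln R \<longrightarrow>
     \<bar>real (B_count \<theta> (exp R) z) - z * (exp (\<theta> * R) * (sieve_density (primes_upto (exp R)) *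
        (fejer_mean_value b (nat \<lceil>((1 - \<theta>) * R)^3\<rceil>) / 3) * weight_sum {2} ((1 - \<theta>) * R)))\<bar>
     \<le> C * (z * exp (\<theta> * R) * sqrt (ln R / R) * weight_sum {2} ((1 - \<theta>) * R))"
proof -
  define w where "w = 1 - \<theta>"
  have w: "w > 0" "w < 1" using \<theta> by (auto simp: w_def)
  have b0: "b > 0" using \<theta> b by simp
  obtain C1 where C1: "C1 > 0" and ev1: "\<forall>\<^sub>F t in at_top. \<forall>R N. R \<ge> t + ln t \<longrightarrow> t^2 \<le> real N \<longrightarrow> real N \<le> t^4 \<longrightarrow>
     \<bar>tent_sum b R t - fejer_mean_value b N / 3 * weight_sum {2} t\<bar> \<le> C1 * ln t / root_scale t * weight_sum {2} t"
    using tent_sum_asymp[OF b0] by blast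
  obtain C2 where C2: "C2 > 0" and ev2: "\<forall>\<^sub>F t in at_top. \<forall>Q\<in>{{}, {2}}. \<forall>u. 0 \<le> u \<longrightarrow> u \<le> t / 2 \<longrightarrow>
     weight_sum Q t - weight_sum Q (t - u) \<le> C2 * (1 + u) / root_scale t * weight_sum Q t"
    using weight_sum_window by blast
  obtain C3 where C3: "C3 \<ge> 1" "\<And>R n y s l. n \<in> coprime_upto {} R \<Longrightarrow> s \<le> 0 \<Longrightarrow> 0 \<le> l \<Longrightarrow> l \<le> 1 \<Longrightarrow>
     \<bar>real (card (sieve_set (primes_upto (exp R)) (prime_factors n) (exp y * exp s / real (kernel n))))
       - sieve_density (primes_upto (exp R)) * (exp y * exp s * kernel_weight n)\<bar>
     \<le> C3 * (exp y * exp (- (l / 9 * y))) * (\<Prod>p\<in>primes_upto (exp R). 1 + 1 / real p) *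
        (kernel_weight n * tilt (primes_upto (exp R)) l n * exp (s / 2))"
    using sieve_interpolated_error by blast
  obtain C5 where C5: "C5 > 0" "\<And>t. t \<ge> 2 \<Longrightarrow> (\<Prod>p\<in>primes_upto (exp t). 1 + 1 / real p) \<le> t powr C5"
    using prod_primes_le by blast
  note ev4 = tilted_tent_sum_le[OF b0]
  obtain T where T1: "\<And>t R N. t \<ge> T \<Longrightarrow> R \<ge> t + ln t \<Longrightarrow> t^2 \<le> real N \<Longrightarrow> real N \<le> t^4 \<Longrightarrow>
       \<bar>tent_sum b R t - fejer_mean_value b N / 3 * weight_sum {2} t\<bar> \<le> C1 * ln t / root_scale t * weight_sum {2} t"
    and T2: "\<And>t u. t \<ge> T \<Longrightarrow> 0 \<le> u \<Longrightarrow> u \<le> t / 2 \<Longrightarrow>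
       weight_sum {2} t - weight_sum {2} (t - u) \<le> C2 * (1 + u) / root_scale t * weight_sum {2} t"
    and T4: "\<And>t R l. t \<ge> T \<Longrightarrow> t \<le> R \<Longrightarrow> 0 < l \<Longrightarrow> l \<le> decay_rate (R + 1) \<Longrightarrow>
     (\<Sum>n\<in>coprime_upto {} R. kernel_weight n * tilt (primes_upto (exp R)) l n * exp (min (t - ln (real n)) (- (b * (t - ln (real n)))) / 2))
     \<le> 42 * (\<Prod>p\<in>primes_upto (exp R). 1 + 1 / real p) * weight_sum {} t"
    using eventually_conj[OF ev1 eventually_conj[OF ev2 ev4]] unfolding eventually_at_top_linorder by blast
  define G where "G = 2 / sqrt w"
  have G: "G > 0" using w by (simp add: G_def)
  define Cb where "Cb = (1 / (1 - 2 powr (-b)) + 2) / 3"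
  have Cb: "Cb > 0" unfolding Cb_def using two_powr_minus_less_1[OF b0] by (intro divide_pos_pos add_pos_pos) auto
  define C6 where "C6 = C2 * ((1 + A) * G)"
  have C6: "C6 > 0" using C2 A G by (simp add: C6_def)
  define C where "C = 2 + 2 * (C1 * (2 * G)) + 2 * Cb * C6"
  have C0: "C > 0" unfolding C_def using C1 G Cb C6 by (intro add_pos_pos mult_pos_pos) auto
  have ev7: "\<forall>\<^sub>F R in at_top. C6 * sqrt (ln R / R) < 1/2"
  proof (rule order_tendstoD(2))
    show "((\<lambda>R. C6 * sqrt (ln R / R)) \<longlongrightarrow> 0) at_top" by real_asymp
  qed auto
  \<comment> \<open>The tilt has order 1 / \<surd>(R ln R) and y has order R, so the exponential is
    about exp (- c \<surd>(R / ln R)) and beats every power of R.\<close>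
  have ev8: "\<forall>\<^sub>F R in at_top. C3 * 42 * exp (- (ln 2 / (64 * sqrt ((R + 1) * ln (R + 1))) / 9 * (\<theta> * R / 2))) * (R powr C5 * R powr C5) * (1 + 2 * R) \<le> sqrt (ln R / R)"
    using \<theta> C3(1) C5(1) by real_asymp
  have ev9: "\<forall>\<^sub>F R in at_top. ln 2 / (64 * sqrt ((R + 1) * ln (R + 1))) \<le> (1::real)" by real_asymp
  have ev10: "\<forall>\<^sub>F R in at_top. A * ln R \<le> w * R / 4" using w A by real_asymp
  have ev11: "\<forall>\<^sub>F R in at_top. A * ln R + ln (2 * R) \<le> \<theta> * R" using \<theta> A by real_asymp
  have ev12: "\<forall>\<^sub>F R in at_top. ln (w * R / 2) \<ge> ln R / 2" using w by real_asymp
  have ev13: "\<forall>\<^sub>F R in at_top. A * ln R \<le> \<theta> * R / 2" using \<theta> A by real_asymp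
  have ev14: "\<forall>\<^sub>F R in at_top. w * R / 2 \<ge> max T 16" using w by real_asymp
  have ev15: "\<forall>\<^sub>F R in at_top. ln R \<ge> (1::real)" by real_asymp
  have "\<forall>\<^sub>F R in at_top. \<forall>z>0. \<bar>ln z\<bar> \<le> A * ln R \<longrightarrow>
     \<bar>real (B_count \<theta> (exp R) z) - z * (exp (\<theta> * R) * (sieve_density (primes_upto (exp R)) *
        (fejer_mean_value b (nat \<lceil>(w * R)^3\<rceil>) / 3) * weight_sum {2} (w * R)))\<bar>
     \<le> C * (z * exp (\<theta> * R) * sqrt (ln R / R) * weight_sum {2} (w * R))"
    using ev7 ev8 ev9 ev10 ev11 ev12 ev13 ev14 ev15 eventually_ge_at_top[of 2]
  proof eventually_elim
    case (elim R)
    show ?case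
    proof (intro allI impI)
      fix z :: real assume z: "z > 0" and zA: "\<bar>ln z\<bar> \<le> A * ln R"
      define \<eta> where "\<eta> = sqrt (ln R / R)"
      define t1 where "t1 = w * R"
      define t where "t = t1 - ln z"
      define N where "N = nat \<lceil>t1^3\<rceil>"
      define P where "P = primes_upto (exp R)"
      define M where "M = weight_sum {2} t1"
      define W where "W = weight_sum {2} t"
      define y where "y = \<theta> * R + ln z"
      define Y where "Y = exp (\<theta> * R) * z"
      define l where "l = decay_rate (R + 1)"
      define c where "c = fejer_mean_value b N / 3"
      define d where "d = sieve_density P"
      have R2: "R \<ge> 2" "ln R \<ge> 1" using elim by auto
      have \<eta>0: "\<eta> > 0" using R2 by (simp add: \<eta>_def)
      have Yy: "Y = exp y" using z by (simp add: Y_def y_def exp_add)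
      have Y0: "Y > 0" by (simp add: Yy)
      have t1: "t1 \<ge> 32" "t1 / 2 \<ge> T" "t1 \<le> R" using elim w R2 by (auto simp: t1_def mult_le_cancel_right1)
      have zt: "\<bar>ln z\<bar> \<le> t1 / 4" using elim zA by (simp add: t1_def)
      have t: "t \<ge> t1 / 2" "t \<le> 2 * t1" "t \<ge> T" "t \<ge> 16" "t \<le> R"
      proof -
        show "t \<ge> t1 / 2" "t \<le> 2 * t1" "t \<ge> T" "t \<ge> 16" unfolding t_def using zt t1 by linarith+
        have "t \<le> w * R + \<theta> * R / 2" unfolding t_def t1_def using zA elim by linarith
        also have "\<dots> \<le> w * R + \<theta> * R" using \<theta> R2 by simp
        also have "\<dots> = R" by (simp add: w_def algebra_simps)
        finally show "t \<le> R" .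
      qed
      have M0: "M \<ge> 0" "W \<ge> 0" by (auto simp: M_def W_def)
      \<comment> \<open>The quotient ln R / \<surd>(R ln R) is \<surd>(ln R / R); the bound is
        uniform over all cut-offs u \<ge> t1 / 2.\<close>
      have key: "a / root_scale u \<le> k * G * \<eta>" if a: "0 \<le> a" "a \<le> k * ln R" and u: "t1 / 2 \<le> u" for a k u
      proof -
        have "w * R * ln R / 4 = (w * R / 2) * (ln R / 2)" by simp
        also have "\<dots> \<le> u * ln u"
        proof (intro mult_mono)
          have "ln (w * R / 2) \<le> ln u" using u t1 by (intro ln_mono) (auto simp: t1_def)
          thus "ln R / 2 \<le> ln u" using elim by linarith
        qed (use u t1 R2 in \<open>auto simp: t1_def\<close>)
        finally have rs: "sqrt (w * R * ln R / 4) \<le> root_scale u" unfolding root_scale_def by (rule real_sqrt_le_mono)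
        have pos: "sqrt (w * R * ln R / 4) > 0" using w R2 by simp
        have k0: "k \<ge> 0"
        proof (rule ccontr)
          assume "\<not> k \<ge> 0"
          hence "k * ln R < 0" using R2 by (intro mult_neg_pos) auto
          thus False using a by linarith
        qed
        have "a / root_scale u \<le> (k * ln R) / sqrt (w * R * ln R / 4)"
          using a rs pos k0 R2 by (intro frac_le) auto
        also have "sqrt (w * R * ln R / 4) = sqrt w * (sqrt R * sqrt (ln R)) / 2" by (simp add: real_sqrt_mult real_sqrt_divide)
        also have "(k * ln R) / (sqrt w * (sqrt R * sqrt (ln R)) / 2) = k * G * \<eta>"
        proof -
          have "ln R = sqrt (ln R) * sqrt (ln R)" using R2 by simp
          hence "(k * ln R) / (sqrt w * (sqrt R * sqrt (ln R)) / 2) = (k * (sqrt (ln R) * sqrt (ln R))) / (sqrt w * (sqrt R * sqrt (ln R)) / 2)" by simp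
          moreover have "(k * (r * r)) / (sqrt w * (sqrt R * r) / 2) = k * (2 / sqrt w) * (r / sqrt R)" if "r > 0" for r
            using that by simp
          from this[of "sqrt (ln R)"] have "(k * (sqrt (ln R) * sqrt (ln R))) / (sqrt w * (sqrt R * sqrt (ln R)) / 2) = k * G * \<eta>"
            unfolding G_def \<eta>_def real_sqrt_divide using R2 by simp
          ultimately show ?thesis using R2 by simp
        qed
        finally show ?thesis .
      qed
      have window: "M - weight_sum {2} t \<le> C6 * \<eta> * M" if "t \<le> t1"
      proof -
        have "M - weight_sum {2} (t1 - ln z) \<le> C2 * (1 + ln z) / root_scale t1 * M"
          unfolding M_def using that zt t1 by (intro T2) (auto simp: t_def)
        also have "\<dots> = C2 * ((1 + ln z) / root_scale t1) * M" by simp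
        also have "\<dots> \<le> C2 * ((1 + A) * G * \<eta>) * M"
        proof (intro mult_right_mono mult_left_mono key)
          show "1 + ln z \<le> (1 + A) * ln R" using zA R2 by (simp add: distrib_right)
        qed (use that C2 M0 t1 in \<open>auto simp: t_def\<close>)
        finally show ?thesis by (simp add: C6_def t_def mult.assoc)
      qed
      \<comment> \<open>\<open>weight_sum_window\<close> compares with the value at the right end of
        the window. For t > t1 that is W, which has to be bounded by 2 M first, using C6 \<eta>
        \<le> 1/2.\<close>
      have window2: "W - M \<le> C6 * \<eta> * W" if "t > t1"
      proof -
        have "W - weight_sum {2} (t - (- ln z)) \<le> C2 * (1 + (- ln z)) / root_scale t * W"
          unfolding W_def using that zt t t1 by (intro T2) (auto simp: t_def)
        also have "\<dots> = C2 * ((1 + (- ln z)) / root_scale t) * W" by simp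
        also have "\<dots> \<le> C2 * ((1 + A) * G * \<eta>) * W"
        proof (intro mult_right_mono mult_left_mono key)
          show "1 + (- ln z) \<le> (1 + A) * ln R" using zA R2 by (simp add: distrib_right)
        qed (use that C2 M0 t in \<open>auto simp: t_def\<close>)
        finally show ?thesis by (simp add: C6_def M_def t_def mult.assoc)
      qed
      have small: "C6 * \<eta> \<le> 1/2" using elim by (simp add: \<eta>_def)
      have WM: "W \<le> 2 * M \<and> \<bar>W - M\<bar> \<le> 2 * (C6 * \<eta>) * M"
      proof (cases "t \<le> t1")
        case True
        have "W \<le> M" unfolding W_def M_def using True by (rule weight_sum_mono)
        moreover have "M - W \<le> C6 * \<eta> * M" using window[OF True] by (simp add: W_def)
        moreover have "C6 * \<eta> * M \<ge> 0" using C6 \<eta>0 M0 by simp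
        ultimately show ?thesis using M0 by (simp add: mult.assoc)
      next
        case False
        have a: "W - M \<le> C6 * \<eta> * W" using False by (intro window2) simp
        also have "\<dots> \<le> (1/2) * W" using small M0 by (intro mult_right_mono) auto
        finally have W2: "W \<le> 2 * M" by simp
        have "C6 * \<eta> * W \<le> C6 * \<eta> * (2 * M)" using W2 C6 \<eta>0 by (intro mult_left_mono) auto
        hence "W - M \<le> 2 * (C6 * \<eta>) * M" using a by simp
        moreover have "M \<le> W" unfolding W_def M_def using False by (intro weight_sum_mono) auto
        ultimately show ?thesis using W2 by simp
      qed
      have N: "t1^3 \<le> real N" "real N \<le> t1^3 + 1"
      proof -
        have "t1^3 \<ge> 0" using t1 by simp
        thus "t1^3 \<le> real N" "real N \<le> t1^3 + 1" unfolding N_def by linarith+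
      qed
      have N1: "N \<ge> 1"
      proof -
        have "1 \<le> t1^3" using t1 by (intro one_le_power) auto
        thus ?thesis using N by linarith
      qed
      have Nt: "t^2 \<le> real N" "real N \<le> t^4"
      proof -
        have "t^2 \<le> (2 * t1)^2" using t by (intro power_mono) auto
        also have "\<dots> = 4 * t1^2" by (simp add: power_mult_distrib)
        also have "\<dots> \<le> t1 * t1^2" using t1 by (intro mult_right_mono) auto
        also have "\<dots> = t1^3" by (simp add: power3_eq_cube power2_eq_square)
        finally show "t^2 \<le> real N" using N by linarith
        have "1 \<le> t1^3" using t1 by (intro one_le_power) auto
        hence "real N \<le> 2 * t1^3" using N by linarith
        also have "\<dots> \<le> (t1 / 16) * t1^3" using t1 by (intro mult_right_mono) auto
        also have "\<dots> = (t1 / 2)^4" by (simp add: power_divide power4_eq_xxxx power3_eq_cube)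
        also have "\<dots> \<le> t^4" using t t1 by (intro power_mono) auto
        finally show "real N \<le> t^4" .
      qed
      have d: "0 \<le> d" "d \<le> 1"
      proof -
        have "prime q" if "q \<in> P" for q using that by (simp add: P_def primes_upto_def)
        hence "1/2 \<le> sieve_density P" "sieve_density P \<le> 1" using sieve_density_bounds[of P] by (auto simp: P_def)
        thus "0 \<le> d" "d \<le> 1" by (simp_all add: d_def)
      qed
      have c: "0 \<le> c" "c \<le> Cb"
      proof -
        have "1 \<le> fejer_mean_value b N" "fejer_mean_value b N \<le> 1 / (1 - 2 powr (-b)) + 2"
          unfolding fejer_mean_value_def by (rule fejer_coeff_0_bounds(2,3)[OF b0 N1])+
        thus "0 \<le> c" "c \<le> Cb" unfolding c_def Cb_def by (linarith, intro divide_right_mono, auto)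
      qed
      have E1: "\<bar>tent_sum b R t - c * W\<bar> \<le> C1 * (2 * G * \<eta>) * W"
      proof -
        have lt: "ln t \<le> ln (2 * R)" using t t1 by (intro ln_mono) auto
        have "ln (2 * R) = ln 2 + ln R" using R2 by (simp add: ln_mult_pos)
        moreover have "ln 2 \<le> (1::real)" using ln_le_minus_one[of "2::real"] by simp
        ultimately have lt2: "ln t \<le> 2 * ln R" using lt R2 by linarith
        \<comment> \<open>The truncation at R lies far enough beyond t: the remaining \<theta> R = R
          - w R absorbs both A ln R and ln t.\<close>
        have "t \<le> w * R + A * ln R" unfolding t_def t1_def using zA by linarith
        moreover have "w * R + \<theta> * R = R" by (simp add: w_def algebra_simps)
        ultimately have "R \<ge> t + ln t" using lt elim by linarith
        hence "\<bar>tent_sum b R t - c * W\<bar> \<le> C1 * ln t / root_scale t * W"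
          unfolding c_def W_def using t Nt by (intro T1) auto
        also have "\<dots> = C1 * (ln t / root_scale t) * W" by simp
        also have "\<dots> \<le> C1 * (2 * G * \<eta>) * W"
          using C1 M0 t lt2 by (intro mult_right_mono mult_left_mono key) auto
        finally show ?thesis .
      qed
      \<comment> \<open>The total sieve error. The tilt l is taken as large as
        \<open>tilted_tent_sum_le\<close> permits, since the saving is exp (- l y / 9).\<close>
      have E2: "\<bar>real (B_count \<theta> (exp R) z) - d * (Y * tent_sum b R t)\<bar> \<le> Y * \<eta> * W"
      proof -
        let ?U = "coprime_upto {} R"
        let ?s = "\<lambda>n. min (t - ln (real n)) (- (b * (t - ln (real n))))"
        let ?D = "\<Prod>p\<in>P. 1 + 1 / real p"
        have D: "0 \<le> ?D" "?D \<le> R powr C5" using C5(2)[of R] R2 by (auto simp: P_def intro!: prod_nonneg)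
        have l: "0 < l" "l \<le> 1"
        proof -
          show "0 < l" unfolding l_def using R2 by (intro decay_rate_pos) auto
          show "l \<le> 1" unfolding l_def decay_rate_def root_scale_def using elim by simp
        qed
        have tt: "t = (1 - \<theta>) * R - ln z" by (simp add: t_def t1_def w_def)
        have "real (B_count \<theta> (exp R) z) = (\<Sum>n\<in>?U. real (card (sieve_set P (prime_factors n) (Y * tent b (t - ln (real n)) / real (kernel n)))))"
          unfolding P_def by (rule B_count_eq[OF \<theta> b z refl tt]) (simp add: Y_def)
        also have "\<dots> = (\<Sum>n\<in>?U. real (card (sieve_set P (prime_factors n) (exp y * exp (?s n) / real (kernel n)))))"
          by (simp only: tent_eq[OF b0] Yy)
        finally have B: "real (B_count \<theta> (exp R) z) = (\<Sum>n\<in>?U. real (card (sieve_set P (prime_factors n) (exp y * exp (?s n) / real (kernel n)))))" .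
        have "d * (Y * tent_sum b R t) = (\<Sum>n\<in>?U. d * (exp y * exp (?s n) * kernel_weight n))"
          unfolding tent_sum_def sum_distrib_left Yy tent_eq[OF b0] by (simp only: mult_ac)
        hence "\<bar>real (B_count \<theta> (exp R) z) - d * (Y * tent_sum b R t)\<bar> =
            \<bar>\<Sum>n\<in>?U. real (card (sieve_set P (prime_factors n) (exp y * exp (?s n) / real (kernel n)))) - d * (exp y * exp (?s n) * kernel_weight n)\<bar>"
          unfolding B by (simp only: sum_subtractf)
        also have "\<dots> \<le> (\<Sum>n\<in>?U. \<bar>real (card (sieve_set P (prime_factors n) (exp y * exp (?s n) / real (kernel n)))) - d * (exp y * exp (?s n) * kernel_weight n)\<bar>)"
          by (rule sum_abs)
        also have "\<dots> \<le> (\<Sum>n\<in>?U. C3 * (exp y * exp (- (l / 9 * y))) * ?D * (kernel_weight n * tilt P l n * exp (?s n / 2)))"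
          unfolding P_def d_def using l min_tent_nonpos[OF b0] by (intro sum_mono C3(2)) auto
        also have "\<dots> = C3 * (exp y * exp (- (l / 9 * y))) * ?D * (\<Sum>n\<in>?U. kernel_weight n * tilt P l n * exp (?s n / 2))"
          by (simp only: sum_distrib_left)
        also have "\<dots> \<le> C3 * (exp y * exp (- (l / 9 * y))) * ?D * (42 * ?D * weight_sum {} t)"
          unfolding P_def using t l C3(1) by (intro mult_left_mono T4) (auto simp: l_def intro!: mult_nonneg_nonneg prod_nonneg)
        also have "\<dots> = Y * W' * (C3 * 42 * exp (- (l / 9 * y)) * (?D * ?D))" if "W' = weight_sum {} t" for W'
          unfolding that Yy by (simp only: mult_ac)
        also have "Y * weight_sum {} t * (C3 * 42 * exp (- (l / 9 * y)) * (?D * ?D)) \<le>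
           Y * ((1 + 2 * R) * W) * (C3 * 42 * exp (- (l / 9 * (\<theta> * R / 2))) * (R powr C5 * R powr C5))"
        proof (intro mult_mono)
          have "weight_sum {} t \<le> (1 + t) * W" unfolding W_def using t by (intro weight_sum_le_odd) auto
          also have "\<dots> \<le> (1 + 2 * R) * W" using t R2 M0 by (intro mult_right_mono) auto
          finally show "weight_sum {} t \<le> (1 + 2 * R) * W" .
          have "\<theta> * R / 2 \<le> y" unfolding y_def using zA elim by linarith
          hence "l / 9 * (\<theta> * R / 2) \<le> l / 9 * y" using l by (intro mult_left_mono) auto
          thus "exp (- (l / 9 * y)) \<le> exp (- (l / 9 * (\<theta> * R / 2)))" by simp
        qed (use D Y0 C3(1) M0 R2 in \<open>auto intro!: mult_nonneg_nonneg\<close>)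
        also have "\<dots> = Y * W * (C3 * 42 * exp (- (l / 9 * (\<theta> * R / 2))) * (R powr C5 * R powr C5) * (1 + 2 * R))"
          by (simp only: mult_ac)
        also have "\<dots> \<le> Y * W * \<eta>"
        proof (intro mult_left_mono)
          show "C3 * 42 * exp (- (l / 9 * (\<theta> * R / 2))) * (R powr C5 * R powr C5) * (1 + 2 * R) \<le> \<eta>"
            using elim(2) unfolding l_def decay_rate_def root_scale_def \<eta>_def .
        qed (use Y0 M0 in auto)
        finally show ?thesis by (simp only: mult_ac)
      qed
      have "\<bar>real (B_count \<theta> (exp R) z) - Y * (d * c * M)\<bar> \<le>
         \<bar>real (B_count \<theta> (exp R) z) - d * (Y * tent_sum b R t)\<bar> + Y * (d * \<bar>tent_sum b R t - c * W\<bar>) + Y * (d * c * \<bar>W - M\<bar>)"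
      proof -
        have "real (B_count \<theta> (exp R) z) - Y * (d * c * M) = (real (B_count \<theta> (exp R) z) - d * (Y * tent_sum b R t))
            + Y * (d * (tent_sum b R t - c * W)) + Y * (d * c * (W - M))" by (simp add: algebra_simps)
        also have "\<bar>\<dots>\<bar> \<le> \<bar>real (B_count \<theta> (exp R) z) - d * (Y * tent_sum b R t)\<bar> + \<bar>Y * (d * (tent_sum b R t - c * W))\<bar> + \<bar>Y * (d * c * (W - M))\<bar>"
          by linarith
        finally show ?thesis using Y0 d c by (simp add: abs_mult)
      qed
      also have "\<dots> \<le> Y * \<eta> * (2 * M) + Y * (1 * (C1 * (2 * G * \<eta>) * (2 * M))) + Y * (1 * Cb * (2 * (C6 * \<eta>) * M))"
      proof (intro add_mono mult_mono)
        show "\<bar>real (B_count \<theta> (exp R) z) - d * (Y * tent_sum b R t)\<bar> \<le> Y * \<eta> * (2 * M)"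
        proof (rule order_trans[OF E2])
          show "Y * \<eta> * W \<le> Y * \<eta> * (2 * M)" using WM Y0 \<eta>0 by (intro mult_left_mono) auto
        qed
        show "\<bar>tent_sum b R t - c * W\<bar> \<le> C1 * (2 * G * \<eta>) * (2 * M)"
        proof (rule order_trans[OF E1])
          show "C1 * (2 * G * \<eta>) * W \<le> C1 * (2 * G * \<eta>) * (2 * M)" using WM C1 G \<eta>0 by (intro mult_left_mono) auto
        qed
      qed (use Y0 d c WM M0 C6 \<eta>0 Cb in auto)
      also have "\<dots> = C * (Y * \<eta> * M)" by (simp add: C_def algebra_simps)
      finally have "\<bar>real (B_count \<theta> (exp R) z) - Y * (d * c * M)\<bar> \<le> C * (Y * \<eta> * M)" .
      moreover have "Y * (d * c * M) = z * (exp (\<theta> * R) * (d * c * M))" "Y * \<eta> * M = z * exp (\<theta> * R) * \<eta> * M"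
        by (simp_all add: Y_def)
      ultimately have "\<bar>real (B_count \<theta> (exp R) z) - z * (exp (\<theta> * R) * (d * c * M))\<bar> \<le> C * (z * exp (\<theta> * R) * \<eta> * M)"
        by (simp only:)
      thus "\<bar>real (B_count \<theta> (exp R) z) - z * (exp (\<theta> * R) * (sieve_density (primes_upto (exp R)) *
        (fejer_mean_value b (nat \<lceil>(w * R)^3\<rceil>) / 3) * weight_sum {2} (w * R)))\<bar>
         \<le> C * (z * exp (\<theta> * R) * sqrt (ln R / R) * weight_sum {2} (w * R))"
        unfolding d_def c_def M_def P_def N_def t1_def \<eta>_def .
    qed
  qed
  thus ?thesis using C0 unfolding w_def by blast
qed

theorem theorem4:
  fixes \<theta> A :: real
  assumes "0 < \<theta>" and "\<theta> < 1" and "A > 0"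
  shows "\<exists>x0 C. C > 0 \<and> (\<forall>x z. x \<ge> x0 \<longrightarrow> z > 0 \<longrightarrow> \<bar>ln z\<bar> \<le> A * ln (ln x) \<longrightarrow>
           \<bar>real (B_count \<theta> x z) - z * real (S_count \<theta> x)\<bar>
             \<le> C * z * real (S_count \<theta> x) * sqrt (ln (ln x) / ln x))"
proof -
  define b where "b = \<theta> / (1 - \<theta>)"
  have b0: "b > 0" using assms by (simp add: b_def)
  define m where "m R = sieve_density (primes_upto (exp R)) * (fejer_mean_value b (nat \<lceil>((1 - \<theta>) * R)^3\<rceil>) / 3)" for R
  define W where "W R = weight_sum {2} ((1 - \<theta>) * R)" for R
  obtain C where C: "C > 0" and ev: "\<forall>\<^sub>F R in at_top. \<forall>z>0. \<bar>ln z\<bar> \<le> A * ln R \<longrightarrow>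
     \<bar>real (B_count \<theta> (exp R) z) - z * (exp (\<theta> * R) * (m R * W R))\<bar> \<le> C * (z * exp (\<theta> * R) * sqrt (ln R / R) * W R)"
    using B_count_asymp[OF assms b_def] unfolding m_def W_def by blast
  have ev2: "\<forall>\<^sub>F R in at_top. C * sqrt (ln R / R) < 1/12"
  proof (rule order_tendstoD(2))
    show "((\<lambda>R. C * sqrt (ln R / R)) \<longlongrightarrow> 0) at_top" by real_asymp
  qed auto
  have ev3: "\<forall>\<^sub>F R::real in at_top. ln R \<ge> 0" by real_asymp
  obtain T where T: "\<And>R z. R \<ge> T \<Longrightarrow> z > 0 \<Longrightarrow> \<bar>ln z\<bar> \<le> A * ln R \<Longrightarrow>
       \<bar>real (B_count \<theta> (exp R) z) - z * (exp (\<theta> * R) * (m R * W R))\<bar> \<le> C * (z * exp (\<theta> * R) * sqrt (ln R / R) * W R)"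
     "\<And>R. R \<ge> T \<Longrightarrow> C * sqrt (ln R / R) < 1/12" "\<And>R. R \<ge> T \<Longrightarrow> ln R \<ge> 0"
    using eventually_conj[OF ev eventually_conj[OF ev2 ev3]] unfolding eventually_at_top_linorder by blast
  \<comment> \<open>The second entry ensures (1 - \<theta>) R \<ge> 1, so that the sampling
    parameter is at least 1.\<close>
  define T' where "T' = max T (1 / (1 - \<theta>) + 1)"
  have "\<bar>real (B_count \<theta> x z) - z * real (S_count \<theta> x)\<bar> \<le> (24 * C) * z * real (S_count \<theta> x) * sqrt (ln (ln x) / ln x)"
    if x: "x \<ge> exp T'" and z: "z > 0" and zA: "\<bar>ln z\<bar> \<le> A * ln (ln x)" for x z
  proof -
    have x0: "x > 0" using x exp_gt_zero less_le_trans by blast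
    define R where "R = ln x"
    have xR: "x = exp R" using x0 by (simp add: R_def)
    have "T' \<le> R" using x x0 by (simp add: R_def ln_ge_iff)
    hence RT: "R \<ge> T" "R \<ge> 1 / (1 - \<theta>) + 1" by (auto simp: T'_def)
    define \<eta> where "\<eta> = sqrt (ln R / R)"
    define E where "E = exp (\<theta> * R)"
    have R1: "(1 - \<theta>) * R \<ge> 1"
    proof -
      have "(1 - \<theta>) * (1 / (1 - \<theta>)) \<le> (1 - \<theta>) * R" using RT assms by (intro mult_left_mono) auto
      thus ?thesis using assms by simp
    qed
    \<comment> \<open>Since S is the case z = 1, one asymptotic formula covers both counts.\<close>
    have S: "S_count \<theta> x = B_count \<theta> x 1" by (simp add: S_count_def B_count_def)
    have B: "\<bar>real (B_count \<theta> x z) - z * (E * (m R * W R))\<bar> \<le> C * (z * E * \<eta> * W R)"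
      using T(1)[OF RT(1) z] zA unfolding xR E_def \<eta>_def by simp
    have S1: "\<bar>real (S_count \<theta> x) - E * (m R * W R)\<bar> \<le> C * (E * \<eta> * W R)"
    proof -
      have "0 \<le> A * ln R" using T(3)[OF RT(1)] assms(3) by simp
      moreover have "real (S_count \<theta> x) = real (B_count \<theta> (exp R) 1)" using S xR by simp
      ultimately show ?thesis using T(1)[OF RT(1), of 1] unfolding E_def \<eta>_def by simp
    qed
    have m: "m R \<ge> 1/6"
    proof -
      have "((1 - \<theta>) * R)^3 \<ge> 1" using R1 by (intro one_le_power)
      hence "nat \<lceil>((1 - \<theta>) * R)^3\<rceil> \<ge> 1" by linarith
      from fejer_coeff_0_bounds(2)[OF b0 this]
      have "fejer_mean_value b (nat \<lceil>((1 - \<theta>) * R)^3\<rceil>) / 3 \<ge> 1/3" by (simp add: fejer_mean_value_def)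
      moreover have "sieve_density (primes_upto (exp R)) \<ge> 1/2"
        by (rule sieve_density_bounds) (auto simp: primes_upto_def)
      ultimately have "(1/2) * (1/3) \<le> m R" unfolding m_def by (intro mult_mono) auto
      thus ?thesis by simp
    qed
    have EW: "E * W R \<ge> 0" by (simp add: E_def W_def)
    have "C * \<eta> < 1/12" using T(2)[OF RT(1)] by (simp add: \<eta>_def)
    hence "C * \<eta> * (E * W R) \<le> 1/12 * (E * W R)" using EW by (intro mult_right_mono) auto
    moreover have "1/6 * (E * W R) \<le> m R * (E * W R)" using m EW by (intro mult_right_mono) auto
    moreover have "m R * (E * W R) - C * \<eta> * (E * W R) \<le> real (S_count \<theta> x)"
    proof -
      have "E * (m R * W R) = m R * (E * W R)" "C * (E * \<eta> * W R) = C * \<eta> * (E * W R)" by simp_all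
      thus ?thesis using S1 by linarith
    qed
    \<comment> \<open>This turns an error measured by E W into one measured by S: the main term is
      at least E W / 6, the product of 1/2 for the sieve and 1/3 for the mean, and the error is at
      most E W / 12.\<close>
    ultimately have low: "E * W R \<le> 12 * real (S_count \<theta> x)" by linarith
    have "\<bar>real (B_count \<theta> x z) - z * real (S_count \<theta> x)\<bar> \<le>
        \<bar>real (B_count \<theta> x z) - z * (E * (m R * W R))\<bar> + \<bar>z * (real (S_count \<theta> x) - E * (m R * W R))\<bar>"
      by (simp add: right_diff_distrib)
    also have "\<bar>z * (real (S_count \<theta> x) - E * (m R * W R))\<bar> = z * \<bar>real (S_count \<theta> x) - E * (m R * W R)\<bar>" using z by (simp add: abs_mult)
    also have "\<bar>real (B_count \<theta> x z) - z * (E * (m R * W R))\<bar> + z * \<bar>real (S_count \<theta> x) - E * (m R * W R)\<bar> \<le>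
        C * (z * E * \<eta> * W R) + z * (C * (E * \<eta> * W R))"
      using B S1 z by (intro add_mono mult_left_mono) auto
    also have "\<dots> = 2 * C * z * \<eta> * (E * W R)" by simp
    also have "\<dots> \<le> 2 * C * z * \<eta> * (12 * real (S_count \<theta> x))"
    proof (rule mult_left_mono[OF low])
      have "\<eta> \<ge> 0" unfolding \<eta>_def using T(3)[OF RT(1)] RT(2) assms by (intro real_sqrt_ge_zero divide_nonneg_nonneg) (auto intro: order_trans[rotated])
      thus "0 \<le> 2 * C * z * \<eta>" using C z by simp
    qed
    also have "\<dots> = (24 * C) * z * real (S_count \<theta> x) * sqrt (ln (ln x) / ln x)" by (simp add: \<eta>_def R_def)
    finally show ?thesis .
  qed
  thus ?thesis using C by (intro exI[of _ "exp T'"] exI[of _ "24 * C"]) auto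
qed

end
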